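(* Let $\Lambda$ and $\Gamma$ be artin algebras and let ${}_{\Lambda}U_{\Gamma}$ be a faithfully balanced selforthogonal bimodule. Then $$U\text{-dom.dim}({}_{\Lambda}U)=U\text{-dom.dim}(U_{\Gamma}).$$
   Context: $\mathrm{mod}\,\Lambda$ (resp. $\mathrm{mod}\,\Gamma^{op}$) denotes the category of finitely generated left $\Lambda$-modules (resp. right $\Gamma$-modules). A bimodule ${}_{\Lambda}U_{\Gamma}$ is faithfully balanced selforthogonal if: (1) ${}_{\Lambda}U\in\mathrm{mod}\,\Lambda$ and $U_{\Gamma}\in\mathrm{mod}\,\Gamma^{op}$; (2) the natural maps $\Lambda\to\mathrm{End}(U_{\Gamma})$ and $\Gamma\to\mathrm{End}({}_{\Lambda}U)^{op}$ are isomorphisms; (3) $\mathrm{Ext}^{i}_{\Lambda}({}_{\Lambda}U,{}_{\Lambda}U)=0$ and $\mathrm{Ext}^{i}_{\Gamma}(U_{\Gamma},U_{\Gamma})=0$ for all $i\geq 1$. For $M$ in $\mathrm{mod}\,\Lambda$ (resp. $\mathrm{mod}\,\Gamma^{op}$) and an integer $n\ge 0$, one writes $U\text{-dom.dim}(M)\geq n$ if each of the first $n$ terms in a minimal injective resolution $0\to M\to I_0\to I_1\to\cdots$ of $M$ (that is, $I_0,\dots,I_{n-1}$) is cogenerated by ${}_{\Lambda}U$ (resp. $U_{\Gamma}$), i.e. can be embedded into a direct product of copies of ${}_{\Lambda}U$ (resp. $U_{\Gamma}$). $U\text{-dom.dim}(M)\in\{0,1,2,\dots\}\cup\{\infty\}$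 is the supremum of all $n$ with $U\text{-dom.dim}(M)\ge n$. *)

theory Defs
  imports "HOL-Algebra.Algebra" "HOL-Library.Extended_Nat"
begin

section \<open>Rings and artin algebras\<close>

definition opp_ring :: "'r ring \<Rightarrow> 'r ring" where
  "opp_ring R = R\<lparr>monoid.mult := \<lambda>x y. y \<otimes>\<^bsub>R\<^esub> x\<rparr>"

definition artinian_cring :: "'k ring \<Rightarrow> bool" where
  "artinian_cring k \<longleftrightarrow> cring k \<and>
     (\<forall>I :: nat \<Rightarrow> 'k set. (\<forall>n. ideal (I n) k \<and> I (Suc n) \<subseteq> I n) \<longrightarrow> (\<exists>n. \<forall>m\<ge>n. I m = I n))"

text \<open>The library's locale \<open>module\<close> requires a commutative ring of scalars. Over an arbitrary
  ring we keep its record type; the fields \<open>mult\<close> and \<open>one\<close> of a module are never used.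
  Right modules over a ring are left modules over its opposite ring.\<close>

locale left_module = R?: ring R + M?: abelian_group M
  for R :: "'r ring" (structure) and M :: "('r, 'a) module" (structure) +
  assumes act_closed: "\<lbrakk>a \<in> carrier R; x \<in> carrier M\<rbrakk> \<Longrightarrow> a \<odot>\<^bsub>M\<^esub> x \<in> carrier M"
    and act_l_distr: "\<lbrakk>a \<in> carrier R; b \<in> carrier R; x \<in> carrier M\<rbrakk> \<Longrightarrow>
      (a \<oplus>\<^bsub>R\<^esub> b) \<odot>\<^bsub>M\<^esub> x = a \<odot>\<^bsub>M\<^esub> x \<oplus>\<^bsub>M\<^esub> b \<odot>\<^bsub>M\<^esub> x"
    and act_r_distr: "\<lbrakk>a \<in> carrier R; x \<in> carrier M; y \<in> carrier M\<rbrakk> \<Longrightarrow>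
      a \<odot>\<^bsub>M\<^esub> (x \<oplus>\<^bsub>M\<^esub> y) = a \<odot>\<^bsub>M\<^esub> x \<oplus>\<^bsub>M\<^esub> a \<odot>\<^bsub>M\<^esub> y"
    and act_assoc: "\<lbrakk>a \<in> carrier R; b \<in> carrier R; x \<in> carrier M\<rbrakk> \<Longrightarrow>
      (a \<otimes>\<^bsub>R\<^esub> b) \<odot>\<^bsub>M\<^esub> x = a \<odot>\<^bsub>M\<^esub> (b \<odot>\<^bsub>M\<^esub> x)"
    and act_one: "x \<in> carrier M \<Longrightarrow> \<one>\<^bsub>R\<^esub> \<odot>\<^bsub>M\<^esub> x = x"

definition fin_gen :: "'r ring \<Rightarrow> ('r, 'a) module \<Rightarrow> bool" where
  "fin_gen R M \<longleftrightarrow> left_module R M \<and>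
     (\<exists>S. finite S \<and> S \<subseteq> carrier M \<and>
       (\<forall>x \<in> carrier M. \<exists>c \<in> S \<rightarrow> carrier R. x = (\<Oplus>\<^bsub>M\<^esub>s\<in>S. c s \<odot>\<^bsub>M\<^esub> s)))"

text \<open>\<open>A\<close>, regarded as a module over \<open>k\<close> along \<open>\<phi> : k \<rightarrow> A\<close>.\<close>

definition scalar_module :: "('k \<Rightarrow> 'r) \<Rightarrow> 'r ring \<Rightarrow> ('k, 'r) module" where
  "scalar_module \<phi> A = \<lparr>carrier = carrier A, monoid.mult = monoid.mult A, monoid.one = monoid.one A,
     ring.zero = ring.zero A, ring.add = ring.add A,
     smult = (\<lambda>a x. \<phi> a \<otimes>\<^bsub>A\<^esub> x)\<rparr>"

definition artin_algebra :: "'k ring \<Rightarrow> ('k \<Rightarrow> 'r) \<Rightarrow> 'r ring \<Rightarrow> bool" where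
  "artin_algebra k \<phi> A \<longleftrightarrow> artinian_cring k \<and> ring A \<and> \<phi> \<in> ring_hom k A \<and>
     (\<forall>a \<in> carrier k. \<forall>x \<in> carrier A. \<phi> a \<otimes>\<^bsub>A\<^esub> x = x \<otimes>\<^bsub>A\<^esub> \<phi> a) \<and>
     fin_gen k (scalar_module \<phi> A)"

section \<open>Homomorphisms\<close>

text \<open>Homomorphisms are extensional functions, so that equality of homomorphisms is
  equality in HOL.\<close>

definition mhom :: "'r ring \<Rightarrow> ('r, 'a) module \<Rightarrow> ('r, 'b) module \<Rightarrow> ('a \<Rightarrow> 'b) set" where
  "mhom R M N = {f \<in> carrier M \<rightarrow>\<^sub>E carrier N.
     (\<forall>x \<in> carrier M. \<forall>y \<in> carrier M. f (x \<oplus>\<^bsub>M\<^esub> y) = f x \<oplus>\<^bsub>N\<^esub> f y) \<and>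
     (\<forall>a \<in> carrier R. \<forall>x \<in> carrier M. f (a \<odot>\<^bsub>M\<^esub> x) = a \<odot>\<^bsub>N\<^esub> f x)}"

definition zero_hom :: "('r, 'a) module \<Rightarrow> ('r, 'b) module \<Rightarrow> 'a \<Rightarrow> 'b" where
  "zero_hom M N = (\<lambda>x \<in> carrier M. \<zero>\<^bsub>N\<^esub>)"

definition add_hom ::
  "('r, 'a) module \<Rightarrow> ('r, 'b) module \<Rightarrow> ('a \<Rightarrow> 'b) \<Rightarrow> ('a \<Rightarrow> 'b) \<Rightarrow> 'a \<Rightarrow> 'b" where
  "add_hom M N f g = (\<lambda>x \<in> carrier M. f x \<oplus>\<^bsub>N\<^esub> g x)"

definition end_ring :: "'r ring \<Rightarrow> ('r, 'a) module \<Rightarrow> ('a \<Rightarrow> 'a) ring" where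
  "end_ring R M = \<lparr>carrier = mhom R M M, monoid.mult = compose (carrier M), monoid.one = (\<lambda>x \<in> carrier M. x),
     ring.zero = zero_hom M M, ring.add = add_hom M M\<rparr>"

definition hom_group :: "'r ring \<Rightarrow> ('r, 'a) module \<Rightarrow> ('r, 'b) module \<Rightarrow> ('a \<Rightarrow> 'b) monoid" where
  "hom_group R M N = \<lparr>carrier = mhom R M N, monoid.mult = add_hom M N, monoid.one = zero_hom M N\<rparr>"

section \<open>Projective and injective modules\<close>

text \<open>HOL cannot quantify over types inside a definition, so the test modules in the lifting and
  extension properties are carried by subsets of the type \<open>nat \<Rightarrow> 'r\<close>. Every countably generated
  \<open>R\<close>-module has an isomorphic copy there: a quotient of the free module on countably many
  generators can be transported to a set of representatives in \<open>nat \<Rightarrow> 'r\<close>. In particular all left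
  ideals and the regular module occur, so by Baer's criterion \<open>injective\<close> below is
  injectivity with respect to all modules. A projective resolution of any finitely generated
  module by countably generated free modules occurs too, and for a module \<open>P\<close> carried by this
  type the free module on \<open>carrier P\<close> also has a copy in it, so for such \<open>P\<close>
  \<open>projective\<close> is projectivity with respect to all modules.\<close>

type_synonym 'r univ = "nat \<Rightarrow> 'r"

definition projective :: "'r ring \<Rightarrow> ('r, 'a) module \<Rightarrow> bool" where
  "projective R P \<longleftrightarrow> left_module R P \<and>
     (\<forall>(A :: ('r, 'r univ) module) (B :: ('r, 'r univ) module) f g.
        left_module R A \<and> left_module R B \<and>
        f \<in> mhom R A B \<and> f ` carrier A = carrier B \<and> g \<in> mhom R P B \<longrightarrow>
        (\<exists>h \<in> mhom R P A. compose (carrier P) f h = g))"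

definition injective :: "'r ring \<Rightarrow> ('r, 'a) module \<Rightarrow> bool" where
  "injective R E \<longleftrightarrow> left_module R E \<and>
     (\<forall>(A :: ('r, 'r univ) module) (B :: ('r, 'r univ) module) f g.
        left_module R A \<and> left_module R B \<and>
        f \<in> mhom R A B \<and> inj_on f (carrier A) \<and> g \<in> mhom R A E \<longrightarrow>
        (\<exists>h \<in> mhom R B E. compose (carrier A) h f = g))"

section \<open>Ext\<close>

text \<open>\<open>\<dots> \<rightarrow> P 1 \<rightarrow> P 0 \<rightarrow> M \<rightarrow> 0\<close> with \<open>d n : P (n + 1) \<rightarrow> P n\<close> and augmentation \<open>e\<close>.\<close>

definition projective_resolution ::
  "'r ring \<Rightarrow> ('r, 'a) module \<Rightarrow> (nat \<Rightarrow> ('r, 'b) module) \<Rightarrow> (nat \<Rightarrow> 'b \<Rightarrow> 'b) \<Rightarrow> ('b \<Rightarrow> 'a) \<Rightarrow> bool"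
where
  "projective_resolution R M P d e \<longleftrightarrow>
     left_module R M \<and> (\<forall>n. projective R (P n)) \<and>
     e \<in> mhom R (P 0) M \<and> (\<forall>n. d n \<in> mhom R (P (Suc n)) (P n)) \<and>
     e ` carrier (P 0) = carrier M \<and>
     d 0 ` carrier (P 1) = a_kernel (P 0) M e \<and>
     (\<forall>n. d (Suc n) ` carrier (P (Suc (Suc n))) = a_kernel (P (Suc n)) (P n) (d n))"

definition cocycles ::
  "'r ring \<Rightarrow> (nat \<Rightarrow> ('r, 'b) module) \<Rightarrow> (nat \<Rightarrow> 'b \<Rightarrow> 'b) \<Rightarrow> ('r, 'c) module \<Rightarrow> nat \<Rightarrow> ('b \<Rightarrow> 'c) set"
where
  "cocycles R P d N n = {f \<in> mhom R (P n) N.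
     compose (carrier (P (Suc n))) f (d n) = zero_hom (P (Suc n)) N}"

primrec coboundaries ::
  "'r ring \<Rightarrow> (nat \<Rightarrow> ('r, 'b) module) \<Rightarrow> (nat \<Rightarrow> 'b \<Rightarrow> 'b) \<Rightarrow> ('r, 'c) module \<Rightarrow> nat \<Rightarrow> ('b \<Rightarrow> 'c) set"
where
  "coboundaries R P d N 0 = {zero_hom (P 0) N}"
| "coboundaries R P d N (Suc n) =
     (\<lambda>g. compose (carrier (P (Suc n))) g (d n)) ` mhom R (P n) N"

definition ext_group ::
  "'r ring \<Rightarrow> (nat \<Rightarrow> ('r, 'b) module) \<Rightarrow> (nat \<Rightarrow> 'b \<Rightarrow> 'b) \<Rightarrow> ('r, 'c) module \<Rightarrow> nat \<Rightarrow> ('b \<Rightarrow> 'c) set monoid"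
where
  "ext_group R P d N n =
     (hom_group R (P n) N)\<lparr>carrier := cocycles R P d N n\<rparr> Mod coboundaries R P d N n"

text \<open>Up to isomorphism \<open>ext_group\<close> does not depend on the resolution; vanishing is stated for
  every projective resolution, and finitely (or countably) generated \<open>M\<close> have one with
  terms in \<open>'r univ\<close>.\<close>

definition ext_vanishes :: "'r ring \<Rightarrow> ('r, 'a) module \<Rightarrow> ('r, 'c) module \<Rightarrow> nat \<Rightarrow> bool" where
  "ext_vanishes R M N n \<longleftrightarrow>
     (\<forall>(P :: nat \<Rightarrow> ('r, 'r univ) module) d e.
        projective_resolution R M P d e \<longrightarrow> trivial_group (ext_group R P d N n))"

section \<open>Faithfully balanced selforthogonal bimodules\<close>

record ('l, 'g, 'u) bimod = "'u ring" +
  lact :: "'l \<Rightarrow> 'u \<Rightarrow> 'u"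
  ract :: "'u \<Rightarrow> 'g \<Rightarrow> 'u"

definition left_mod :: "('l, 'g, 'u) bimod \<Rightarrow> ('l, 'u) module" where
  "left_mod U = \<lparr>carrier = carrier U, monoid.mult = monoid.mult U, monoid.one = monoid.one U,
     ring.zero = ring.zero U, ring.add = ring.add U,
     smult = lact U\<rparr>"

definition right_mod :: "('l, 'g, 'u) bimod \<Rightarrow> ('g, 'u) module" where
  "right_mod U = \<lparr>carrier = carrier U, monoid.mult = monoid.mult U, monoid.one = monoid.one U,
     ring.zero = ring.zero U, ring.add = ring.add U,
     smult = (\<lambda>g u. ract U u g)\<rparr>"

definition bimodule :: "'l ring \<Rightarrow> 'g ring \<Rightarrow> ('l, 'g, 'u) bimod \<Rightarrow> bool" where
  "bimodule L G U \<longleftrightarrow> ring L \<and> ring G \<and>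
     left_module L (left_mod U) \<and> left_module (opp_ring G) (right_mod U) \<and>
     (\<forall>a \<in> carrier L. \<forall>u \<in> carrier U. \<forall>g \<in> carrier G. ract U (lact U a u) g = lact U a (ract U u g))"

definition faithfully_balanced_selforthogonal ::
  "'l ring \<Rightarrow> 'g ring \<Rightarrow> ('l, 'g, 'u) bimod \<Rightarrow> bool" where
  "faithfully_balanced_selforthogonal L G U \<longleftrightarrow>
     bimodule L G U \<and>
     fin_gen L (left_mod U) \<and> fin_gen (opp_ring G) (right_mod U) \<and>
     (\<lambda>a. \<lambda>u \<in> carrier U. lact U a u) \<in> ring_iso L (end_ring (opp_ring G) (right_mod U)) \<and>
     (\<lambda>g. \<lambda>u \<in> carrier U. ract U u g) \<in> ring_iso G (opp_ring (end_ring L (left_mod U))) \<and>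
     (\<forall>i\<ge>1. ext_vanishes L (left_mod U) (left_mod U) i) \<and>
     (\<forall>i\<ge>1. ext_vanishes (opp_ring G) (right_mod U) (right_mod U) i)"

section \<open>Minimal injective resolutions and dominant dimension\<close>

definition essential :: "'r ring \<Rightarrow> ('r, 'a) module \<Rightarrow> 'a set \<Rightarrow> bool" where
  "essential R E N \<longleftrightarrow> submodule N R E \<and>
     (\<forall>K. submodule K R E \<and> K \<noteq> {\<zero>\<^bsub>E\<^esub>} \<longrightarrow> N \<inter> K \<noteq> {\<zero>\<^bsub>E\<^esub>})"

text \<open>\<open>0 \<rightarrow> M \<rightarrow> I 0 \<rightarrow> I 1 \<rightarrow> \<dots>\<close> with coaugmentation \<open>e\<close> and \<open>d n : I n \<rightarrow> I (n + 1)\<close>.\<close>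

definition injective_resolution ::
  "'r ring \<Rightarrow> ('r, 'a) module \<Rightarrow> (nat \<Rightarrow> ('r, 'b) module) \<Rightarrow> (nat \<Rightarrow> 'b \<Rightarrow> 'b) \<Rightarrow> ('a \<Rightarrow> 'b) \<Rightarrow> bool"
where
  "injective_resolution R M I d e \<longleftrightarrow>
     left_module R M \<and> (\<forall>n. injective R (I n)) \<and>
     e \<in> mhom R M (I 0) \<and> (\<forall>n. d n \<in> mhom R (I n) (I (Suc n))) \<and>
     inj_on e (carrier M) \<and>
     e ` carrier M = a_kernel (I 0) (I 1) (d 0) \<and>
     (\<forall>n. d n ` carrier (I n) = a_kernel (I (Suc n)) (I (Suc (Suc n))) (d (Suc n)))"

text \<open>Minimality: \<open>I 0\<close> is an injective envelope of \<open>M\<close> and \<open>I (n + 1)\<close> is an injective envelope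
  of the image of \<open>d n\<close>.\<close>

definition minimal_injective_resolution ::
  "'r ring \<Rightarrow> ('r, 'a) module \<Rightarrow> (nat \<Rightarrow> ('r, 'b) module) \<Rightarrow> (nat \<Rightarrow> 'b \<Rightarrow> 'b) \<Rightarrow> ('a \<Rightarrow> 'b) \<Rightarrow> bool"
where
  "minimal_injective_resolution R M I d e \<longleftrightarrow>
     injective_resolution R M I d e \<and>
     essential R (I 0) (e ` carrier M) \<and>
     (\<forall>n. essential R (I (Suc n)) (d n ` carrier (I n)))"

definition power_module :: "'x set \<Rightarrow> ('r, 'u) module \<Rightarrow> ('r, 'x \<Rightarrow> 'u) module" where
  "power_module S U = \<lparr>carrier = S \<rightarrow>\<^sub>E carrier U, monoid.mult = undefined, monoid.one = undefined,
     ring.zero = (\<lambda>x \<in> S. \<zero>\<^bsub>U\<^esub>), ring.add = (\<lambda>v w. \<lambda>x \<in> S. v x \<oplus>\<^bsub>U\<^esub> w x),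
     smult = (\<lambda>a v. \<lambda>x \<in> S. a \<odot>\<^bsub>U\<^esub> v x)\<rparr>"

text \<open>The index type \<open>'a \<Rightarrow> 'u\<close> loses no generality: an embedding of \<open>M\<close> into a power of \<open>U\<close> is a
  family of homomorphisms \<open>M \<rightarrow> U\<close>, and repeated members can be dropped.\<close>

definition cogenerated :: "'r ring \<Rightarrow> ('r, 'u) module \<Rightarrow> ('r, 'a) module \<Rightarrow> bool" where
  "cogenerated R U M \<longleftrightarrow>
     (\<exists>(S :: ('a \<Rightarrow> 'u) set) f. f \<in> mhom R M (power_module S U) \<and> inj_on f (carrier M))"

text \<open>The \<open>U\<close>-dominant dimension of a module, computed from the terms \<open>I\<close> of a minimal injective
  resolution of it. The choice is immaterial, as such a resolution is unique up to isomorphism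
  and cogeneration by \<open>U\<close> is invariant under isomorphism. The elements of the \<open>I k\<close> may live in any
  type, so a theorem about an arbitrary minimal injective resolution \<open>I\<close> is not tied to
  a universe.\<close>

definition dom_dim_ge ::
  "'r ring \<Rightarrow> ('r, 'u) module \<Rightarrow> (nat \<Rightarrow> ('r, 'b) module) \<Rightarrow> nat \<Rightarrow> bool" where
  "dom_dim_ge R U I n \<longleftrightarrow> (\<forall>k<n. cogenerated R U (I k))"

definition dom_dim :: "'r ring \<Rightarrow> ('r, 'u) module \<Rightarrow> (nat \<Rightarrow> ('r, 'b) module) \<Rightarrow> enat" where
  "dom_dim R U I = Sup {enat n | n. dom_dim_ge R U I n}"

end

theory Submission
  imports Defs
begin

text \<open>
  By symmetry it suffices to show: if the first \<open>n\<close> terms of the injective resolution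
  \<open>I\<^sub>0 \<rightarrow> I\<^sub>1 \<rightarrow> \<dots>\<close> of \<open>U\<close> over \<open>\<Lambda>\<close> are cogenerated by \<open>U\<close>, then so are those of the minimal
  injective resolution \<open>J\<^sub>0 \<rightarrow> J\<^sub>1 \<rightarrow> \<dots>\<close> over \<open>\<Gamma>\<close>.

  Call a cyclic module torsion if it has no nonzero homomorphism to \<open>U\<close>. A torsion module \<open>T\<close> has no
  nonzero homomorphism to a module cogenerated by \<open>U\<close>, so dimension shifting along the \<open>I\<^sub>b\<close> gives
  \<open>Ext\<^sup>a(T, U) = 0\<close> for \<open>a < n\<close> over \<open>\<Lambda>\<close>. Now resolve a torsion module over \<open>\<Gamma>\<close> by finitely
  generated free modules and dualize into \<open>U\<close>. Cyclic submodules of the cohomology of the dual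
  complex are torsion over \<open>\<Lambda>\<close>, because a homomorphism to \<open>U \<subseteq> I\<^sub>0\<close> extends to a power of \<open>U\<close>, and
  from there it maps to \<open>U\<close> by elements of \<open>\<Gamma>\<close>. As the terms of the dual complex are powers of \<open>U\<close>,
  the vanishing of \<open>Ext\<close> over \<open>\<Lambda>\<close> would split the first nonzero cohomology off inside such a power,
  so cohomology vanishes in degrees below \<open>n\<close>. Hence \<open>Ext\<^sup>a(T, U) = 0\<close> for \<open>a < n\<close> over \<open>\<Gamma>\<close> as
  well, and shifting dimensions along the \<open>J\<^sub>b\<close> shows inductively that no nonzero element of
  \<open>J\<^sub>k\<close> with \<open>k < n\<close> is killed by all homomorphisms to \<open>U\<close>. For \<open>J\<^sub>0\<close> itself homomorphisms to \<open>U\<close>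
  are constructed by solving linear equations in the artinian, hence linearly compact,
  \<open>\<Lambda>\<close>-module \<open>U\<close>.
\<close>

section \<open>Linear combinations\<close>

text \<open>All finiteness is drawn from U being artinian over both rings \<open>R\<close> and
  \<open>S\<close>. Where a noetherian ring would offer finitely many generators, this offers
  finitely many equations with the right solutions in U; and where terms of an injective resolution
  are too large for finite methods, it offers compactness. The two sides meet in one observation.
  For a free S-module of rank m, the homomorphisms to U are the tuples in U^m. These form an
  R-module, and matrices over S act on them R-linearly. Dualizing a complex over S therefore gives a
  complex over R whose terms are powers of U, and vanishing of Ext over R can be applied to it.
  Everything is done in coordinates, without quotient modules or Ext groups: a complex is a family
  of matrices, a cyclic module is represented by the elements annihilating its generator, and
  vanishing of Ext with values in C is solvability of linear equations in C, whatever type carries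
  C. Cyclic modules suffice because a failure of cogeneration is witnessed by a single
  element.\<close>

definition lincomb :: "('r, 'a) module \<Rightarrow> 'i set \<Rightarrow> ('i \<Rightarrow> 'r) \<Rightarrow> ('i \<Rightarrow> 'a) \<Rightarrow> 'a" where
  "lincomb M F p c = (\<Oplus>\<^bsub>M\<^esub>i\<in>F. p i \<odot>\<^bsub>M\<^esub> c i)"

context left_module
begin

lemma act_zero_right: "a \<in> carrier R \<Longrightarrow> a \<odot>\<^bsub>M\<^esub> \<zero>\<^bsub>M\<^esub> = \<zero>\<^bsub>M\<^esub>"
  using act_r_distr[of a "\<zero>\<^bsub>M\<^esub>" "\<zero>\<^bsub>M\<^esub>"] act_closed[of a "\<zero>\<^bsub>M\<^esub>"]
  by (metis M.add.l_cancel_one' M.add.one_closed M.l_zero)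

lemma act_zero_left: "x \<in> carrier M \<Longrightarrow> \<zero> \<odot>\<^bsub>M\<^esub> x = \<zero>\<^bsub>M\<^esub>"
  using act_l_distr[of \<zero> \<zero> x] act_closed[of \<zero> x]
  by (metis M.add.l_cancel_one' R.l_zero R.zero_closed)

lemma act_minus_left: "a \<in> carrier R \<Longrightarrow> x \<in> carrier M \<Longrightarrow> (\<ominus> a) \<odot>\<^bsub>M\<^esub> x = \<ominus>\<^bsub>M\<^esub> (a \<odot>\<^bsub>M\<^esub> x)"
  using act_l_distr[of "\<ominus> a" a x] act_closed
  by (metis M.minus_equality R.a_inv_closed R.l_neg act_zero_left)

lemma act_minus_one: "x \<in> carrier M \<Longrightarrow> (\<ominus> \<one>) \<odot>\<^bsub>M\<^esub> x = \<ominus>\<^bsub>M\<^esub> x"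
  by (simp add: act_minus_left act_one)

lemma lincomb_closed:
  "p \<in> F \<rightarrow> carrier R \<Longrightarrow> c \<in> F \<rightarrow> carrier M \<Longrightarrow> lincomb M F p c \<in> carrier M"
  unfolding lincomb_def by (intro M.finsum_closed) (auto intro: act_closed)

lemma lincomb_cong:
  assumes "\<And>i. i \<in> F \<Longrightarrow> p i = p' i" "\<And>i. i \<in> F \<Longrightarrow> c i = c' i"
    "p' \<in> F \<rightarrow> carrier R" "c' \<in> F \<rightarrow> carrier M"
  shows "lincomb M F p c = lincomb M F p' c'"
  unfolding lincomb_def using assms by (intro M.finsum_cong') (auto intro: act_closed)

lemma lincomb_empty: "lincomb M {} p c = \<zero>\<^bsub>M\<^esub>"
  by (simp add: lincomb_def M.finsum_empty)

lemma lincomb_insert: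
  assumes "finite F" "k \<notin> F" "p \<in> insert k F \<rightarrow> carrier R" "c \<in> insert k F \<rightarrow> carrier M"
  shows "lincomb M (insert k F) p c = p k \<odot>\<^bsub>M\<^esub> c k \<oplus>\<^bsub>M\<^esub> lincomb M F p c"
  unfolding lincomb_def using assms by (intro M.finsum_insert) (auto intro: act_closed)

lemma lincomb_add:
  assumes "p \<in> F \<rightarrow> carrier R" "c \<in> F \<rightarrow> carrier M" "c' \<in> F \<rightarrow> carrier M"
  shows "lincomb M F p (\<lambda>i. c i \<oplus>\<^bsub>M\<^esub> c' i) = lincomb M F p c \<oplus>\<^bsub>M\<^esub> lincomb M F p c'"
proof -
  have "lincomb M F p (\<lambda>i. c i \<oplus>\<^bsub>M\<^esub> c' i) = (\<Oplus>\<^bsub>M\<^esub>i\<in>F. p i \<odot>\<^bsub>M\<^esub> c i \<oplus>\<^bsub>M\<^esub> p i \<odot>\<^bsub>M\<^esub> c' i)"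
    unfolding lincomb_def using assms
    by (intro M.finsum_cong') (auto simp: act_r_distr act_closed Pi_iff)
  then show ?thesis
    unfolding lincomb_def using assms by (subst (asm) M.finsum_addf) (auto intro: act_closed)
qed

lemma lincomb_add_left:
  assumes "p \<in> F \<rightarrow> carrier R" "q \<in> F \<rightarrow> carrier R" "c \<in> F \<rightarrow> carrier M"
  shows "lincomb M F (\<lambda>i. p i \<oplus> q i) c = lincomb M F p c \<oplus>\<^bsub>M\<^esub> lincomb M F q c"
proof -
  have "lincomb M F (\<lambda>i. p i \<oplus> q i) c = (\<Oplus>\<^bsub>M\<^esub>i\<in>F. p i \<odot>\<^bsub>M\<^esub> c i \<oplus>\<^bsub>M\<^esub> q i \<odot>\<^bsub>M\<^esub> c i)"
    unfolding lincomb_def using assms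
    by (intro M.finsum_cong') (auto simp: act_l_distr act_closed Pi_iff)
  then show ?thesis
    unfolding lincomb_def using assms by (subst (asm) M.finsum_addf) (auto intro: act_closed)
qed

lemma lincomb_zero:
  assumes "p \<in> F \<rightarrow> carrier R" "\<And>i. i \<in> F \<Longrightarrow> c i = \<zero>\<^bsub>M\<^esub>"
  shows "lincomb M F p c = \<zero>\<^bsub>M\<^esub>"
proof -
  have "lincomb M F p c = (\<Oplus>\<^bsub>M\<^esub>i\<in>F. \<zero>\<^bsub>M\<^esub>)"
    unfolding lincomb_def using assms by (intro M.finsum_cong') (auto simp: act_zero_right Pi_iff)
  then show ?thesis by (simp add: M.finsum_zero)
qed

lemma lincomb_zero_left:
  assumes "c \<in> F \<rightarrow> carrier M" "\<And>i. i \<in> F \<Longrightarrow> p i = \<zero>"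
  shows "lincomb M F p c = \<zero>\<^bsub>M\<^esub>"
proof -
  have "lincomb M F p c = (\<Oplus>\<^bsub>M\<^esub>i\<in>F. \<zero>\<^bsub>M\<^esub>)"
    unfolding lincomb_def using assms by (intro M.finsum_cong') (auto simp: act_zero_left Pi_iff)
  then show ?thesis by (simp add: M.finsum_zero)
qed

lemma lincomb_diff:
  assumes "p \<in> F \<rightarrow> carrier R" "c \<in> F \<rightarrow> carrier M" "c' \<in> F \<rightarrow> carrier M"
  shows "lincomb M F p (\<lambda>i. c i \<oplus>\<^bsub>M\<^esub> \<ominus>\<^bsub>M\<^esub> c' i) = lincomb M F p c \<oplus>\<^bsub>M\<^esub> \<ominus>\<^bsub>M\<^esub> lincomb M F p c'"
proof -
  have "lincomb M F p (\<lambda>i. \<ominus>\<^bsub>M\<^esub> c' i) \<oplus>\<^bsub>M\<^esub> lincomb M F p c' = lincomb M F p (\<lambda>i. \<ominus>\<^bsub>M\<^esub> c' i \<oplus>\<^bsub>M\<^esub> c' i)"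
    using assms by (intro lincomb_add[symmetric]) auto
  also have "\<dots> = \<zero>\<^bsub>M\<^esub>" using assms by (intro lincomb_zero) (auto simp: M.l_neg Pi_iff)
  finally have "\<ominus>\<^bsub>M\<^esub> lincomb M F p c' = lincomb M F p (\<lambda>i. \<ominus>\<^bsub>M\<^esub> c' i)"
    using assms by (intro M.minus_equality lincomb_closed) auto
  moreover have "lincomb M F p (\<lambda>i. c i \<oplus>\<^bsub>M\<^esub> \<ominus>\<^bsub>M\<^esub> c' i) =
      lincomb M F p c \<oplus>\<^bsub>M\<^esub> lincomb M F p (\<lambda>i. \<ominus>\<^bsub>M\<^esub> c' i)"
    using assms by (intro lincomb_add) auto
  ultimately show ?thesis by simp
qed

lemma act_lincomb:
  assumes "finite F" "a \<in> carrier R" "p \<in> F \<rightarrow> carrier R" "c \<in> F \<rightarrow> carrier M"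
  shows "a \<odot>\<^bsub>M\<^esub> lincomb M F p c = lincomb M F (\<lambda>i. a \<otimes> p i) c"
  using assms
proof (induction F)
  case empty
  then show ?case by (simp add: lincomb_empty act_zero_right)
next
  case (insert k F)
  then have "p k \<in> carrier R" "c k \<in> carrier M" "p \<in> F \<rightarrow> carrier R" "c \<in> F \<rightarrow> carrier M" by auto
  moreover have "(\<lambda>i. a \<otimes> p i) \<in> insert k F \<rightarrow> carrier R" using insert by auto
  ultimately show ?case
    using insert by (simp add: lincomb_insert act_r_distr act_closed lincomb_closed act_assoc)
qed

text \<open>Associativity of row times matrix times column. It makes the composite of two
  coboundaries vanish, and it turns a functional applied to the values of a matrix into a single row
  whose coefficients can be compared.\<close>

lemma lincomb_lincomb:
  assumes "finite F" "finite G" "p \<in> F \<rightarrow> carrier R" "\<And>i j. i \<in> G \<Longrightarrow> j \<in> F \<Longrightarrow> D i j \<in> carrier R"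
    "c \<in> G \<rightarrow> carrier M"
  shows "lincomb M F p (\<lambda>j. lincomb M G (\<lambda>i. D i j) c) =
    lincomb M G (\<lambda>i. \<Oplus>j\<in>F. p j \<otimes> D i j) c"
  using assms(1,3,4)
proof (induction F)
  case empty
  have "lincomb M G (\<lambda>i. \<zero>) c = \<zero>\<^bsub>M\<^esub>"
    using assms by (intro lincomb_zero_left) auto
  then show ?case by (simp add: lincomb_empty)
next
  case (insert k F)
  have p: "p k \<in> carrier R" "p \<in> F \<rightarrow> carrier R" and D: "\<And>i j. i \<in> G \<Longrightarrow> j \<in> F \<Longrightarrow> D i j \<in> carrier R"
    "\<And>i. i \<in> G \<Longrightarrow> D i k \<in> carrier R" using insert by auto
  have "lincomb M (insert k F) p (\<lambda>j. lincomb M G (\<lambda>i. D i j) c) =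
      p k \<odot>\<^bsub>M\<^esub> lincomb M G (\<lambda>i. D i k) c \<oplus>\<^bsub>M\<^esub> lincomb M F p (\<lambda>j. lincomb M G (\<lambda>i. D i j) c)"
    using insert.hyps insert.prems assms(5) by (intro lincomb_insert) (auto intro!: lincomb_closed)
  also have "\<dots> = lincomb M G (\<lambda>i. p k \<otimes> D i k) c \<oplus>\<^bsub>M\<^esub> lincomb M G (\<lambda>i. \<Oplus>j\<in>F. p j \<otimes> D i j) c"
    using insert.IH[OF p(2) D(1)] p D assms by (subst act_lincomb) auto
  also have "\<dots> = lincomb M G (\<lambda>i. p k \<otimes> D i k \<oplus> (\<Oplus>j\<in>F. p j \<otimes> D i j)) c"
    using p D assms by (intro lincomb_add_left[symmetric]) (auto intro!: R.finsum_closed)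
  also have "\<dots> = lincomb M G (\<lambda>i. \<Oplus>j\<in>insert k F. p j \<otimes> D i j) c"
    using insert.hyps p D assms(5)
    by (intro lincomb_cong) (auto simp: Pi_iff intro!: R.finsum_closed)
  finally show ?case .
qed

lemma lincomb_unit:
  assumes "finite F" "k \<in> F" "p \<in> F \<rightarrow> carrier R" "u \<in> carrier M"
  shows "lincomb M F p (\<lambda>i. if i = k then u else \<zero>\<^bsub>M\<^esub>) = p k \<odot>\<^bsub>M\<^esub> u"
proof -
  have "lincomb M F p (\<lambda>i. if i = k then u else \<zero>\<^bsub>M\<^esub>) = (\<Oplus>\<^bsub>M\<^esub>i\<in>F. if k = i then p i \<odot>\<^bsub>M\<^esub> u else \<zero>\<^bsub>M\<^esub>)"
    unfolding lincomb_def using assms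
    by (intro M.finsum_cong') (auto simp: act_zero_right Pi_iff intro: act_closed)
  also have "\<dots> = p k \<odot>\<^bsub>M\<^esub> u"
    using assms by (intro M.finsum_singleton) (auto intro: act_closed)
  finally show ?thesis .
qed

lemma lincomb_delta:
  assumes "finite F" "k \<in> F" "c \<in> F \<rightarrow> carrier M" "r \<in> carrier R"
  shows "lincomb M F (\<lambda>i. if i = k then r else \<zero>) c = r \<odot>\<^bsub>M\<^esub> c k"
proof -
  have "lincomb M F (\<lambda>i. if i = k then r else \<zero>) c = (\<Oplus>\<^bsub>M\<^esub>i\<in>F. if k = i then r \<odot>\<^bsub>M\<^esub> c i else \<zero>\<^bsub>M\<^esub>)"
    unfolding lincomb_def using assms by (intro M.finsum_cong') (auto simp: act_zero_left act_closed Pi_iff)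
  also have "\<dots> = r \<odot>\<^bsub>M\<^esub> c k"
    using assms by (intro M.finsum_singleton) (auto intro: act_closed)
  finally show ?thesis .
qed

lemma lincomb_unit_left:
  assumes "finite F" "k \<in> F" "c \<in> F \<rightarrow> carrier M"
  shows "lincomb M F (\<lambda>i. if i = k then \<one> else \<zero>) c = c k"
  using lincomb_delta[OF assms R.one_closed] assms(2,3) by (simp add: act_one Pi_iff)

lemma lincomb_superset:
  assumes "finite G" "F \<subseteq> G" "p \<in> F \<rightarrow> carrier R" "c \<in> G \<rightarrow> carrier M"
    "\<And>i. i \<in> G - F \<Longrightarrow> p i = \<zero>"
  shows "lincomb M G p c = lincomb M F p c"
  unfolding lincomb_def using assms
  by (intro M.add.finprod_mono_neutral_cong_right)
    (auto simp: act_zero_left Pi_iff intro: act_closed; metis DiffI R.zero_closed act_closed)+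

text \<open>Negatives come for free, being multiples by minus one.\<close>

lemma is_submodule_iff:
  "submodule H R M \<longleftrightarrow> H \<subseteq> carrier M \<and> \<zero>\<^bsub>M\<^esub> \<in> H \<and> (\<forall>x\<in>H. \<forall>y\<in>H. x \<oplus>\<^bsub>M\<^esub> y \<in> H) \<and>
    (\<forall>a\<in>carrier R. \<forall>x\<in>H. a \<odot>\<^bsub>M\<^esub> x \<in> H)" (is "?L \<longleftrightarrow> ?R")
proof
  assume ?L
  then interpret submodule H R M .
  show ?R using mem_carrier m_closed one_closed by auto
next
  assume r: ?R
  have "\<ominus>\<^bsub>M\<^esub> x \<in> H" if "x \<in> H" for x
    using r that act_minus_one[of x] by (metis R.a_inv_closed R.one_closed subsetD)
  then show ?L
    using r unfolding submodule_def submodule_axioms_def subgroup_def by (auto simp: a_inv_def)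
qed

lemma minus_mem_submodule: "submodule H R M \<Longrightarrow> x \<in> H \<Longrightarrow> \<ominus>\<^bsub>M\<^esub> x \<in> H"
  using act_minus_one[of x] unfolding is_submodule_iff
  by (metis R.a_inv_closed R.one_closed subsetD)

end

section \<open>Homomorphisms and powers\<close>

lemma mhom_closed: "f \<in> mhom R M N \<Longrightarrow> x \<in> carrier M \<Longrightarrow> f x \<in> carrier N"
  by (auto simp: mhom_def)

lemma mhom_add:
  "f \<in> mhom R M N \<Longrightarrow> x \<in> carrier M \<Longrightarrow> y \<in> carrier M \<Longrightarrow> f (x \<oplus>\<^bsub>M\<^esub> y) = f x \<oplus>\<^bsub>N\<^esub> f y"
  by (auto simp: mhom_def)

lemma mhom_act:
  "f \<in> mhom R M N \<Longrightarrow> a \<in> carrier R \<Longrightarrow> x \<in> carrier M \<Longrightarrow> f (a \<odot>\<^bsub>M\<^esub> x) = a \<odot>\<^bsub>N\<^esub> f x"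
  by (auto simp: mhom_def)

lemma restrict_mhom:
  assumes "left_module R M" "\<And>x. x \<in> carrier M \<Longrightarrow> f x \<in> carrier N"
    "\<And>x y. x \<in> carrier M \<Longrightarrow> y \<in> carrier M \<Longrightarrow> f (x \<oplus>\<^bsub>M\<^esub> y) = f x \<oplus>\<^bsub>N\<^esub> f y"
    "\<And>a x. a \<in> carrier R \<Longrightarrow> x \<in> carrier M \<Longrightarrow> f (a \<odot>\<^bsub>M\<^esub> x) = a \<odot>\<^bsub>N\<^esub> f x"
  shows "restrict f (carrier M) \<in> mhom R M N"
proof -
  interpret left_module R M by fact
  show ?thesis using assms(2-) by (auto simp: mhom_def act_closed)
qed

lemma compose_mhom:
  assumes "left_module R M" "f \<in> mhom R M N" "g \<in> mhom R N K"
  shows "compose (carrier M) g f \<in> mhom R M K"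
  unfolding compose_def using assms
  by (intro restrict_mhom) (auto simp: mhom_closed mhom_add mhom_act)

lemma mhom_zero:
  assumes "left_module R M" "left_module R N" "f \<in> mhom R M N"
  shows "f \<zero>\<^bsub>M\<^esub> = \<zero>\<^bsub>N\<^esub>"
proof -
  interpret M: left_module R M by fact
  interpret N: left_module R N by fact
  show ?thesis
    using mhom_act[OF assms(3) M.R.zero_closed M.M.zero_closed] mhom_closed[OF assms(3) M.M.zero_closed]
    by (simp add: M.act_zero_left N.act_zero_left)
qed

lemma mhom_minus:
  assumes "left_module R M" "left_module R N" "f \<in> mhom R M N" "x \<in> carrier M"
  shows "f (\<ominus>\<^bsub>M\<^esub> x) = \<ominus>\<^bsub>N\<^esub> f x"
proof -
  interpret M: left_module R M by fact
  interpret N: left_module R N by fact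
  show ?thesis
    using mhom_act[OF assms(3) M.R.a_inv_closed[OF M.R.one_closed] assms(4)] mhom_closed[OF assms(3,4)] assms(4)
    by (simp add: M.act_minus_one N.act_minus_one)
qed

lemma mhom_lincomb:
  assumes "left_module R M" "left_module R N" "f \<in> mhom R M N" "finite F"
    "p \<in> F \<rightarrow> carrier R" "c \<in> F \<rightarrow> carrier M"
  shows "f (lincomb M F p c) = lincomb N F p (\<lambda>i. f (c i))"
proof -
  interpret M: left_module R M by fact
  interpret N: left_module R N by fact
  show ?thesis using assms(4-)
  proof (induction F)
    case empty
    then show ?case by (simp add: M.lincomb_empty N.lincomb_empty mhom_zero[OF assms(1-3)])
  next
    case (insert k F)
    moreover from insert have "p k \<in> carrier R" "c k \<in> carrier M" "p \<in> F \<rightarrow> carrier R" "c \<in> F \<rightarrow> carrier M"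
      "(\<lambda>i. f (c i)) \<in> insert k F \<rightarrow> carrier N"
      using assms(3) by (auto intro: mhom_closed)
    ultimately show ?case
      by (simp add: M.lincomb_insert N.lincomb_insert mhom_add[OF assms(3)] mhom_act[OF assms(3)]
          M.act_closed M.lincomb_closed)
  qed
qed

lemma carrier_power: "carrier (power_module F M) = F \<rightarrow>\<^sub>E carrier M"
  and zero_power: "\<zero>\<^bsub>power_module F M\<^esub> = (\<lambda>x\<in>F. \<zero>\<^bsub>M\<^esub>)"
  and add_power: "v \<oplus>\<^bsub>power_module F M\<^esub> w = (\<lambda>x\<in>F. v x \<oplus>\<^bsub>M\<^esub> w x)"
  and act_power: "a \<odot>\<^bsub>power_module F M\<^esub> v = (\<lambda>x\<in>F. a \<odot>\<^bsub>M\<^esub> v x)"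
  by (simp_all add: power_module_def)

lemmas power_simps = carrier_power zero_power add_power act_power

lemma left_module_power:
  assumes "left_module R M"
  shows "left_module R (power_module F M)"
proof -
  interpret left_module R M by fact
  have "abelian_group (power_module F M)"
  proof (rule abelian_groupI)
    fix v assume v: "v \<in> carrier (power_module F M)"
    then show "\<exists>w\<in>carrier (power_module F M). w \<oplus>\<^bsub>power_module F M\<^esub> v = \<zero>\<^bsub>power_module F M\<^esub>"
      by (intro bexI[of _ "\<lambda>x\<in>F. \<ominus>\<^bsub>M\<^esub> v x"])
        (auto simp: power_simps M.l_neg PiE_iff intro!: restrict_ext)
    show "\<zero>\<^bsub>power_module F M\<^esub> \<oplus>\<^bsub>power_module F M\<^esub> v = v"
      using v by (auto simp: power_simps PiE_iff extensional_def)
  qed (auto simp: power_simps PiE_iff M.a_ac intro!: restrict_ext)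
  then show ?thesis
    by (intro left_module.intro left_module_axioms.intro R.ring_axioms)
      (auto simp: power_simps PiE_iff act_closed act_l_distr act_r_distr act_assoc act_one extensional_def
        intro!: restrict_ext)
qed

lemma proj_mhom:
  assumes "left_module R M" "i \<in> F"
  shows "(\<lambda>v\<in>carrier (power_module F M). v i) \<in> mhom R (power_module F M) M"
  using assms by (intro restrict_mhom left_module_power) (auto simp: power_simps)

lemma lincomb_power:
  assumes "left_module R M" "finite G" "p \<in> G \<rightarrow> carrier R" "c \<in> G \<rightarrow> carrier (power_module F M)" "x \<in> F"
  shows "lincomb (power_module F M) G p c x = lincomb M G p (\<lambda>i. c i x)"
proof -
  interpret left_module R M by fact
  interpret P: left_module R "power_module F M" by (rule left_module_power) fact
  have "lincomb (power_module F M) G p c x = (\<lambda>v\<in>carrier (power_module F M). v x) (lincomb (power_module F M) G p c)"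
    using P.lincomb_closed[OF assms(3,4)] by simp
  also have "\<dots> = lincomb M G p (\<lambda>i. (\<lambda>v\<in>carrier (power_module F M). v x) (c i))"
    using assms(2-4) by (rule mhom_lincomb[OF left_module_power[OF assms(1)] assms(1) proj_mhom[OF assms(1,5)]])
  also have "\<dots> = lincomb M G p (\<lambda>i. c i x)"
    using assms by (intro lincomb_cong) (auto simp: power_simps PiE_iff)
  finally show ?thesis .
qed

section \<open>Extending homomorphisms into injective modules\<close>

lemma injective_left_module: "injective R E \<Longrightarrow> left_module R E"
  by (simp add: injective_def)

text \<open>The test modules in \<open>injective\<close> are carried by
  \<open>nat \<Rightarrow> 'r\<close>. A left ideal and the ring itself are moved there as constant
  functions by \<open>c\<close>, with evaluation at 0 as the inverse; the value of the extended map
  at one is the element sought.\<close>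

lemma injective_ideal:
  fixes R :: "'r ring"
  assumes inj: "injective R E" and A: "A \<subseteq> carrier R" "\<zero>\<^bsub>R\<^esub> \<in> A"
    and addA: "\<And>r s. r \<in> A \<Longrightarrow> s \<in> A \<Longrightarrow> r \<oplus>\<^bsub>R\<^esub> s \<in> A"
    and mulA: "\<And>r s. r \<in> carrier R \<Longrightarrow> s \<in> A \<Longrightarrow> r \<otimes>\<^bsub>R\<^esub> s \<in> A"
    and g: "\<And>r. r \<in> A \<Longrightarrow> g r \<in> carrier E"
    and addg: "\<And>r s. r \<in> A \<Longrightarrow> s \<in> A \<Longrightarrow> g (r \<oplus>\<^bsub>R\<^esub> s) = g r \<oplus>\<^bsub>E\<^esub> g s"
    and mulg: "\<And>r s. r \<in> carrier R \<Longrightarrow> s \<in> A \<Longrightarrow> g (r \<otimes>\<^bsub>R\<^esub> s) = r \<odot>\<^bsub>E\<^esub> g s"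
  shows "\<exists>y\<in>carrier E. \<forall>r\<in>A. g r = r \<odot>\<^bsub>E\<^esub> y"
proof -
  interpret E: left_module R E by (rule injective_left_module) fact
  define c :: "'r \<Rightarrow> 'r univ" where "c r = (\<lambda>_. r)" for r
  define md :: "'r set \<Rightarrow> ('r, 'r univ) module" where
    "md Z = \<lparr>carrier = c ` Z, monoid.mult = undefined, monoid.one = undefined,
      ring.zero = c \<zero>\<^bsub>R\<^esub>, ring.add = (\<lambda>v w. c (v 0 \<oplus>\<^bsub>R\<^esub> w 0)), smult = (\<lambda>a v. c (a \<otimes>\<^bsub>R\<^esub> v 0))\<rparr>" for Z
  have c0: "c r 0 = r" for r by (simp add: c_def)
  have md: "left_module R (md Z)" if Z: "Z \<subseteq> carrier R" "\<zero>\<^bsub>R\<^esub> \<in> Z"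
    "\<And>r s. r \<in> Z \<Longrightarrow> s \<in> Z \<Longrightarrow> r \<oplus>\<^bsub>R\<^esub> s \<in> Z" "\<And>r s. r \<in> carrier R \<Longrightarrow> s \<in> Z \<Longrightarrow> r \<otimes>\<^bsub>R\<^esub> s \<in> Z" for Z
  proof -
    have XR: "x \<in> Z \<Longrightarrow> x \<in> carrier R" for x using Z by auto
    have neg: "\<ominus>\<^bsub>R\<^esub> x \<in> Z" if "x \<in> Z" for x
      using Z(4)[of "\<ominus>\<^bsub>R\<^esub> \<one>\<^bsub>R\<^esub>" x] that XR[OF that] by (simp add: E.R.l_minus)
    have "abelian_group (md Z)"
    proof (rule abelian_groupI)
      fix v assume "v \<in> carrier (md Z)"
      then show "\<exists>w\<in>carrier (md Z). w \<oplus>\<^bsub>md Z\<^esub> v = \<zero>\<^bsub>md Z\<^esub>"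
        by (auto simp: md_def c0 E.R.l_neg XR intro!: bexI[OF _ neg])
    qed (auto simp: md_def c0 Z XR E.R.a_ac)
    then show ?thesis
      by (intro left_module.intro left_module_axioms.intro E.R.ring_axioms)
        (auto simp: md_def c0 Z XR E.R.l_distr E.R.r_distr E.R.m_assoc)
  qed
  have A': "left_module R (md A)" using assms by (intro md) auto
  have B': "left_module R (md (carrier R))" by (intro md) auto
  have f: "(\<lambda>v\<in>carrier (md A). v) \<in> mhom R (md A) (md (carrier R))"
    using A by (intro restrict_mhom[OF A']) (auto simp: md_def c0)
  have g': "(\<lambda>v\<in>carrier (md A). g (v 0)) \<in> mhom R (md A) E"
    using A g addg mulg by (intro restrict_mhom[OF A']) (auto simp: md_def c0)
  have "inj_on (\<lambda>v\<in>carrier (md A). v) (carrier (md A))" by (auto simp: inj_on_def)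
  then obtain h where h: "h \<in> mhom R (md (carrier R)) E"
    "compose (carrier (md A)) h (\<lambda>v\<in>carrier (md A). v) = (\<lambda>v\<in>carrier (md A). g (v 0))"
    using inj A' B' f g' unfolding injective_def by blast
  have cin: "c r \<in> carrier (md A)" if "r \<in> A" for r using that by (simp add: md_def)
  have one: "c \<one>\<^bsub>R\<^esub> \<in> carrier (md (carrier R))" by (simp add: md_def)
  show ?thesis
  proof (intro bexI ballI)
    show "h (c \<one>\<^bsub>R\<^esub>) \<in> carrier E" using h(1) one by (rule mhom_closed)
    fix r assume r: "r \<in> A"
    then have "g r = h (c r)"
      using fun_cong[OF h(2), of "c r"] cin[OF r] by (simp add: compose_def c0)
    also have "c r = r \<odot>\<^bsub>md (carrier R)\<^esub> c \<one>\<^bsub>R\<^esub>" using r A by (auto simp: md_def c0)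
    also have "h \<dots> = r \<odot>\<^bsub>E\<^esub> h (c \<one>\<^bsub>R\<^esub>)" using r A one by (intro mhom_act[OF h(1)]) auto
    finally show "g r = r \<odot>\<^bsub>E\<^esub> h (c \<one>\<^bsub>R\<^esub>)" .
  qed
qed

text \<open>Baer's criterion. Partial homomorphisms \<open>B \<rightarrow> E\<close> are given by their graphs, so that
  well-definedness reduces to the condition \<open>single\<close>.\<close>

lemma extend_relation:
  assumes inj: "injective R E" and B: "left_module R B"
    and G: "G \<subseteq> carrier B \<times> carrier E" "G \<noteq> {}"
    and add: "\<And>x y x' y'. (x, y) \<in> G \<Longrightarrow> (x', y') \<in> G \<Longrightarrow> (x \<oplus>\<^bsub>B\<^esub> x', y \<oplus>\<^bsub>E\<^esub> y') \<in> G"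
    and act: "\<And>a x y. a \<in> carrier R \<Longrightarrow> (x, y) \<in> G \<Longrightarrow> (a \<odot>\<^bsub>B\<^esub> x, a \<odot>\<^bsub>E\<^esub> y) \<in> G"
    and single: "\<And>y. (\<zero>\<^bsub>B\<^esub>, y) \<in> G \<Longrightarrow> y = \<zero>\<^bsub>E\<^esub>"
  shows "\<exists>h\<in>mhom R B E. \<forall>(x, y)\<in>G. h x = y"
proof -
  interpret E: left_module R E by (rule injective_left_module) fact
  interpret B: left_module R B by fact
  define ok where "ok H \<longleftrightarrow> H \<subseteq> carrier B \<times> carrier E \<and>
    (\<forall>x y x' y'. (x, y) \<in> H \<longrightarrow> (x', y') \<in> H \<longrightarrow> (x \<oplus>\<^bsub>B\<^esub> x', y \<oplus>\<^bsub>E\<^esub> y') \<in> H) \<and>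
    (\<forall>a x y. a \<in> carrier R \<longrightarrow> (x, y) \<in> H \<longrightarrow> (a \<odot>\<^bsub>B\<^esub> x, a \<odot>\<^bsub>E\<^esub> y) \<in> H) \<and>
    (\<forall>y. (\<zero>\<^bsub>B\<^esub>, y) \<in> H \<longrightarrow> y = \<zero>\<^bsub>E\<^esub>)" for H
  have "\<exists>M\<in>{H. G \<subseteq> H \<and> ok H}. \<forall>Z\<in>{H. G \<subseteq> H \<and> ok H}. M \<subseteq> Z \<longrightarrow> Z = M"
  proof (rule subset_Zorn_nonempty)
    have "ok G" unfolding ok_def using G add act single by blast
    then show "{H. G \<subseteq> H \<and> ok H} \<noteq> {}" by auto
  next
    fix \<C> assume ne: "\<C> \<noteq> {}" and ch: "subset.chain {H. G \<subseteq> H \<and> ok H} \<C>"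
    have ok: "ok H" "G \<subseteq> H" if "H \<in> \<C>" for H using ch that by (auto simp: subset.chain_def)
    have "\<exists>H\<in>\<C>. a \<in> H \<and> b \<in> H" if ab: "a \<in> \<Union>\<C>" "b \<in> \<Union>\<C>" for a b
    proof -
      obtain Z Y where "Z \<in> \<C>" "Y \<in> \<C>" "a \<in> Z" "b \<in> Y" using ab by auto
      moreover have "Z \<subseteq> Y \<or> Y \<subseteq> Z" using ch \<open>Z \<in> \<C>\<close> \<open>Y \<in> \<C>\<close>
        unfolding subset_chain_def by auto
      ultimately show ?thesis by blast
    qed
    note two = this
    have "ok (\<Union>\<C>)" unfolding ok_def
    proof (intro conjI allI impI)
      show "\<Union>\<C> \<subseteq> carrier B \<times> carrier E" using ok(1) unfolding ok_def by (intro Union_least) blast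
    next
      fix x y x' y' assume "(x, y) \<in> \<Union>\<C>" "(x', y') \<in> \<Union>\<C>"
      from two[OF this] obtain H where "H \<in> \<C>" "(x, y) \<in> H" "(x', y') \<in> H" by auto
      then show "(x \<oplus>\<^bsub>B\<^esub> x', y \<oplus>\<^bsub>E\<^esub> y') \<in> \<Union>\<C>" using ok[of H] unfolding ok_def by blast
    next
      fix a x y assume "a \<in> carrier R" "(x, y) \<in> \<Union>\<C>"
      then show "(a \<odot>\<^bsub>B\<^esub> x, a \<odot>\<^bsub>E\<^esub> y) \<in> \<Union>\<C>" using ok unfolding ok_def by blast
    next
      fix y assume "(\<zero>\<^bsub>B\<^esub>, y) \<in> \<Union>\<C>"
      then show "y = \<zero>\<^bsub>E\<^esub>" using ok unfolding ok_def by blast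
    qed
    then show "\<Union>\<C> \<in> {H. G \<subseteq> H \<and> ok H}" using ne ok by auto
  qed
  then obtain H where "H \<in> {H. G \<subseteq> H \<and> ok H}" and maxH: "\<forall>Z\<in>{H. G \<subseteq> H \<and> ok H}. H \<subseteq> Z \<longrightarrow> Z = H"
    by (rule bexE)
  then have GH: "G \<subseteq> H" and okH: "ok H" by simp_all
  have max: "Z = H" if "ok Z" "H \<subseteq> Z" for Z
    using maxH that GH by (metis (mono_tags, lifting) mem_Collect_eq subset_trans)
  have HBE: "(x, y) \<in> H \<Longrightarrow> x \<in> carrier B \<and> y \<in> carrier E" for x y using okH unfolding ok_def by blast
  have Hadd: "(x, y) \<in> H \<Longrightarrow> (x', y') \<in> H \<Longrightarrow> (x \<oplus>\<^bsub>B\<^esub> x', y \<oplus>\<^bsub>E\<^esub> y') \<in> H" for x y x' y'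
    using okH unfolding ok_def by blast
  have Hact: "a \<in> carrier R \<Longrightarrow> (x, y) \<in> H \<Longrightarrow> (a \<odot>\<^bsub>B\<^esub> x, a \<odot>\<^bsub>E\<^esub> y) \<in> H" for a x y
    using okH unfolding ok_def by blast
  have Hsingle: "(\<zero>\<^bsub>B\<^esub>, y) \<in> H \<Longrightarrow> y = \<zero>\<^bsub>E\<^esub>" for y using okH unfolding ok_def by blast
  have Hneg: "(\<ominus>\<^bsub>B\<^esub> x, \<ominus>\<^bsub>E\<^esub> y) \<in> H" if "(x, y) \<in> H" for x y
    using Hact[of "\<ominus>\<^bsub>R\<^esub> \<one>\<^bsub>R\<^esub>", OF _ that] HBE[OF that] by (simp add: B.act_minus_one E.act_minus_one)
  have H0: "(\<zero>\<^bsub>B\<^esub>, \<zero>\<^bsub>E\<^esub>) \<in> H"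
  proof -
    obtain x y where xy: "(x, y) \<in> H" using G(2) GH by fastforce
    show ?thesis using Hact[OF E.R.zero_closed xy] HBE[OF xy] by (simp add: B.act_zero_left E.act_zero_left)
  qed
  have uniq: "y = y'" if "(x, y) \<in> H" "(x, y') \<in> H" for x y y'
  proof -
    have "y \<oplus>\<^bsub>E\<^esub> \<ominus>\<^bsub>E\<^esub> y' = \<zero>\<^bsub>E\<^esub>"
      using Hadd[OF that(1) Hneg[OF that(2)]] HBE[OF that(1)] by (intro Hsingle) (simp add: B.M.r_neg)
    then show ?thesis using HBE[OF that(1)] HBE[OF that(2)]
      by (metis E.M.minus_equality E.M.minus_minus E.M.a_inv_closed)
  qed
  have total: "\<exists>y. (b, y) \<in> H" if b: "b \<in> carrier B" for b
  proof -
    \<comment> \<open>The multiples of \<open>b\<close> already in the domain come from the left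
      ideal \<open>A\<close>; extending their prescribed values to the whole ring gives a value
      \<open>y\<close> for \<open>b\<close> itself.\<close>
    define A where "A = {r \<in> carrier R. \<exists>y. (r \<odot>\<^bsub>B\<^esub> b, y) \<in> H}"
    define g where "g r = (THE y. (r \<odot>\<^bsub>B\<^esub> b, y) \<in> H)" for r
    have g: "(r \<odot>\<^bsub>B\<^esub> b, g r) \<in> H" if "r \<in> A" for r
      using that unfolding A_def g_def by (auto intro: theI uniq)
    have addA: "(( r \<oplus>\<^bsub>R\<^esub> s) \<odot>\<^bsub>B\<^esub> b, g r \<oplus>\<^bsub>E\<^esub> g s) \<in> H" if "r \<in> A" "s \<in> A" for r s
      using Hadd[OF g[OF that(1)] g[OF that(2)]] that b by (simp add: A_def B.act_l_distr)
    have mulA: "((r \<otimes>\<^bsub>R\<^esub> s) \<odot>\<^bsub>B\<^esub> b, r \<odot>\<^bsub>E\<^esub> g s) \<in> H" if "r \<in> carrier R" "s \<in> A" for r s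
      using Hact[OF that(1) g[OF that(2)]] that b by (simp add: A_def B.act_assoc)
    have "\<exists>y\<in>carrier E. \<forall>r\<in>A. g r = r \<odot>\<^bsub>E\<^esub> y"
    proof (rule injective_ideal[OF inj])
      show "A \<subseteq> carrier R" by (auto simp: A_def)
      show "\<zero>\<^bsub>R\<^esub> \<in> A" using H0 b by (auto simp: A_def B.act_zero_left)
      show "r \<oplus>\<^bsub>R\<^esub> s \<in> A" "g (r \<oplus>\<^bsub>R\<^esub> s) = g r \<oplus>\<^bsub>E\<^esub> g s" if "r \<in> A" "s \<in> A" for r s
      proof -
        show *: "r \<oplus>\<^bsub>R\<^esub> s \<in> A" using addA[OF that] that by (auto simp: A_def)
        show "g (r \<oplus>\<^bsub>R\<^esub> s) = g r \<oplus>\<^bsub>E\<^esub> g s" by (rule uniq[OF g[OF *] addA[OF that]])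
      qed
      show "r \<otimes>\<^bsub>R\<^esub> s \<in> A" "g (r \<otimes>\<^bsub>R\<^esub> s) = r \<odot>\<^bsub>E\<^esub> g s" if "r \<in> carrier R" "s \<in> A" for r s
      proof -
        show *: "r \<otimes>\<^bsub>R\<^esub> s \<in> A" using mulA[OF that] that by (auto simp: A_def)
        show "g (r \<otimes>\<^bsub>R\<^esub> s) = r \<odot>\<^bsub>E\<^esub> g s" by (rule uniq[OF g[OF *] mulA[OF that]])
      qed
      show "g r \<in> carrier E" if "r \<in> A" for r using HBE[OF g[OF that]] by simp
    qed
    then obtain y where y: "y \<in> carrier E" "\<And>r. r \<in> A \<Longrightarrow> g r = r \<odot>\<^bsub>E\<^esub> y" by blast
    define H' where "H' = {(x \<oplus>\<^bsub>B\<^esub> r \<odot>\<^bsub>B\<^esub> b, z \<oplus>\<^bsub>E\<^esub> r \<odot>\<^bsub>E\<^esub> y) |x z r. (x, z) \<in> H \<and> r \<in> carrier R}"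
    have H'I: "(x \<oplus>\<^bsub>B\<^esub> r \<odot>\<^bsub>B\<^esub> b, z \<oplus>\<^bsub>E\<^esub> r \<odot>\<^bsub>E\<^esub> y) \<in> H'" if "(x, z) \<in> H" "r \<in> carrier R" for x z r
      using that by (auto simp: H'_def)
    have HH': "H \<subseteq> H'"
    proof clarify
      fix x z assume xz: "(x, z) \<in> H"
      show "(x, z) \<in> H'" using H'I[OF xz E.R.zero_closed] HBE[OF xz] b y
        by (simp add: B.act_zero_left E.act_zero_left)
    qed
    have "ok H'" unfolding ok_def
    proof (intro conjI allI impI)
      show "H' \<subseteq> carrier B \<times> carrier E" using HBE b y by (auto simp: H'_def B.act_closed E.act_closed)
    next
      fix x1 z1 x2 z2 assume "(x1, z1) \<in> H'" "(x2, z2) \<in> H'"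
      then obtain x z r x' z' r' where *: "(x, z) \<in> H" "(x', z') \<in> H" "r \<in> carrier R" "r' \<in> carrier R"
        "x1 = x \<oplus>\<^bsub>B\<^esub> r \<odot>\<^bsub>B\<^esub> b" "z1 = z \<oplus>\<^bsub>E\<^esub> r \<odot>\<^bsub>E\<^esub> y"
        "x2 = x' \<oplus>\<^bsub>B\<^esub> r' \<odot>\<^bsub>B\<^esub> b" "z2 = z' \<oplus>\<^bsub>E\<^esub> r' \<odot>\<^bsub>E\<^esub> y" by (auto simp: H'_def)
      have "x1 \<oplus>\<^bsub>B\<^esub> x2 = (x \<oplus>\<^bsub>B\<^esub> x') \<oplus>\<^bsub>B\<^esub> (r \<oplus>\<^bsub>R\<^esub> r') \<odot>\<^bsub>B\<^esub> b"
        using * HBE b by (simp add: B.act_l_distr B.act_closed B.M.a_ac)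
      moreover have "z1 \<oplus>\<^bsub>E\<^esub> z2 = (z \<oplus>\<^bsub>E\<^esub> z') \<oplus>\<^bsub>E\<^esub> (r \<oplus>\<^bsub>R\<^esub> r') \<odot>\<^bsub>E\<^esub> y"
        using * HBE y by (simp add: E.act_l_distr E.act_closed E.M.a_ac)
      ultimately show "(x1 \<oplus>\<^bsub>B\<^esub> x2, z1 \<oplus>\<^bsub>E\<^esub> z2) \<in> H'"
        using H'I[OF Hadd[OF *(1,2)], of "r \<oplus>\<^bsub>R\<^esub> r'"] * by simp
    next
      fix a x1 z1 assume a: "a \<in> carrier R" and "(x1, z1) \<in> H'"
      then obtain x z r where *: "(x, z) \<in> H" "r \<in> carrier R"
        "x1 = x \<oplus>\<^bsub>B\<^esub> r \<odot>\<^bsub>B\<^esub> b" "z1 = z \<oplus>\<^bsub>E\<^esub> r \<odot>\<^bsub>E\<^esub> y" by (auto simp: H'_def)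
      have "a \<odot>\<^bsub>B\<^esub> x1 = a \<odot>\<^bsub>B\<^esub> x \<oplus>\<^bsub>B\<^esub> (a \<otimes>\<^bsub>R\<^esub> r) \<odot>\<^bsub>B\<^esub> b"
        using * a HBE[OF *(1)] b by (simp add: B.act_r_distr B.act_closed B.act_assoc)
      moreover have "a \<odot>\<^bsub>E\<^esub> z1 = a \<odot>\<^bsub>E\<^esub> z \<oplus>\<^bsub>E\<^esub> (a \<otimes>\<^bsub>R\<^esub> r) \<odot>\<^bsub>E\<^esub> y"
        using * a HBE[OF *(1)] y by (simp add: E.act_r_distr E.act_closed E.act_assoc)
      ultimately show "(a \<odot>\<^bsub>B\<^esub> x1, a \<odot>\<^bsub>E\<^esub> z1) \<in> H'"
        using H'I[OF Hact[OF a *(1)], of "a \<otimes>\<^bsub>R\<^esub> r"] * a by simp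
    next
      \<comment> \<open>Adjoining \<open>(b, y)\<close> keeps the relation single-valued: if
        \<open>x + r b = 0\<close>, then \<open>r\<close> lies in \<open>A\<close>, and
        \<open>y\<close> was chosen so that \<open>r y\<close> is the value \<open>- z\<close>
        forced there.\<close>
      fix z1 assume "(\<zero>\<^bsub>B\<^esub>, z1) \<in> H'"
      then obtain x z r where *: "(x, z) \<in> H" "r \<in> carrier R"
        "\<zero>\<^bsub>B\<^esub> = x \<oplus>\<^bsub>B\<^esub> r \<odot>\<^bsub>B\<^esub> b" "z1 = z \<oplus>\<^bsub>E\<^esub> r \<odot>\<^bsub>E\<^esub> y" by (auto simp: H'_def)
      have "r \<odot>\<^bsub>B\<^esub> b = \<ominus>\<^bsub>B\<^esub> x" using *(3) HBE[OF *(1)] B.act_closed[OF *(2) b]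
        by (metis B.M.a_comm B.M.minus_equality)
      then have r: "(r \<odot>\<^bsub>B\<^esub> b, \<ominus>\<^bsub>E\<^esub> z) \<in> H" using Hneg[OF *(1)] by simp
      then have "r \<in> A" using *(2) by (auto simp: A_def)
      then have "r \<odot>\<^bsub>E\<^esub> y = \<ominus>\<^bsub>E\<^esub> z" using y(2) uniq[OF g r] by simp
      then show "z1 = \<zero>\<^bsub>E\<^esub>" using *(4) HBE[OF *(1)] by (simp add: E.M.r_neg)
    qed
    then have "H' = H" using HH' by (rule max)
    moreover have "(b, y) \<in> H'" using H'I[OF H0 E.R.one_closed] b y by (simp add: B.act_one E.act_one)
    ultimately show ?thesis by auto
  qed
  define h where "h = (\<lambda>x\<in>carrier B. THE y. (x, y) \<in> H)"
  have h: "(x, h x) \<in> H" if "x \<in> carrier B" for x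
    using total[OF that] that by (auto simp: h_def intro: theI uniq)
  have "h = restrict h (carrier B)" by (simp add: h_def)
  also have "\<dots> \<in> mhom R B E"
  proof (rule restrict_mhom[OF B])
    show "h x \<in> carrier E" if "x \<in> carrier B" for x using HBE[OF h[OF that]] by simp
    show "h (x \<oplus>\<^bsub>B\<^esub> y) = h x \<oplus>\<^bsub>E\<^esub> h y" if "x \<in> carrier B" "y \<in> carrier B" for x y
      using that by (intro uniq[OF h Hadd[OF h h]]) auto
    show "h (a \<odot>\<^bsub>B\<^esub> x) = a \<odot>\<^bsub>E\<^esub> h x" if "a \<in> carrier R" "x \<in> carrier B" for a x
      using that by (intro uniq[OF h Hact[OF _ h]]) (auto simp: B.act_closed)
  qed
  finally have "h \<in> mhom R B E" .
  moreover have "h x = y" if "(x, y) \<in> G" for x y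
    using that GH HBE[of x y] by (auto intro!: uniq[OF h])
  ultimately show ?thesis by blast
qed

section \<open>Artinian modules\<close>

definition artinian_module :: "'r ring \<Rightarrow> ('r, 'a) module \<Rightarrow> bool" where
  "artinian_module R M \<longleftrightarrow> (\<forall>S. S \<noteq> {} \<longrightarrow> (\<forall>N\<in>S. submodule N R M) \<longrightarrow>
     (\<exists>N\<in>S. \<forall>N'\<in>S. N' \<subseteq> N \<longrightarrow> N' = N))"

text \<open>Most applications minimize over finite sets of conditions, with the submodules as their
  solution sets, so the minimum is wanted as an index.\<close>

lemma artinian_module_minimal:
  assumes "artinian_module R M" "i0 \<in> S" "\<And>i. i \<in> S \<Longrightarrow> submodule (f i) R M"
  shows "\<exists>i\<in>S. \<forall>j\<in>S. f j \<subseteq> f i \<longrightarrow> f j = f i"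
proof -
  have "f ` S \<noteq> {}" "\<forall>N\<in>f ` S. submodule N R M" using assms by auto
  then have "\<exists>N\<in>f ` S. \<forall>N'\<in>f ` S. N' \<subseteq> N \<longrightarrow> N' = N"
    using assms(1) unfolding artinian_module_def by presburger
  then show ?thesis by (simp only: bex_simps ball_simps)
qed

text \<open>For passing from a base ring to an algebra over it, which has fewer submodules.\<close>

lemma artinian_module_coarsen:
  assumes "artinian_module k M" "\<And>N. submodule N R M' \<Longrightarrow> submodule N k M"
  shows "artinian_module R M'"
  unfolding artinian_module_def
proof (intro allI impI)
  fix S assume "S \<noteq> {}" "\<forall>N\<in>S. submodule N R M'"
  then have "S \<noteq> {}" "\<forall>N\<in>S. submodule N k M" using assms(2) by simp_all
  with assms(1) show "\<exists>N\<in>S. \<forall>N'\<in>S. N' \<subseteq> N \<longrightarrow> N' = N"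
    unfolding artinian_module_def by (elim allE[of _ S] impE) assumption+
qed

section \<open>Submodules under homomorphisms, quotients and finite powers\<close>

lemma image_submodule:
  assumes "left_module R M" "left_module R M'" "f \<in> mhom R M M'" "submodule N R M"
  shows "submodule (f ` N) R M'"
proof -
  interpret M: left_module R M by fact
  interpret M': left_module R M' by fact
  have N: "N \<subseteq> carrier M" "\<zero>\<^bsub>M\<^esub> \<in> N" "\<And>x y. x \<in> N \<Longrightarrow> y \<in> N \<Longrightarrow> x \<oplus>\<^bsub>M\<^esub> y \<in> N"
    "\<And>a x. a \<in> carrier R \<Longrightarrow> x \<in> N \<Longrightarrow> a \<odot>\<^bsub>M\<^esub> x \<in> N"
    using assms(4) by (auto simp: M.is_submodule_iff)
  have NM: "x \<in> N \<Longrightarrow> x \<in> carrier M" for x using N(1) by auto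
  show ?thesis unfolding M'.is_submodule_iff
  proof (intro conjI ballI)
    show "f ` N \<subseteq> carrier M'" using NM mhom_closed[OF assms(3)] by blast
    show "\<zero>\<^bsub>M'\<^esub> \<in> f ` N" using mhom_zero[OF assms(1-3)] N(2) by (metis imageI)
    show "x \<oplus>\<^bsub>M'\<^esub> y \<in> f ` N" if "x \<in> f ` N" "y \<in> f ` N" for x y
      using that N(3) by (auto simp: mhom_add[OF assms(3) NM NM, symmetric])
    show "a \<odot>\<^bsub>M'\<^esub> x \<in> f ` N" if "a \<in> carrier R" "x \<in> f ` N" for a x
      using that N(4) by (auto simp: mhom_act[OF assms(3) _ NM, symmetric])
  qed
qed

lemma vimage_submodule:
  assumes "left_module R M" "left_module R M'" "f \<in> mhom R M M'" "submodule N R M'"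
  shows "submodule {x \<in> carrier M. f x \<in> N} R M"
proof -
  interpret M: left_module R M by fact
  interpret M': left_module R M' by fact
  show ?thesis
    using assms(4) mhom_zero[OF assms(1-3)] unfolding M.is_submodule_iff M'.is_submodule_iff
    by (auto simp: mhom_add[OF assms(3)] mhom_act[OF assms(3)] M.act_closed)
qed

lemma inter_submodule:
  assumes "left_module R M" "submodule N R M" "submodule N' R M"
  shows "submodule (N \<inter> N') R M"
proof -
  interpret M: left_module R M by fact
  show ?thesis using assms(2,3) unfolding M.is_submodule_iff by auto
qed

lemma zero_submodule:
  assumes "left_module R M"
  shows "submodule {\<zero>\<^bsub>M\<^esub>} R M"
proof -
  interpret M: left_module R M by fact
  show ?thesis unfolding M.is_submodule_iff by (auto simp: M.act_zero_right)
qed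

text \<open>Taking preimages preserves inclusion and, by surjectivity, loses nothing:
  \<open>f\<close> maps the preimage of \<open>N\<close> back onto \<open>N\<close>.\<close>

lemma artinian_quotient:
  assumes M: "left_module R M" and M': "left_module R M'" and f: "f \<in> mhom R M M'"
    and surj: "f ` carrier M = carrier M'" and art: "artinian_module R M"
  shows "artinian_module R M'"
  unfolding artinian_module_def
proof (intro allI impI)
  fix S assume S: "S \<noteq> {}" "\<forall>N\<in>S. submodule N R M'"
  define pre where "pre N = {x \<in> carrier M. f x \<in> N}" for N
  have sub: "submodule (pre N) R M" if "N \<in> S" for N
    unfolding pre_def using vimage_submodule[OF M M' f] S(2) that by blast
  have im: "f ` pre N = N" if "N \<in> S" for N
  proof -
    have "N \<subseteq> carrier M'"
      using bspec[OF S(2) that] by (simp add: left_module.is_submodule_iff[OF M'])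
    moreover have "f ` pre N = f ` carrier M \<inter> N" unfolding pre_def by auto
    ultimately show ?thesis unfolding surj by (simp add: Int_absorb1)
  qed
  obtain N0 where N0: "N0 \<in> S" using S by auto
  have "\<exists>N\<in>S. \<forall>N'\<in>S. pre N' \<subseteq> pre N \<longrightarrow> pre N' = pre N"
    using art N0 sub by (rule artinian_module_minimal)
  then obtain N where N: "N \<in> S" "\<forall>N'\<in>S. pre N' \<subseteq> pre N \<longrightarrow> pre N' = pre N" by (rule bexE)
  have "N' = N" if "N' \<in> S" "N' \<subseteq> N" for N'
  proof -
    have "pre N' \<subseteq> pre N" using that(2) by (auto simp: pre_def)
    then have "pre N' = pre N" using N(2) that(1) by simp
    then have "f ` pre N' = f ` pre N" by simp
    then show ?thesis unfolding im[OF that(1)] im[OF N(1)] .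
  qed
  then show "\<exists>N\<in>S. \<forall>N'\<in>S. N' \<subseteq> N \<longrightarrow> N' = N" using N(1) by (intro bexI[of _ N] ballI impI)
qed

lemma restrict_power_mhom:
  assumes "left_module R M" "G \<subseteq> F"
  shows "(\<lambda>v\<in>carrier (power_module F M). restrict v G) \<in> mhom R (power_module F M) (power_module G M)"
proof (intro restrict_mhom left_module_power assms)
  have mem: "j \<in> G \<Longrightarrow> j \<in> F" for j using assms(2) by auto
  show "restrict v G \<in> carrier (power_module G M)" if "v \<in> carrier (power_module F M)" for v
    using that mem by (auto simp: power_simps PiE_iff)
qed (use assms(2) in \<open>auto simp: power_simps fun_eq_iff restrict_def\<close>)

text \<open>Induction, splitting off one coordinate \<open>i\<close>: two nested submodules coincide
  if they have the same projection under \<open>p\<close> and the same part in the kernel of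
  \<open>p\<close>. So the projection is minimized first, and among the minimizers the kernel
  part.\<close>

lemma artinian_power:
  assumes M: "left_module R M" and art: "artinian_module R M" and fin: "finite F"
  shows "artinian_module R (power_module F M)"
  using fin
proof (induction F)
  case empty
  interpret P: left_module R "power_module {} M" by (rule left_module_power) fact
  have "N = carrier (power_module {} M)" if "submodule N R (power_module {} M)" for N
    using that unfolding P.is_submodule_iff by (auto simp: power_simps)
  then show ?case unfolding artinian_module_def by (metis ex_in_conv)
next
  case (insert i F)
  interpret M: left_module R M by fact
  define P where "P = power_module (insert i F) M"
  interpret P: left_module R P unfolding P_def by (rule left_module_power) fact
  define p where "p = (\<lambda>v\<in>carrier P. v i)"
  define q where "q = (\<lambda>v\<in>carrier P. restrict v F)"
  have p: "p \<in> mhom R P M" unfolding p_def P_def using M by (rule proj_mhom) simp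
  have q: "q \<in> mhom R P (power_module F M)" unfolding q_def P_def
    using M by (rule restrict_power_mhom) auto
  \<comment> \<open>The part of \<open>N\<close> vanishing at \<open>i\<close>. Dropping that
    coordinate moves it into the power over \<open>F\<close>, where the induction hypothesis
    applies.\<close>
  define ker where "ker N = q ` (N \<inter> {v \<in> carrier P. p v \<in> {\<zero>\<^bsub>M\<^esub>}})" for N
  have subp: "submodule (p ` N) R M" if "submodule N R P" for N
    by (rule image_submodule[OF P.left_module_axioms M p that])
  have subk: "submodule (ker N) R (power_module F M)" if "submodule N R P" for N
    unfolding ker_def
    by (intro image_submodule[OF P.left_module_axioms left_module_power[OF M] q]
        inter_submodule[OF P.left_module_axioms that]
        vimage_submodule[OF P.left_module_axioms M p] zero_submodule M)
  have eq: "N' = N" if N: "submodule N R P" "submodule N' R P" "N' \<subseteq> N" "p ` N' = p ` N" "ker N' = ker N" for N N'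
  proof (rule antisym[OF N(3)], rule subsetI)
    fix v assume v: "v \<in> N"
    have NP: "N \<subseteq> carrier P" using N(1) by (simp add: P.is_submodule_iff)
    obtain v' where v': "v' \<in> N'" "p v' = p v" using N(4) v by (metis imageE imageI)
    have vP: "v \<in> carrier P" "v' \<in> carrier P" using v v' N(3) NP by auto
    define d where "d = v \<oplus>\<^bsub>P\<^esub> \<ominus>\<^bsub>P\<^esub> v'"
    have d: "d \<in> N" unfolding d_def
      using v v'(1) N(1,3) P.minus_mem_submodule[OF N(1)] by (auto simp: P.is_submodule_iff)
    have dP: "d \<in> carrier P" using d NP by auto
    have "p d = \<zero>\<^bsub>M\<^esub>" unfolding d_def using vP v'(2)
      by (simp add: mhom_add[OF p] mhom_minus[OF P.left_module_axioms M p] M.r_neg mhom_closed[OF p])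
    then have "q d \<in> ker N" unfolding ker_def using d dP by auto
    then have "q d \<in> ker N'" unfolding N(5) .
    then obtain w where w: "w \<in> N'" "w \<in> carrier P" "p w = \<zero>\<^bsub>M\<^esub>" "q w = q d" unfolding ker_def by auto
    have "w = d"
    proof (rule PiE_ext)
      show "w \<in> insert i F \<rightarrow>\<^sub>E carrier M" "d \<in> insert i F \<rightarrow>\<^sub>E carrier M"
        using w(2) dP by (simp_all add: P_def carrier_power)
      fix j assume "j \<in> insert i F"
      then show "w j = d j" using w(2,3) dP \<open>p d = \<zero>\<^bsub>M\<^esub>\<close> fun_cong[OF w(4), of j]
        by (cases "j = i") (simp_all add: p_def q_def)
    qed
    then have "v = v' \<oplus>\<^bsub>P\<^esub> w" unfolding d_def using vP
      by (metis P.M.a_comm P.M.a_assoc P.M.a_inv_closed P.M.l_neg P.M.r_zero)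
    then show "v \<in> N'" using v'(1) w(1) N(2) by (simp add: P.is_submodule_iff)
  qed
  show ?case unfolding P_def[symmetric] artinian_module_def
  proof (intro allI impI)
    fix S assume S: "S \<noteq> {}" "\<forall>N\<in>S. submodule N R P"
    then obtain N0 where N0: "N0 \<in> S" by auto
    have "\<exists>N1\<in>S. \<forall>N\<in>S. p ` N \<subseteq> p ` N1 \<longrightarrow> p ` N = p ` N1"
      using S(2) by (intro artinian_module_minimal[OF art N0] subp) (rule bspec)
    then obtain N1 where N1: "N1 \<in> S" "\<forall>N\<in>S. p ` N \<subseteq> p ` N1 \<longrightarrow> p ` N = p ` N1" by (rule bexE)
    have "\<exists>N2\<in>{N \<in> S. p ` N = p ` N1}. \<forall>N\<in>{N \<in> S. p ` N = p ` N1}. ker N \<subseteq> ker N2 \<longrightarrow> ker N = ker N2"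
      using S(2) N1(1) subk by (intro artinian_module_minimal[OF insert.IH, of N1]) auto
    then obtain N2 where "N2 \<in> {N \<in> S. p ` N = p ` N1}"
      and min2: "\<forall>N\<in>{N \<in> S. p ` N = p ` N1}. ker N \<subseteq> ker N2 \<longrightarrow> ker N = ker N2" by (rule bexE)
    then have N2: "N2 \<in> S" "p ` N2 = p ` N1" by simp_all
    show "\<exists>N\<in>S. \<forall>N'\<in>S. N' \<subseteq> N \<longrightarrow> N' = N"
    proof (intro bexI[OF _ N2(1)] ballI impI)
      fix N assume N: "N \<in> S" "N \<subseteq> N2"
      have 1: "p ` N = p ` N1" using N1(2) N(1) image_mono[OF N(2), of p] unfolding N2(2) by simp
      have "ker N \<subseteq> ker N2" using N(2) by (auto simp: ker_def)
      then have "ker N = ker N2" using min2 N(1) 1 by simp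
      then show "N = N2"
        by (rule eq[OF bspec[OF S(2) N2(1)] bspec[OF S(2) N(1)] N(2) trans[OF 1 N2(2)[symmetric]]])
    qed
  qed
qed

section \<open>Artin algebras are artinian over themselves on both sides\<close>

abbreviation regular_module :: "'r ring \<Rightarrow> ('r, 'r) module" where
  "regular_module R \<equiv> scalar_module (\<lambda>r. r) R"

lemma scalar_module_simps [simp]:
  "carrier (scalar_module \<phi> A) = carrier A" "\<zero>\<^bsub>scalar_module \<phi> A\<^esub> = \<zero>\<^bsub>A\<^esub>"
  "x \<oplus>\<^bsub>scalar_module \<phi> A\<^esub> y = x \<oplus>\<^bsub>A\<^esub> y" "a \<odot>\<^bsub>scalar_module \<phi> A\<^esub> x = \<phi> a \<otimes>\<^bsub>A\<^esub> x"
  by (simp_all add: scalar_module_def)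

lemma abelian_group_scalar_module: "ring A \<Longrightarrow> abelian_group (scalar_module \<phi> A)"
proof -
  assume "ring A"
  then interpret ring A .
  have "\<exists>y\<in>carrier A. y \<oplus>\<^bsub>A\<^esub> x = \<zero>\<^bsub>A\<^esub>" if "x \<in> carrier A" for x
    using l_neg[OF that] a_inv_closed[OF that] by blast
  then show ?thesis by (intro abelian_groupI) (simp_all add: a_ac)
qed

lemma left_module_regular: "ring R \<Longrightarrow> left_module R (regular_module R)"
proof -
  assume R: "ring R"
  then interpret ring R .
  show ?thesis
    using R by (intro left_module.intro left_module_axioms.intro abelian_group_scalar_module)
      (auto simp: l_distr r_distr m_assoc)
qed

text \<open>A finite generating set \<open>S\<close> presents the module as a quotient of a power of
  the regular module.\<close>

lemma fin_gen_artinian: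
  assumes "fin_gen R M" "artinian_module R (regular_module R)"
  shows "artinian_module R M"
proof -
  interpret left_module R M using assms(1) by (simp add: fin_gen_def)
  let ?R = "regular_module R"
  obtain S where S: "finite S" "S \<subseteq> carrier M"
    "\<And>x. x \<in> carrier M \<Longrightarrow> \<exists>c \<in> S \<rightarrow> carrier R. x = (\<Oplus>\<^bsub>M\<^esub>s\<in>S. c s \<odot>\<^bsub>M\<^esub> s)"
    using assms(1) by (auto simp: fin_gen_def)
  define f where "f = (\<lambda>v\<in>carrier (power_module S ?R). lincomb M S v (\<lambda>s. s))"
  have reg: "left_module R ?R" by (rule left_module_regular) (rule R.ring_axioms)
  have id: "(\<lambda>s. s) \<in> S \<rightarrow> carrier M" using S(2) by auto
  have f: "f \<in> mhom R (power_module S ?R) M" unfolding f_def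
  proof (intro restrict_mhom left_module_power reg)
    show "lincomb M S v (\<lambda>s. s) \<in> carrier M" if "v \<in> carrier (power_module S ?R)" for v
      using that id by (intro lincomb_closed) (auto simp: power_simps)
    show "lincomb M S (v \<oplus>\<^bsub>power_module S ?R\<^esub> w) (\<lambda>s. s) = lincomb M S v (\<lambda>s. s) \<oplus>\<^bsub>M\<^esub> lincomb M S w (\<lambda>s. s)"
      if "v \<in> carrier (power_module S ?R)" "w \<in> carrier (power_module S ?R)" for v w
      using that id by (subst lincomb_add_left[symmetric]) (auto simp: power_simps PiE_iff intro!: lincomb_cong)
    show "lincomb M S (a \<odot>\<^bsub>power_module S ?R\<^esub> v) (\<lambda>s. s) = a \<odot>\<^bsub>M\<^esub> lincomb M S v (\<lambda>s. s)"
      if "a \<in> carrier R" "v \<in> carrier (power_module S ?R)" for a v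
      using that id S(1) by (subst act_lincomb) (auto simp: power_simps PiE_iff intro!: lincomb_cong)
  qed
  have "f ` carrier (power_module S ?R) = carrier M"
  proof
    show "f ` carrier (power_module S ?R) \<subseteq> carrier M" using mhom_closed[OF f] by blast
    show "carrier M \<subseteq> f ` carrier (power_module S ?R)"
    proof
      fix x assume x: "x \<in> carrier M"
      obtain c where c: "c \<in> S \<rightarrow> carrier R" "x = (\<Oplus>\<^bsub>M\<^esub>s\<in>S. c s \<odot>\<^bsub>M\<^esub> s)"
        using S(3)[OF x] by (rule bexE)
      have "f (restrict c S) = lincomb M S (restrict c S) (\<lambda>s. s)"
        using c(1) unfolding f_def by (intro restrict_apply') (auto simp: power_simps)
      also have "\<dots> = lincomb M S c (\<lambda>s. s)" using c(1) id by (intro lincomb_cong) auto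
      also have "\<dots> = x" using c(2) by (simp add: lincomb_def)
      finally show "x \<in> f ` carrier (power_module S ?R)"
        using c(1) by (intro image_eqI[of _ _ "restrict c S"]) (auto simp: power_simps)
    qed
  qed
  then show ?thesis
    by (rule artinian_quotient[OF left_module_power[OF reg] left_module_axioms f])
      (rule artinian_power[OF reg assms(2) S(1)])
qed

text \<open>Bridges two forms of the condition: \<open>artinian_cring\<close> speaks of descending
  chains of two-sided ideals, \<open>artinian_module\<close> of minimal elements. A family without
  minimal element yields a strictly descending chain by dependent choice, and commutativity makes
  its members two-sided.\<close>

lemma artinian_cring_regular:
  assumes "artinian_cring k"
  shows "artinian_module k (regular_module k)"
proof (rule ccontr)
  interpret cring k using assms by (simp add: artinian_cring_def)
  interpret reg: left_module k "regular_module k" by (rule left_module_regular) (rule ring_axioms)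
  assume "\<not> artinian_module k (regular_module k)"
  then obtain S where S: "S \<noteq> {}" "\<forall>N\<in>S. submodule N k (regular_module k)"
    and no_min: "\<not> (\<exists>N\<in>S. \<forall>N'\<in>S. N' \<subseteq> N \<longrightarrow> N' = N)"
    unfolding artinian_module_def not_all not_imp by (elim exE conjE)
  have smaller: "\<exists>N'. N' \<in> S \<and> N' \<subset> N" if "N \<in> S" for N using no_min that by blast
  obtain N0 where N0: "N0 \<in> S" using S(1) by auto
  have "\<exists>f. \<forall>n. f n \<in> S \<and> f (Suc n) \<subset> f n"
  proof (rule dependent_nat_choice)
    show "\<exists>N. N \<in> S" using N0 by (rule exI)
    show "\<exists>N'. N' \<in> S \<and> N' \<subset> N" if "N \<in> S" for N and n :: nat
      using that by (rule smaller)
  qed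
  then obtain f where f': "\<forall>n. f n \<in> S \<and> f (Suc n) \<subset> f n" by (rule exE)
  have f: "f n \<in> S" "f (Suc n) \<subseteq> f n" "f (Suc n) \<noteq> f n" for n using f'[rule_format, of n] by auto
  have "ideal (f n) k" for n
  proof (rule idealI)
    note sub = bspec[OF S(2) f(1)[of n]]
    then have sub': "f n \<subseteq> carrier k" "\<zero>\<^bsub>k\<^esub> \<in> f n" "\<And>x y. x \<in> f n \<Longrightarrow> y \<in> f n \<Longrightarrow> x \<oplus>\<^bsub>k\<^esub> y \<in> f n"
      "\<And>a x. a \<in> carrier k \<Longrightarrow> x \<in> f n \<Longrightarrow> a \<otimes>\<^bsub>k\<^esub> x \<in> f n" unfolding reg.is_submodule_iff by auto
    have neg: "\<ominus>\<^bsub>k\<^esub> x \<in> f n" if "x \<in> f n" for x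
      using sub'(4)[of "\<ominus>\<^bsub>k\<^esub> \<one>\<^bsub>k\<^esub>" x] that sub'(1) by (auto simp: l_minus)
    show "subgroup (f n) (add_monoid k)"
      using sub' neg by (intro subgroup.intro) (auto simp: a_inv_def)
    show "ring k" by (rule ring_axioms)
    show "x \<otimes>\<^bsub>k\<^esub> a \<in> f n" if "a \<in> f n" "x \<in> carrier k" for a x using sub' that by auto
    then show "a \<otimes>\<^bsub>k\<^esub> x \<in> f n" if "a \<in> f n" "x \<in> carrier k" for a x
      using sub'(1) that by (metis m_comm subsetD)
  qed
  then have "\<exists>n. \<forall>m\<ge>n. f m = f n" using assms f(2) by (simp add: artinian_cring_def)
  then obtain n where n: "\<forall>m\<ge>n. f m = f n" by (rule exE)
  have "f (Suc n) = f n" by (rule n[rule_format]) simp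
  then show False using f(3)[of n] by contradiction
qed

lemma opp_ring_simps [simp]:
  "carrier (opp_ring R) = carrier R" "\<zero>\<^bsub>opp_ring R\<^esub> = \<zero>\<^bsub>R\<^esub>" "\<one>\<^bsub>opp_ring R\<^esub> = \<one>\<^bsub>R\<^esub>"
  "x \<oplus>\<^bsub>opp_ring R\<^esub> y = x \<oplus>\<^bsub>R\<^esub> y" "x \<otimes>\<^bsub>opp_ring R\<^esub> y = y \<otimes>\<^bsub>R\<^esub> x"
  by (simp_all add: opp_ring_def)

lemma ring_opp_ring: "ring R \<Longrightarrow> ring (opp_ring R)"
proof -
  assume "ring R"
  then interpret ring R .
  have "\<exists>y\<in>carrier R. y \<oplus>\<^bsub>R\<^esub> x = \<zero>\<^bsub>R\<^esub>" if "x \<in> carrier R" for x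
    using l_neg[OF that] a_inv_closed[OF that] by blast
  then show ?thesis
    by (intro ringI abelian_groupI monoidI) (simp_all add: a_ac m_assoc l_distr r_distr)
qed

text \<open>Since \<open>\<phi>\<close> has central image, left and right ideals alike are
  \<open>k\<close>-submodules of the finitely generated, hence artinian, \<open>k\<close>-module
  \<open>A\<close>.\<close>

lemma artin_algebra_artinian:
  assumes "artin_algebra k \<phi> A"
  shows "artinian_module A (regular_module A)"
    and "artinian_module (opp_ring A) (regular_module (opp_ring A))"
proof -
  note alg = assms[unfolded artin_algebra_def]
  have k: "artinian_cring k" and A: "ring A" and hom: "\<phi> \<in> ring_hom k A" and fg: "fin_gen k (scalar_module \<phi> A)"
    using alg by blast+
  have comm: "\<phi> a \<otimes>\<^bsub>A\<^esub> x = x \<otimes>\<^bsub>A\<^esub> \<phi> a" if "a \<in> carrier k" "x \<in> carrier A" for a x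
    using alg that by blast
  have \<phi>: "\<phi> a \<in> carrier A" if "a \<in> carrier k" for a
    using hom that by (rule ring_hom_closed)
  interpret ring A by fact
  interpret K: left_module k "scalar_module \<phi> A" using fg unfolding fin_gen_def by (rule conjunct1)
  interpret L: left_module A "regular_module A" by (rule left_module_regular) (rule ring_axioms)
  interpret Ro: left_module "opp_ring A" "regular_module (opp_ring A)"
    by (intro left_module_regular ring_opp_ring ring_axioms)
  have art: "artinian_module k (scalar_module \<phi> A)"
    using fg artinian_cring_regular[OF k] by (rule fin_gen_artinian)
  have "submodule N k (scalar_module \<phi> A)" if "submodule N A (regular_module A)" for N
    using that \<phi> unfolding K.is_submodule_iff L.is_submodule_iff by auto
  with art show "artinian_module A (regular_module A)" by (rule artinian_module_coarsen)
  have "submodule N k (scalar_module \<phi> A)" if "submodule N (opp_ring A) (regular_module (opp_ring A))" for N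
    using that \<phi> unfolding K.is_submodule_iff Ro.is_submodule_iff by (auto simp: comm subset_iff)
  with art show "artinian_module (opp_ring A) (regular_module (opp_ring A))" by (rule artinian_module_coarsen)
qed

text \<open>Artinian modules are linearly compact. A system of equations in unknowns indexed by \<open>Y\<close> is
  given by the solution sets of its members, and \<open>supp\<close> says that each equation involves only
  finitely many unknowns. Zorn's lemma is applied to sets of prescribed values which remain
  compatible with every finite subsystem.\<close>

lemma artinian_compact:
  assumes M: "left_module R M" and art: "artinian_module R M"
    and sub: "\<And>W. W \<in> \<E> \<Longrightarrow> submodule W R (power_module Y M)"
    and supp: "\<And>W. W \<in> \<E> \<Longrightarrow> \<exists>F. finite F \<and> F \<subseteq> Y \<and>
      (\<forall>w\<in>W. \<forall>w'\<in>carrier (power_module Y M). (\<forall>y\<in>F. w y = w' y) \<longrightarrow> w' \<in> W)"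
    and x: "x \<in> Y"
    and fin: "\<And>\<Phi>. finite \<Phi> \<Longrightarrow> \<Phi> \<subseteq> \<E> \<Longrightarrow> \<exists>w\<in>carrier (power_module Y M). (\<forall>W\<in>\<Phi>. w \<in> W) \<and> w x = v"
  shows "\<exists>w\<in>carrier (power_module Y M). (\<forall>W\<in>\<E>. w \<in> W) \<and> w x = v"
proof -
  define P where "P = power_module Y M"
  interpret M: left_module R M by fact
  interpret P: left_module R P unfolding P_def by (rule left_module_power) fact
  have P_at: "w y \<in> carrier M" if "w \<in> carrier P" "y \<in> Y" for w y
    using that by (auto simp: P_def power_simps)
  define sat where "sat \<Phi> F w \<longleftrightarrow> w \<in> carrier P \<and> (\<forall>W\<in>\<Phi>. w \<in> W) \<and> (\<forall>y c. (y, c) \<in> F \<longrightarrow> w y = c)" for \<Phi> F w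
  define FS where "FS \<Psi> \<longleftrightarrow> (x, v) \<in> \<Psi> \<and> \<Psi> \<subseteq> Y \<times> UNIV \<and>
    (\<forall>\<Phi> F. finite \<Phi> \<longrightarrow> \<Phi> \<subseteq> \<E> \<longrightarrow> finite F \<longrightarrow> F \<subseteq> \<Psi> \<longrightarrow> (\<exists>w. sat \<Phi> F w))" for \<Psi>
  have "\<exists>M\<in>Collect FS. \<forall>Z\<in>Collect FS. M \<subseteq> Z \<longrightarrow> Z = M"
  proof (rule subset_Zorn_nonempty)
    have "FS {(x, v)}" unfolding FS_def
    proof (intro conjI allI impI)
      fix \<Phi> F assume "finite \<Phi>" "\<Phi> \<subseteq> \<E>" "F \<subseteq> {(x, v)}"
      then show "\<exists>w. sat \<Phi> F w" using fin[of \<Phi>] unfolding sat_def P_def by blast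
    qed (use x in auto)
    then show "Collect FS \<noteq> {}" by auto
  next
    fix \<C> assume ne: "\<C> \<noteq> {}" and ch: "subset.chain (Collect FS) \<C>"
    have FS: "FS \<Psi>" if "\<Psi> \<in> \<C>" for \<Psi> using ch that by (auto simp: subset.chain_def)
    have "FS (\<Union>\<C>)" unfolding FS_def
    proof (intro conjI allI impI)
      show "(x, v) \<in> \<Union>\<C>" "\<Union>\<C> \<subseteq> Y \<times> UNIV" using ne FS unfolding FS_def by blast+
      fix \<Phi> F assume *: "finite \<Phi>" "\<Phi> \<subseteq> \<E>" "finite F" "F \<subseteq> \<Union>\<C>"
      obtain \<Psi> where "\<Psi> \<in> \<C>" "F \<subseteq> \<Psi>"
        using finite_subset_Union_chain[OF *(3,4) ne ch] by blast
      then show "\<exists>w. sat \<Phi> F w" using FS[of \<Psi>] * unfolding FS_def by blast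
    qed
    then show "\<Union>\<C> \<in> Collect FS" by simp
  qed
  then obtain \<Psi> where \<Psi>: "FS \<Psi>" and max: "\<And>Z. FS Z \<Longrightarrow> \<Psi> \<subseteq> Z \<Longrightarrow> Z = \<Psi>" by auto
  have xv: "(x, v) \<in> \<Psi>" and \<Psi>Y: "\<Psi> \<subseteq> Y \<times> UNIV" using \<Psi> by (auto simp: FS_def)
  have \<Psi>sat: "\<exists>w. sat \<Phi> F w" if "finite \<Phi>" "\<Phi> \<subseteq> \<E>" "finite F" "F \<subseteq> \<Psi>" for \<Phi> F
    using \<Psi> that unfolding FS_def by blast
  have ex_val: "\<exists>c. (y, c) \<in> \<Psi>" if y: "y \<in> Y" for y
  proof -
    \<comment> \<open>The homogeneous version of \<open>sat\<close>. Its values at \<open>y\<close>,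
      collected in \<open>T\<close>, measure the freedom left for this unknown. As these are
      submodules, some finite part \<open>(\<Phi>0, F0)\<close> leaves the least freedom, and any
      value it admits at \<open>y\<close> will do.\<close>
    define hom where "hom \<Phi> F w \<longleftrightarrow> w \<in> carrier P \<and> (\<forall>W\<in>\<Phi>. w \<in> W) \<and> (\<forall>z c. (z, c) \<in> F \<longrightarrow> w z = \<zero>\<^bsub>M\<^esub>)"
      for \<Phi> and F :: "('c \<times> 'b) set" and w
    define T where "T = (\<lambda>(\<Phi>, F). {w y |w. hom \<Phi> F w})"
    define fins where "fins = {(\<Phi>, F). finite \<Phi> \<and> \<Phi> \<subseteq> \<E> \<and> finite F \<and> F \<subseteq> \<Psi>}"
    have subm_add: "w \<oplus>\<^bsub>P\<^esub> w' \<in> W" if "W \<in> \<E>" "w \<in> W" "w' \<in> W" for W w w'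
      using sub[OF that(1), folded P_def] that by (simp add: P.is_submodule_iff)
    have subm_act: "a \<odot>\<^bsub>P\<^esub> w \<in> W" if "W \<in> \<E>" "w \<in> W" "a \<in> carrier R" for W w a
      using sub[OF that(1), folded P_def] that by (simp add: P.is_submodule_iff)
    have at: "(w \<oplus>\<^bsub>P\<^esub> w') z = w z \<oplus>\<^bsub>M\<^esub> w' z" "(a \<odot>\<^bsub>P\<^esub> w) z = a \<odot>\<^bsub>M\<^esub> w z" "\<zero>\<^bsub>P\<^esub> z = \<zero>\<^bsub>M\<^esub>"
      if "z \<in> Y" for w w' a z using that by (simp_all add: P_def power_simps)
    have homT: "submodule (T \<pi>) R M" if "\<pi> \<in> fins" for \<pi>
    proof -
      obtain \<Phi> F where \<pi>: "\<pi> = (\<Phi>, F)" by fastforce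
      have \<Phi>: "\<Phi> \<subseteq> \<E>" and F: "\<And>z c. (z, c) \<in> F \<Longrightarrow> z \<in> Y" using that \<Psi>Y by (auto simp: \<pi> fins_def)
      have \<Phi>E: "W \<in> \<E>" if "W \<in> \<Phi>" for W using that \<Phi> by auto
      have z: "hom \<Phi> F \<zero>\<^bsub>P\<^esub>" using F sub[OF \<Phi>E, folded P_def] unfolding hom_def
        by (simp add: at P.is_submodule_iff)
      have a: "hom \<Phi> F (w \<oplus>\<^bsub>P\<^esub> w')" if "hom \<Phi> F w" "hom \<Phi> F w'" for w w'
        using that F unfolding hom_def by (auto simp: at intro: subm_add \<Phi>E)
      have s: "hom \<Phi> F (r \<odot>\<^bsub>P\<^esub> w)" if "hom \<Phi> F w" "r \<in> carrier R" for r w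
        using that F unfolding hom_def by (auto simp: at P.act_closed M.act_zero_right intro: subm_act \<Phi>E)
      show ?thesis unfolding M.is_submodule_iff \<pi> T_def
      proof (intro conjI ballI; clarsimp)
        show "w y \<in> carrier M" if "hom \<Phi> F w" for w using that y by (auto simp: hom_def P_at)
        show "\<exists>w. \<zero>\<^bsub>M\<^esub> = w y \<and> hom \<Phi> F w" using z y at(3) by metis
        show "\<exists>w''. w y \<oplus>\<^bsub>M\<^esub> w' y = w'' y \<and> hom \<Phi> F w''" if "hom \<Phi> F w" "hom \<Phi> F w'" for w w'
          using a[OF that] y at(1) by metis
        show "\<exists>w''. r \<odot>\<^bsub>M\<^esub> w y = w'' y \<and> hom \<Phi> F w''" if "r \<in> carrier R" "hom \<Phi> F w" for r w
          using s[OF that(2,1)] y at(2) by metis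
      qed
    qed
    have "({}, {}) \<in> fins" by (simp add: fins_def)
    from artinian_module_minimal[OF art this homT]
    obtain \<Phi>0 F0 where fins0: "(\<Phi>0, F0) \<in> fins"
      and min0: "\<And>\<pi>. \<pi> \<in> fins \<Longrightarrow> T \<pi> \<subseteq> T (\<Phi>0, F0) \<Longrightarrow> T \<pi> = T (\<Phi>0, F0)" by fast
    then have f0: "finite \<Phi>0" "\<Phi>0 \<subseteq> \<E>" "finite F0" "F0 \<subseteq> \<Psi>" by (auto simp: fins_def)
    obtain w0 where w0: "sat \<Phi>0 F0 w0" using \<Psi>sat[OF f0] by blast
    have "FS (insert (y, w0 y) \<Psi>)" unfolding FS_def
    proof (intro conjI allI impI)
      fix \<Phi> F assume *: "finite \<Phi>" "\<Phi> \<subseteq> \<E>" "finite F" "F \<subseteq> insert (y, w0 y) \<Psi>"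
      define F' where "F' = F - {(y, w0 y)}"
      have new: "finite (\<Phi> \<union> \<Phi>0)" "\<Phi> \<union> \<Phi>0 \<subseteq> \<E>" "finite (F' \<union> F0)" "F' \<union> F0 \<subseteq> \<Psi>"
        using * f0 by (auto simp: F'_def)
      obtain w1 where w1: "sat (\<Phi> \<union> \<Phi>0) (F' \<union> F0) w1" using \<Psi>sat[OF new] by blast
      have "T (\<Phi> \<union> \<Phi>0, F' \<union> F0) \<subseteq> T (\<Phi>0, F0)" by (auto simp: T_def hom_def)
      then have Teq: "T (\<Phi> \<union> \<Phi>0, F' \<union> F0) = T (\<Phi>0, F0)" using new by (intro min0) (auto simp: fins_def)
      have wP: "w0 \<in> carrier P" "w1 \<in> carrier P" using w0 w1 by (auto simp: sat_def)
      \<comment> \<open>Two solutions of the minimal part differ at \<open>y\<close> by an element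
        of \<open>T\<close>. By minimality the larger system still admits this difference, so adding
        the corresponding \<open>w2\<close> moves \<open>w1\<close> to the value
        \<open>w0 y\<close>.\<close>
      define d where "d = w0 \<oplus>\<^bsub>P\<^esub> (\<ominus>\<^bsub>R\<^esub> \<one>\<^bsub>R\<^esub>) \<odot>\<^bsub>P\<^esub> w1"
      have at_d: "d z = w0 z \<oplus>\<^bsub>M\<^esub> \<ominus>\<^bsub>M\<^esub> w1 z" if "z \<in> Y" for z
        unfolding d_def using that wP by (simp add: at M.act_minus_one P_at)
      have "hom \<Phi>0 F0 d" unfolding hom_def
      proof (intro conjI ballI allI impI)
        show "d \<in> carrier P" unfolding d_def using wP by (simp add: P.act_closed)
        show "d \<in> W" if W: "W \<in> \<Phi>0" for W
        proof -
          have "W \<in> \<E>" "w0 \<in> W" "w1 \<in> W" using W f0(2) w0 w1 by (auto simp: sat_def)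
          then show ?thesis unfolding d_def by (intro subm_add subm_act) auto
        qed
        show "d z = \<zero>\<^bsub>M\<^esub>" if zc: "(z, c) \<in> F0" for z c
        proof -
          have z: "z \<in> Y" using zc f0(4) \<Psi>Y by auto
          have "w0 z = c" "w1 z = c" using w0 w1 zc by (auto simp: sat_def)
          then show ?thesis using at_d[OF z] P_at[OF wP(1) z] by (simp add: M.r_neg)
        qed
      qed
      then have "d y \<in> T (\<Phi> \<union> \<Phi>0, F' \<union> F0)" unfolding Teq by (auto simp: T_def)
      then obtain w2 where w2: "hom (\<Phi> \<union> \<Phi>0) (F' \<union> F0) w2" "w2 y = d y" by (auto simp: T_def)
      have w2P: "w2 \<in> carrier P" using w2 by (auto simp: hom_def)
      have "sat \<Phi> F (w1 \<oplus>\<^bsub>P\<^esub> w2)" unfolding sat_def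
      proof (intro conjI ballI allI impI)
        show "w1 \<oplus>\<^bsub>P\<^esub> w2 \<in> carrier P" using wP w2P by simp
        show "w1 \<oplus>\<^bsub>P\<^esub> w2 \<in> W" if W: "W \<in> \<Phi>" for W
        proof -
          have "W \<in> \<E>" "w1 \<in> W" "w2 \<in> W" using W *(2) w1 w2 by (auto simp: sat_def hom_def)
          then show ?thesis by (rule subm_add)
        qed
        show "(w1 \<oplus>\<^bsub>P\<^esub> w2) z = c" if zc: "(z, c) \<in> F" for z c
        proof (cases "(z, c) = (y, w0 y)")
          case True
          have "w1 y \<oplus>\<^bsub>M\<^esub> (w0 y \<oplus>\<^bsub>M\<^esub> \<ominus>\<^bsub>M\<^esub> w1 y) = w0 y"
            using P_at[OF wP(1) y] P_at[OF wP(2) y]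
            by (metis M.M.a_comm M.M.a_assoc M.M.a_inv_closed M.M.l_neg M.M.r_zero)
          then show ?thesis using True y w2(2) at_d[OF y] by (simp add: at)
        next
          case False
          then have zc': "(z, c) \<in> F'" using zc by (simp add: F'_def)
          then have z: "z \<in> Y" using new(4) \<Psi>Y by auto
          moreover have "w1 z = c" "w2 z = \<zero>\<^bsub>M\<^esub>" using zc' w1 w2(1) by (auto simp: sat_def hom_def)
          ultimately show ?thesis using P_at[OF wP(2) z] by (simp add: at)
        qed
      qed
      then show "\<exists>w. sat \<Phi> F w" by (rule exI[of "sat \<Phi> F"])
    qed (use xv \<Psi>Y y in auto)
    then have "insert (y, w0 y) \<Psi> = \<Psi>" by (rule max) auto
    then show ?thesis by blast
  qed
  have uniq: "c = c'" if "(y, c) \<in> \<Psi>" "(y, c') \<in> \<Psi>" for y c c'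
  proof -
    have "\<exists>w. sat {} {(y, c), (y, c')} w" using that by (intro \<Psi>sat) auto
    then show ?thesis by (auto simp: sat_def)
  qed
  define w where "w = (\<lambda>y\<in>Y. THE c. (y, c) \<in> \<Psi>)"
  have w: "(y, w y) \<in> \<Psi>" if "y \<in> Y" for y
    using ex_val[OF that] that by (auto simp: w_def intro: theI uniq)
  have agree: "\<exists>w'. sat \<Phi> ((\<lambda>y. (y, w y)) ` F) w'" if "finite \<Phi>" "\<Phi> \<subseteq> \<E>" "finite F" "F \<subseteq> Y" for \<Phi> F
    using that w by (intro \<Psi>sat) auto
  have wP: "w \<in> carrier P"
  proof -
    have "w y \<in> carrier M" if "y \<in> Y" for y
      using agree[of "{}" "{y}"] that by (auto simp: sat_def dest: P_at)
    then show ?thesis by (auto simp: P_def power_simps w_def)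
  qed
  have "w \<in> W" if W: "W \<in> \<E>" for W
  proof -
    \<comment> \<open>Membership of \<open>w\<close> in \<open>W\<close> is decided by finitely many
      of its values, and on those it agrees with an actual solution.\<close>
    obtain F where F: "finite F" "F \<subseteq> Y"
      "\<forall>w\<in>W. \<forall>w'\<in>carrier P. (\<forall>y\<in>F. w y = w' y) \<longrightarrow> w' \<in> W" using supp[OF W] unfolding P_def by blast
    obtain w' where "sat {W} ((\<lambda>y. (y, w y)) ` F) w'" using agree[of "{W}" F] W F by auto
    then show ?thesis using F(3) wP by (auto simp: sat_def)
  qed
  moreover have "w x = v" using uniq[OF w[OF x] xv] .
  ultimately show ?thesis using wP unfolding P_def by blast
qed

section \<open>Resolutions of cyclic modules up to annihilators\<close>

text \<open>The working form of cogeneration: coordinates of an embedding separate points, and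
  conversely \<open>mhom R E M\<close> itself serves as index set of an embedding.\<close>

lemma cogenerated_iff:
  assumes M: "left_module R M" and E: "left_module R E"
  shows "cogenerated R M E \<longleftrightarrow>
    (\<forall>y\<in>carrier E. y \<noteq> \<zero>\<^bsub>E\<^esub> \<longrightarrow> (\<exists>\<beta>\<in>mhom R E M. \<beta> y \<noteq> \<zero>\<^bsub>M\<^esub>))"
proof
  assume "cogenerated R M E"
  then obtain S :: "('c \<Rightarrow> 'b) set" and f where f: "f \<in> mhom R E (power_module S M)" "inj_on f (carrier E)"
    unfolding cogenerated_def by (elim exE conjE)
  interpret E: left_module R E by fact
  interpret M: left_module R M by fact
  interpret P: left_module R "power_module S M" by (rule left_module_power) fact
  show "\<forall>y\<in>carrier E. y \<noteq> \<zero>\<^bsub>E\<^esub> \<longrightarrow> (\<exists>\<beta>\<in>mhom R E M. \<beta> y \<noteq> \<zero>\<^bsub>M\<^esub>)"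
  proof (intro ballI impI)
    fix y assume y: "y \<in> carrier E" "y \<noteq> \<zero>\<^bsub>E\<^esub>"
    have f0: "f \<zero>\<^bsub>E\<^esub> = \<zero>\<^bsub>power_module S M\<^esub>" by (rule mhom_zero[OF E P.left_module_axioms f(1)])
    have fy: "f y \<in> carrier (power_module S M)" using f(1) y(1) by (rule mhom_closed)
    have "f y \<noteq> f \<zero>\<^bsub>E\<^esub>" using y inj_onD[OF f(2)] E.M.zero_closed by metis
    moreover have "f y = \<zero>\<^bsub>power_module S M\<^esub>" if "\<forall>s\<in>S. f y s = \<zero>\<^bsub>M\<^esub>"
      using fy that by (intro PiE_ext[of _ S "\<lambda>_. carrier M"]) (auto simp: power_simps)
    ultimately have "\<exists>s\<in>S. f y s \<noteq> \<zero>\<^bsub>M\<^esub>" unfolding f0 by auto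
    then obtain s where s: "s \<in> S" "f y s \<noteq> \<zero>\<^bsub>M\<^esub>" by (rule bexE)
    show "\<exists>\<beta>\<in>mhom R E M. \<beta> y \<noteq> \<zero>\<^bsub>M\<^esub>"
    proof (rule bexI)
      show "compose (carrier E) (\<lambda>v\<in>carrier (power_module S M). v s) f \<in> mhom R E M"
        by (rule compose_mhom[OF E f(1) proj_mhom[OF M s(1)]])
      show "compose (carrier E) (\<lambda>v\<in>carrier (power_module S M). v s) f y \<noteq> \<zero>\<^bsub>M\<^esub>"
        using s fy y by (simp add: compose_def)
    qed
  qed
next
  assume sep: "\<forall>y\<in>carrier E. y \<noteq> \<zero>\<^bsub>E\<^esub> \<longrightarrow> (\<exists>\<beta>\<in>mhom R E M. \<beta> y \<noteq> \<zero>\<^bsub>M\<^esub>)"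
  interpret E: left_module R E by fact
  interpret M: left_module R M by fact
  define f where "f = (\<lambda>y\<in>carrier E. \<lambda>\<beta>\<in>mhom R E M. \<beta> y)"
  have "f \<in> mhom R E (power_module (mhom R E M) M)" unfolding f_def
    by (intro restrict_mhom E) (auto simp: power_simps mhom_closed mhom_add mhom_act intro!: restrict_ext)
  moreover have "inj_on f (carrier E)"
  proof (rule inj_onI, rule ccontr)
    fix y z assume yz: "y \<in> carrier E" "z \<in> carrier E" "f y = f z" "y \<noteq> z"
    define w where "w = y \<oplus>\<^bsub>E\<^esub> \<ominus>\<^bsub>E\<^esub> z"
    have "w \<noteq> \<zero>\<^bsub>E\<^esub>"
      unfolding w_def using yz by (metis E.M.minus_equality E.M.minus_minus E.M.a_inv_closed)
    moreover have "w \<in> carrier E" using yz by (simp add: w_def)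
    ultimately obtain \<beta> where \<beta>: "\<beta> \<in> mhom R E M" "\<beta> w \<noteq> \<zero>\<^bsub>M\<^esub>" using sep by auto
    have "\<beta> y = \<beta> z" using fun_cong[OF yz(3), of \<beta>] yz \<beta>(1) by (simp add: f_def)
    then have "\<beta> w = \<zero>\<^bsub>M\<^esub>" unfolding w_def using yz mhom_closed[OF \<beta>(1)]
      by (simp add: mhom_add[OF \<beta>(1)] mhom_minus[OF E M \<beta>(1)] M.M.r_neg)
    then show False using \<beta>(2) by contradiction
  qed
  ultimately show "cogenerated R M E" unfolding cogenerated_def by (intro exI conjI)
qed

lemma image_tuple:
  assumes "c \<in> A \<rightarrow> f ` B"
  obtains b where "b \<in> A \<rightarrow> B" "\<And>j. j \<in> A \<Longrightarrow> c j = f (b j)"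
proof -
  have "\<forall>j\<in>A. \<exists>x. x \<in> B \<and> c j = f x" using assms by blast
  from bchoice[OF this] show thesis using that by blast
qed

lemma finsum_scalar_module: "finsum (scalar_module \<phi> A) = finsum A"
  by (intro ext) (simp add: finsum_def finprod_def scalar_module_def)

lemma lincomb_regular: "lincomb (regular_module R) F p c = (\<Oplus>\<^bsub>R\<^esub>i\<in>F. p i \<otimes>\<^bsub>R\<^esub> c i)"
  by (simp add: lincomb_def finsum_scalar_module)

text \<open>Column \<open>j\<close> of \<open>D a\<close> holds the coordinates of the image of the
  \<open>j\<close>-th basis vector of the next free module, so this is composition with the
  differential. It also dictates the order of the factors in \<open>complex\<close>.\<close>

definition cobdry :: "('r, 'a) module \<Rightarrow> (nat \<Rightarrow> nat) \<Rightarrow> (nat \<Rightarrow> nat \<Rightarrow> nat \<Rightarrow> 'r) \<Rightarrow> nat \<Rightarrow>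
    (nat \<Rightarrow> 'a) \<Rightarrow> nat \<Rightarrow> 'a" where
  "cobdry C m D a c j = lincomb C {..<m a} (\<lambda>i. D a i j) c"

text \<open>A complex of matrices \<open>D a\<close> represents maps of free modules \<open>P (a + 1) \<rightarrow> P a\<close> with
  \<open>P a\<close> of rank \<open>m a\<close>, so that \<open>Hom (P a, C)\<close> is the set of \<open>m a\<close>-tuples in \<open>C\<close>. The index is
  shifted: \<open>m 0 = 0\<close> below, and exactness at \<open>a\<close> is exactness at the tuples of length
  \<open>m (a + 1)\<close>, so that it means vanishing of \<open>Ext\<^sup>a\<close>.\<close>

definition exact_at :: "('r, 'a) module \<Rightarrow> (nat \<Rightarrow> nat) \<Rightarrow> (nat \<Rightarrow> nat \<Rightarrow> nat \<Rightarrow> 'r) \<Rightarrow> 'a set \<Rightarrow>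
    nat \<Rightarrow> bool" where
  "exact_at C m D K a \<longleftrightarrow> (\<forall>c\<in>{..<m (Suc a)} \<rightarrow> K.
     (\<forall>l<m (Suc (Suc a)). cobdry C m D (Suc a) c l = \<zero>\<^bsub>C\<^esub>) \<longrightarrow>
     (\<exists>c'\<in>{..<m a} \<rightarrow> K. \<forall>j<m (Suc a). c j = cobdry C m D a c' j))"

lemma exact_atD:
  assumes "exact_at C m D K a" "c \<in> {..<m (Suc a)} \<rightarrow> K"
    "\<And>l. l < m (Suc (Suc a)) \<Longrightarrow> cobdry C m D (Suc a) c l = \<zero>\<^bsub>C\<^esub>"
  obtains c' where "c' \<in> {..<m a} \<rightarrow> K" "\<And>j. j < m (Suc a) \<Longrightarrow> c j = cobdry C m D a c' j"
  using bspec[OF assms(1)[unfolded exact_at_def] assms(2)] assms(3) by auto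

lemma exact_atI:
  assumes "\<And>c. c \<in> {..<m (Suc a)} \<rightarrow> K \<Longrightarrow>
    (\<And>l. l < m (Suc (Suc a)) \<Longrightarrow> cobdry C m D (Suc a) c l = \<zero>\<^bsub>C\<^esub>) \<Longrightarrow>
    \<exists>c'. c' \<in> {..<m a} \<rightarrow> K \<and> (\<forall>j<m (Suc a). c j = cobdry C m D a c' j)"
  shows "exact_at C m D K a"
  unfolding exact_at_def
proof (intro ballI impI)
  fix c assume "c \<in> {..<m (Suc a)} \<rightarrow> K" "\<forall>l<m (Suc (Suc a)). cobdry C m D (Suc a) c l = \<zero>\<^bsub>C\<^esub>"
  then show "\<exists>c'\<in>{..<m a} \<rightarrow> K. \<forall>j<m (Suc a). c j = cobdry C m D a c' j"
    using assms[of c] by (simp add: Bex_def)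
qed

text \<open>With no cochains below, exactness at 0 says that only the zero tuple is a cocycle, and
  this is inherited by subsets.\<close>

lemma exact_at_0_mono: "m 0 = 0 \<Longrightarrow> exact_at C m D K 0 \<Longrightarrow> K' \<subseteq> K \<Longrightarrow> exact_at C m D K' 0"
  by (rule exact_atI, erule exact_atD) auto

locale matrix_complex = ring R for R :: "'r ring" (structure) +
  fixes m :: "nat \<Rightarrow> nat" and D :: "nat \<Rightarrow> nat \<Rightarrow> nat \<Rightarrow> 'r"
  assumes entry_closed: "i < m a \<Longrightarrow> j < m (Suc a) \<Longrightarrow> D a i j \<in> carrier R"
    and complex: "i < m a \<Longrightarrow> l < m (Suc (Suc a)) \<Longrightarrow>
      (\<Oplus>j\<in>{..<m (Suc a)}. D (Suc a) j l \<otimes> D a i j) = \<zero>"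
begin

lemma cobdry_closed:
  assumes "left_module R C" "c \<in> {..<m a} \<rightarrow> carrier C" "j < m (Suc a)"
  shows "cobdry C m D a c j \<in> carrier C"
proof -
  interpret left_module R C by fact
  show ?thesis unfolding cobdry_def using assms(2,3) by (intro lincomb_closed) (auto intro: entry_closed)
qed

lemma cobdry_cong:
  assumes "left_module R C" "c' \<in> {..<m a} \<rightarrow> carrier C" "j < m (Suc a)" "\<And>i. i < m a \<Longrightarrow> c i = c' i"
  shows "cobdry C m D a c j = cobdry C m D a c' j"
proof -
  interpret left_module R C by fact
  show ?thesis unfolding cobdry_def using assms(2-) by (intro lincomb_cong) (auto intro: entry_closed)
qed

lemma cobdry_mhom:
  assumes "left_module R C" "left_module R C'" "f \<in> mhom R C C'" "c \<in> {..<m a} \<rightarrow> carrier C" "j < m (Suc a)"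
  shows "f (cobdry C m D a c j) = cobdry C' m D a (\<lambda>i. f (c i)) j"
  unfolding cobdry_def using assms by (intro mhom_lincomb) (auto intro: entry_closed)

lemma cobdry_image:
  assumes "left_module R C" "left_module R C'" "f \<in> mhom R C C'" "c \<in> {..<m a} \<rightarrow> carrier C" "j < m (Suc a)"
    "\<And>i. i < m a \<Longrightarrow> y i = f (c i)"
  shows "cobdry C' m D a y j = f (cobdry C m D a c j)"
  unfolding cobdry_mhom[OF assms(1-5)] using assms(4,6)
  by (intro cobdry_cong assms) (auto intro!: mhom_closed[OF assms(3)])

lemma cobdry_cobdry:
  assumes "left_module R C" "c \<in> {..<m a} \<rightarrow> carrier C" "l < m (Suc (Suc a))"
  shows "cobdry C m D (Suc a) (cobdry C m D a c) l = \<zero>\<^bsub>C\<^esub>"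
proof -
  interpret left_module R C by fact
  have "cobdry C m D (Suc a) (cobdry C m D a c) l =
      lincomb C {..<m a} (\<lambda>i. \<Oplus>j\<in>{..<m (Suc a)}. D (Suc a) j l \<otimes> D a i j) c"
    unfolding cobdry_def using assms(2,3) by (intro lincomb_lincomb) (auto intro: entry_closed)
  also have "\<dots> = \<zero>\<^bsub>C\<^esub>" using assms(2,3) by (intro lincomb_zero_left) (auto simp: complex)
  finally show ?thesis .
qed

lemma cobdry_diff:
  assumes "left_module R C" "c \<in> {..<m a} \<rightarrow> carrier C" "c' \<in> {..<m a} \<rightarrow> carrier C" "j < m (Suc a)"
  shows "cobdry C m D a (\<lambda>i. c i \<oplus>\<^bsub>C\<^esub> \<ominus>\<^bsub>C\<^esub> c' i) j =
    cobdry C m D a c j \<oplus>\<^bsub>C\<^esub> \<ominus>\<^bsub>C\<^esub> cobdry C m D a c' j"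
proof -
  interpret left_module R C by fact
  show ?thesis unfolding cobdry_def using assms(2-) by (intro lincomb_diff) (auto intro: entry_closed)
qed

text \<open>The next two lemmas are the pieces of the long exact Ext sequence of
  \<open>0 \<rightarrow> ker f \<rightarrow> C \<rightarrow> im f \<rightarrow> 0\<close> used for dimension shifting.\<close>

lemma exact_at_image:
  assumes C: "left_module R C" and C': "left_module R C'" and f: "f \<in> mhom R C C'"
    and exC: "exact_at C m D (carrier C) a"
    and exK: "exact_at C m D {x \<in> carrier C. f x = \<zero>\<^bsub>C'\<^esub>} (Suc a)"
  shows "exact_at C' m D (f ` carrier C) a"
proof (rule exact_atI)
  interpret C: left_module R C by fact
  interpret C': left_module R C' by fact
  fix c assume c: "c \<in> {..<m (Suc a)} \<rightarrow> f ` carrier C"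
    and c0: "\<And>l. l < m (Suc (Suc a)) \<Longrightarrow> cobdry C' m D (Suc a) c l = \<zero>\<^bsub>C'\<^esub>"
  from c obtain b where bC: "b \<in> {..<m (Suc a)} \<rightarrow> carrier C" and b: "\<And>j. j \<in> {..<m (Suc a)} \<Longrightarrow> c j = f (b j)"
    by (rule image_tuple; blast intro: that)
  \<comment> \<open>\<open>b\<close> lifts \<open>c\<close>, and \<open>z\<close> represents the
    image of \<open>c\<close> under the connecting homomorphism. As \<open>z\<close> bounds in the
    kernel, the lift can be corrected to a cocycle \<open>b'\<close>.\<close>
  define z where "z = cobdry C m D (Suc a) b"
  have zC: "z l \<in> carrier C" if "l < m (Suc (Suc a))" for l
    unfolding z_def using C bC that by (rule cobdry_closed)
  have "f (z l) = \<zero>\<^bsub>C'\<^esub>" if l: "l < m (Suc (Suc a))" for l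
    using cobdry_image[OF C C' f bC l, of c] b c0[OF l] by (simp add: z_def)
  then have "z \<in> {..<m (Suc (Suc a))} \<rightarrow> {x \<in> carrier C. f x = \<zero>\<^bsub>C'\<^esub>}" using zC by auto
  moreover have "cobdry C m D (Suc (Suc a)) z l = \<zero>\<^bsub>C\<^esub>" if "l < m (Suc (Suc (Suc a)))" for l
    unfolding z_def using C bC that by (rule cobdry_cobdry)
  ultimately obtain k where k: "k \<in> {..<m (Suc a)} \<rightarrow> {x \<in> carrier C. f x = \<zero>\<^bsub>C'\<^esub>}"
    "\<And>l. l < m (Suc (Suc a)) \<Longrightarrow> z l = cobdry C m D (Suc a) k l" by (rule exact_atD[OF exK]; blast intro: that)
  have kC: "k \<in> {..<m (Suc a)} \<rightarrow> carrier C" using k(1) by auto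
  define b' where "b' j = b j \<oplus>\<^bsub>C\<^esub> \<ominus>\<^bsub>C\<^esub> k j" for j
  have "b' \<in> {..<m (Suc a)} \<rightarrow> carrier C" using bC kC by (auto simp: b'_def Pi_iff)
  moreover have "cobdry C m D (Suc a) b' l = \<zero>\<^bsub>C\<^esub>" if l: "l < m (Suc (Suc a))" for l
    unfolding b'_def cobdry_diff[OF C bC kC l] k(2)[OF l, symmetric] z_def[symmetric]
    using zC[OF l] by (rule C.M.r_neg)
  ultimately obtain x where x: "x \<in> {..<m a} \<rightarrow> carrier C" "\<And>j. j < m (Suc a) \<Longrightarrow> b' j = cobdry C m D a x j"
    by (rule exact_atD[OF exC]; blast intro: that)
  show "\<exists>c'. c' \<in> {..<m a} \<rightarrow> f ` carrier C \<and> (\<forall>j<m (Suc a). c j = cobdry C' m D a c' j)"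
  proof (intro exI conjI allI impI)
    show "(\<lambda>i. f (x i)) \<in> {..<m a} \<rightarrow> f ` carrier C" using x(1) by auto
    fix j assume j: "j < m (Suc a)"
    have bk: "b j \<in> carrier C" "k j \<in> carrier C" "f (k j) = \<zero>\<^bsub>C'\<^esub>" "c j = f (b j)"
      using b bC k(1) j by auto
    have "f (b' j) = c j" unfolding b'_def bk(4)
      using bk(1-3) mhom_closed[OF f bk(1)] by (simp add: mhom_add[OF f] mhom_minus[OF C C' f])
    then show "c j = cobdry C' m D a (\<lambda>i. f (x i)) j"
      using x(2)[OF j] cobdry_mhom[OF C C' f x(1) j] by simp
  qed
qed

lemma exact_at_kernel:
  assumes C: "left_module R C" and C': "left_module R C'" and f: "f \<in> mhom R C C'"
    and exF: "exact_at C' m D (f ` carrier C) a"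
    and exC: "exact_at C m D (carrier C) (Suc a)"
  shows "exact_at C m D {x \<in> carrier C. f x = \<zero>\<^bsub>C'\<^esub>} (Suc a)"
proof (rule exact_atI)
  interpret C: left_module R C by fact
  interpret C': left_module R C' by fact
  fix c assume c: "c \<in> {..<m (Suc (Suc a))} \<rightarrow> {x \<in> carrier C. f x = \<zero>\<^bsub>C'\<^esub>}"
    and c0: "\<And>l. l < m (Suc (Suc (Suc a))) \<Longrightarrow> cobdry C m D (Suc (Suc a)) c l = \<zero>\<^bsub>C\<^esub>"
  have "c \<in> {..<m (Suc (Suc a))} \<rightarrow> carrier C" using c by auto
  then obtain b where b: "b \<in> {..<m (Suc a)} \<rightarrow> carrier C"
    "\<And>l. l < m (Suc (Suc a)) \<Longrightarrow> c l = cobdry C m D (Suc a) b l"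
    using c0 by (rule exact_atD[OF exC]; blast intro: that)
  have "(\<lambda>j. f (b j)) \<in> {..<m (Suc a)} \<rightarrow> f ` carrier C" using b(1) by auto
  moreover have "cobdry C' m D (Suc a) (\<lambda>j. f (b j)) l = \<zero>\<^bsub>C'\<^esub>" if l: "l < m (Suc (Suc a))" for l
  proof -
    have "f (c l) = \<zero>\<^bsub>C'\<^esub>" using c l by auto
    then show ?thesis using cobdry_mhom[OF C C' f b(1) l] unfolding b(2)[OF l] by simp
  qed
  ultimately obtain y where y: "y \<in> {..<m a} \<rightarrow> f ` carrier C"
    "\<And>j. j < m (Suc a) \<Longrightarrow> f (b j) = cobdry C' m D a y j" by (rule exact_atD[OF exF]; blast intro: that)
  from y(1) obtain x where xC: "x \<in> {..<m a} \<rightarrow> carrier C" and x: "\<And>i. i \<in> {..<m a} \<Longrightarrow> y i = f (x i)"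
    by (rule image_tuple; blast intro: that)
  have dx: "cobdry C m D a x j \<in> carrier C" if "j < m (Suc a)" for j
    using C xC that by (rule cobdry_closed)
  have fdx: "f (cobdry C m D a x j) = f (b j)" if j: "j < m (Suc a)" for j
    using cobdry_image[OF C C' f xC j, of y] x y(2)[OF j] by simp
  \<comment> \<open>Subtracting the coboundary of a lift of \<open>y\<close> moves \<open>b\<close>
    into the kernel of \<open>f\<close> without changing its own coboundary.\<close>
  define c' where "c' j = b j \<oplus>\<^bsub>C\<^esub> \<ominus>\<^bsub>C\<^esub> cobdry C m D a x j" for j
  have bC: "b j \<in> carrier C" if "j < m (Suc a)" for j using b(1) that by auto
  have "f (c' j) = \<zero>\<^bsub>C'\<^esub>" if j: "j < m (Suc a)" for j
    unfolding c'_def using bC[OF j] dx[OF j] mhom_closed[OF f bC[OF j]]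
    by (simp add: mhom_add[OF f] mhom_minus[OF C C' f] fdx[OF j] C'.M.r_neg)
  then have c': "c' \<in> {..<m (Suc a)} \<rightarrow> {x \<in> carrier C. f x = \<zero>\<^bsub>C'\<^esub>}"
    using bC dx by (auto simp: c'_def)
  have "c l = cobdry C m D (Suc a) c' l" if l: "l < m (Suc (Suc a))" for l
  proof -
    have dxC: "cobdry C m D a x \<in> {..<m (Suc a)} \<rightarrow> carrier C" using dx by auto
    have "c l \<in> carrier C" using c l by auto
    then show ?thesis
      using b(2)[OF l] unfolding c'_def cobdry_diff[OF C b(1) dxC l] cobdry_cobdry[OF C xC l] by simp
  qed
  with c' show "\<exists>c'. c' \<in> {..<m (Suc a)} \<rightarrow> {x \<in> carrier C. f x = \<zero>\<^bsub>C'\<^esub>} \<and>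
      (\<forall>j<m (Suc (Suc a)). c j = cobdry C m D (Suc a) c' j)"
    by (intro exI[of _ c'] conjI allI impI)
qed

lemma exact_at_zero:
  assumes "left_module R C"
  shows "exact_at C m D {\<zero>\<^bsub>C\<^esub>} a"
proof (rule exact_atI, intro exI conjI allI impI)
  interpret left_module R C by fact
  fix c j assume c: "c \<in> {..<m (Suc a)} \<rightarrow> {\<zero>\<^bsub>C\<^esub>}" and j: "j < m (Suc a)"
  have "cobdry C m D a (\<lambda>_. \<zero>\<^bsub>C\<^esub>) j = \<zero>\<^bsub>C\<^esub>"
    unfolding cobdry_def using j by (intro lincomb_zero) (auto intro: entry_closed)
  then show "c j = cobdry C m D a (\<lambda>_. \<zero>\<^bsub>C\<^esub>) j" using c j by auto
qed auto

text \<open>Identifies a module with its image in the first term of an injective resolution, so that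
  dimension shifting takes place among subsets of the terms.\<close>

lemma exact_at_embedding:
  assumes C: "left_module R C" and C': "left_module R C'" and f: "f \<in> mhom R C C'" and inj: "inj_on f (carrier C)"
  shows "exact_at C' m D (f ` carrier C) a \<longleftrightarrow> exact_at C m D (carrier C) a"
proof -
  interpret C: left_module R C by fact
  interpret C': left_module R C' by fact
  have f0: "x = \<zero>\<^bsub>C\<^esub>" if "x \<in> carrier C" "f x = \<zero>\<^bsub>C'\<^esub>" for x
    using that inj_onD[OF inj _ that(1) C.M.zero_closed] mhom_zero[OF C C' f] by simp
  show ?thesis
  proof
    assume ex: "exact_at C m D (carrier C) a"
    have "{x \<in> carrier C. f x = \<zero>\<^bsub>C'\<^esub>} = {\<zero>\<^bsub>C\<^esub>}" using f0 mhom_zero[OF C C' f] by auto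
    then show "exact_at C' m D (f ` carrier C) a"
      using exact_at_zero[OF C, of "Suc a"] by (intro exact_at_image[OF C C' f ex]) simp
  next
    assume ex: "exact_at C' m D (f ` carrier C) a"
    show "exact_at C m D (carrier C) a"
    proof (rule exact_atI)
      fix c assume c: "c \<in> {..<m (Suc a)} \<rightarrow> carrier C"
        and c0: "\<And>l. l < m (Suc (Suc a)) \<Longrightarrow> cobdry C m D (Suc a) c l = \<zero>\<^bsub>C\<^esub>"
      have "(\<lambda>j. f (c j)) \<in> {..<m (Suc a)} \<rightarrow> f ` carrier C" using c by auto
      moreover have "cobdry C' m D (Suc a) (\<lambda>j. f (c j)) l = \<zero>\<^bsub>C'\<^esub>" if l: "l < m (Suc (Suc a))" for l
        using cobdry_mhom[OF C C' f c l] c0[OF l] mhom_zero[OF C C' f] by simp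
      ultimately obtain y where y: "y \<in> {..<m a} \<rightarrow> f ` carrier C"
        "\<And>j. j < m (Suc a) \<Longrightarrow> f (c j) = cobdry C' m D a y j" by (rule exact_atD[OF ex]; blast intro: that)
      from y(1) obtain x where xC: "x \<in> {..<m a} \<rightarrow> carrier C" and x: "\<And>i. i \<in> {..<m a} \<Longrightarrow> y i = f (x i)"
        by (rule image_tuple; blast intro: that)
      have "c j = cobdry C m D a x j" if j: "j < m (Suc a)" for j
      proof (rule inj_onD[OF inj])
        show "f (c j) = f (cobdry C m D a x j)" using cobdry_image[OF C C' f xC j, of y] x y(2)[OF j] by simp
      qed (use c j cobdry_closed[OF C xC j] in auto)
      then show "\<exists>c'. c' \<in> {..<m a} \<rightarrow> carrier C \<and> (\<forall>j<m (Suc a). c j = cobdry C m D a c' j)"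
        using xC by (intro exI[of _ x]) simp
    qed
  qed
qed

text \<open>Ext commutes with products in the second argument: the equations are solved coordinate
  by coordinate.\<close>

lemma exact_at_power:
  assumes C: "left_module R C" and ex: "exact_at C m D (carrier C) a"
  shows "exact_at (power_module F C) m D (carrier (power_module F C)) a"
proof (rule exact_atI)
  interpret C: left_module R C by fact
  let ?P = "power_module F C"
  interpret P: left_module R ?P by (rule left_module_power) fact
  have at: "cobdry ?P m D a c j x = cobdry C m D a (\<lambda>i. c i x) j"
    if "c \<in> {..<m a} \<rightarrow> carrier ?P" "j < m (Suc a)" "x \<in> F" for a c j x
    unfolding cobdry_def using that by (intro lincomb_power[OF C]) (auto intro: entry_closed)
  fix c assume c: "c \<in> {..<m (Suc a)} \<rightarrow> carrier ?P"
    and c0: "\<And>l. l < m (Suc (Suc a)) \<Longrightarrow> cobdry ?P m D (Suc a) c l = \<zero>\<^bsub>?P\<^esub>"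
  have "\<exists>b. b \<in> {..<m a} \<rightarrow> carrier C \<and> (\<forall>j<m (Suc a). c j x = cobdry C m D a b j)" if x: "x \<in> F" for x
  proof -
    have "(\<lambda>j. c j x) \<in> {..<m (Suc a)} \<rightarrow> carrier C" using c x by (auto simp: power_simps Pi_iff)
    moreover have "cobdry C m D (Suc a) (\<lambda>j. c j x) l = \<zero>\<^bsub>C\<^esub>" if l: "l < m (Suc (Suc a))" for l
      using at[OF c l x] c0[OF l] x by (simp add: zero_power)
    ultimately obtain b where "b \<in> {..<m a} \<rightarrow> carrier C" "\<And>j. j < m (Suc a) \<Longrightarrow> c j x = cobdry C m D a b j"
      by (rule exact_atD[OF ex]; blast intro: that)
    then show ?thesis by (intro exI[of _ b]) simp
  qed
  then have "\<forall>x\<in>F. \<exists>b. b \<in> {..<m a} \<rightarrow> carrier C \<and> (\<forall>j<m (Suc a). c j x = cobdry C m D a b j)" by (rule ballI)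
  from bchoice[OF this] obtain b where
    b: "\<forall>x\<in>F. b x \<in> {..<m a} \<rightarrow> carrier C \<and> (\<forall>j<m (Suc a). c j x = cobdry C m D a (b x) j)" ..
  define b' where "b' i = (\<lambda>x\<in>F. b x i)" for i
  have b': "b' \<in> {..<m a} \<rightarrow> carrier ?P" using b by (auto simp: b'_def power_simps Pi_iff)
  have "c j = cobdry ?P m D a b' j" if j: "j < m (Suc a)" for j
  proof (rule PiE_ext)
    show "c j \<in> F \<rightarrow>\<^sub>E carrier C" using c j by (auto simp: carrier_power)
    show "cobdry ?P m D a b' j \<in> F \<rightarrow>\<^sub>E carrier C"
      using cobdry_closed[OF P.left_module_axioms b' j] by (simp add: carrier_power)
    fix x assume x: "x \<in> F"
    have "cobdry C m D a (\<lambda>i. b' i x) j = cobdry C m D a (b x) j"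
      using b x by (intro cobdry_cong C j) (auto simp: b'_def)
    then show "c j x = cobdry ?P m D a b' j x" using at[OF b' j x] b x j by simp
  qed
  then show "\<exists>c'. c' \<in> {..<m a} \<rightarrow> carrier ?P \<and> (\<forall>j<m (Suc a). c j = cobdry ?P m D a c' j)"
    using b' by (intro exI[of _ b']) simp
qed

end

text \<open>Exactness of the free complex is only required up to what can be detected by \<open>M\<close>. This is
  enough for injective modules cogenerated by \<open>M\<close>, and unlike honest finitely generated resolutions
  such complexes exist without any noetherian hypothesis on \<open>R\<close>.\<close>

locale weak_resolution = matrix_complex R m D + left_module R M
  for R :: "'r ring" (structure) and M :: "('r, 'a) module" (structure) and m D +
  assumes rank_0: "m 0 = 0"
    and weakly_exact: "\<lbrakk>p \<in> {..<m (Suc a)} \<rightarrow> carrier R;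
      \<And>i. i < m a \<Longrightarrow> (\<Oplus>j\<in>{..<m (Suc a)}. p j \<otimes> D a i j) = \<zero>;
      c \<in> {..<m (Suc a)} \<rightarrow> carrier M;
      \<And>l. l < m (Suc (Suc a)) \<Longrightarrow> cobdry M m D (Suc a) c l = \<zero>\<^bsub>M\<^esub>\<rbrakk> \<Longrightarrow>
      lincomb M {..<m (Suc a)} p c = \<zero>\<^bsub>M\<^esub>"
begin

text \<open>A cocycle \<open>c\<close> should define a map on the image of the differential, to be
  extended by injectivity. Well-definedness asks a value in \<open>E\<close> to vanish; as
  \<open>E\<close> is cogenerated by \<open>M\<close>, this is tested after mapping to
  \<open>M\<close>, where \<open>weakly_exact\<close> decides it.\<close>

lemma exact_at_injective:
  assumes inj: "injective R E" and cog: "cogenerated R M E"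
  shows "exact_at E m D (carrier E) a"
proof (rule exact_atI)
  let ?reg = "regular_module R"
  let ?F = "{..<m (Suc a)}"
  define Q where "Q = power_module {..<m a} ?reg"
  have E: "left_module R E" using inj by (rule injective_left_module)
  interpret E: left_module R E by (rule E)
  interpret reg: left_module R ?reg by (rule left_module_regular) (rule ring_axioms)
  interpret Q: left_module R Q unfolding Q_def by (rule left_module_power) (rule reg.left_module_axioms)
  fix c assume c: "c \<in> ?F \<rightarrow> carrier E"
    and c0: "\<And>l. l < m (Suc (Suc a)) \<Longrightarrow> cobdry E m D (Suc a) c l = \<zero>\<^bsub>E\<^esub>"
  have Drow: "D a i \<in> ?F \<rightarrow> carrier ?reg" if "i < m a" for i using that by (auto intro: entry_closed)
  \<comment> \<open>\<open>T p\<close> is the image of the vector \<open>p\<close> under the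
    differential, and \<open>G\<close> below is the graph of the map that \<open>c\<close> induces
    on this image.\<close>
  define T where "T p = (\<lambda>i\<in>{..<m a}. lincomb ?reg ?F p (D a i))" for p
  have TQ: "T p \<in> carrier Q" if "p \<in> ?F \<rightarrow> carrier R" for p
    using that Drow by (auto simp: T_def Q_def carrier_power intro!: reg.lincomb_closed[simplified])
  define G where "G = {(T p, lincomb E ?F p c) |p. p \<in> ?F \<rightarrow> carrier R}"
  have GI: "(T p, lincomb E ?F p c) \<in> G" if "p \<in> ?F \<rightarrow> carrier R" for p using that by (auto simp: G_def)
  have "\<exists>h\<in>mhom R Q E. \<forall>(x, y)\<in>G. h x = y"
  proof (rule extend_relation[OF inj Q.left_module_axioms])
    show "G \<subseteq> carrier Q \<times> carrier E" using TQ c by (auto simp: G_def intro: E.lincomb_closed)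
    show "G \<noteq> {}" using GI[of "\<lambda>_. \<zero>"] by auto
  next
    fix x y x' y' assume "(x, y) \<in> G" "(x', y') \<in> G"
    then obtain p p' where p: "p \<in> ?F \<rightarrow> carrier R" "x = T p" "y = lincomb E ?F p c"
      and p': "p' \<in> ?F \<rightarrow> carrier R" "x' = T p'" "y' = lincomb E ?F p' c" by (auto simp: G_def)
    have "T (\<lambda>j. p j \<oplus> p' j) = x \<oplus>\<^bsub>Q\<^esub> x'"
      unfolding T_def p(2) p'(2) Q_def add_power using p(1) p'(1) Drow
      by (intro restrict_ext) (simp add: reg.lincomb_add_left[simplified])
    moreover have "lincomb E ?F (\<lambda>j. p j \<oplus> p' j) c = y \<oplus>\<^bsub>E\<^esub> y'"
      unfolding p(3) p'(3) using p(1) p'(1) c by (rule E.lincomb_add_left)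
    ultimately show "(x \<oplus>\<^bsub>Q\<^esub> x', y \<oplus>\<^bsub>E\<^esub> y') \<in> G" using GI[of "\<lambda>j. p j \<oplus> p' j"] p(1) p'(1) by auto
  next
    fix r x y assume r: "r \<in> carrier R" and "(x, y) \<in> G"
    then obtain p where p: "p \<in> ?F \<rightarrow> carrier R" "x = T p" "y = lincomb E ?F p c" by (auto simp: G_def)
    have "T (\<lambda>j. r \<otimes> p j) = r \<odot>\<^bsub>Q\<^esub> x"
      unfolding T_def p(2) Q_def act_power using p(1) Drow r
      by (intro restrict_ext) (simp add: reg.act_lincomb[simplified, symmetric])
    moreover have "lincomb E ?F (\<lambda>j. r \<otimes> p j) c = r \<odot>\<^bsub>E\<^esub> y"
      unfolding p(3) using p(1) c r by (intro E.act_lincomb[symmetric]) auto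
    ultimately show "(r \<odot>\<^bsub>Q\<^esub> x, r \<odot>\<^bsub>E\<^esub> y) \<in> G" using GI[of "\<lambda>j. r \<otimes> p j"] p(1) r by auto
  next
    fix y assume "(\<zero>\<^bsub>Q\<^esub>, y) \<in> G"
    then obtain p where p: "p \<in> ?F \<rightarrow> carrier R" "\<zero>\<^bsub>Q\<^esub> = T p" "y = lincomb E ?F p c" by (auto simp: G_def)
    show "y = \<zero>\<^bsub>E\<^esub>"
    proof (rule ccontr)
      assume "y \<noteq> \<zero>\<^bsub>E\<^esub>"
      moreover have "y \<in> carrier E" unfolding p(3) using p(1) c by (rule E.lincomb_closed)
      ultimately obtain \<beta> where \<beta>: "\<beta> \<in> mhom R E M" "\<beta> y \<noteq> \<zero>\<^bsub>M\<^esub>"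
        using cog unfolding cogenerated_iff[OF left_module_axioms E] by auto
      have "\<beta> y = lincomb M ?F p (\<lambda>j. \<beta> (c j))"
        unfolding p(3) using p(1) c by (intro mhom_lincomb[OF E left_module_axioms \<beta>(1)]) auto
      also have "\<dots> = \<zero>\<^bsub>M\<^esub>"
      proof (rule weakly_exact[OF p(1)])
        show "(\<lambda>j. \<beta> (c j)) \<in> ?F \<rightarrow> carrier M" using c by (auto intro: mhom_closed[OF \<beta>(1)])
        show "(\<Oplus>j\<in>?F. p j \<otimes> D a i j) = \<zero>" if "i < m a" for i
          using fun_cong[OF p(2), of i] that by (simp add: T_def Q_def zero_power lincomb_regular)
        show "cobdry M m D (Suc a) (\<lambda>j. \<beta> (c j)) l = \<zero>\<^bsub>M\<^esub>" if l: "l < m (Suc (Suc a))" for l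
          using cobdry_mhom[OF E left_module_axioms \<beta>(1) c l] c0[OF l]
            mhom_zero[OF E left_module_axioms \<beta>(1)] by simp
      qed
      finally show False using \<beta>(2) by contradiction
    qed
  qed
  then obtain h where h: "h \<in> mhom R Q E" and "\<forall>(x, y)\<in>G. h x = y" by (rule bexE)
  then have hT: "h (T p) = lincomb E ?F p c" if "p \<in> ?F \<rightarrow> carrier R" for p using GI[OF that] by auto
  \<comment> \<open>The cochain bounding \<open>c\<close> consists of the values of the extension
    \<open>h\<close> at these unit vectors.\<close>
  define e where "e i = (\<lambda>i'\<in>{..<m a}. if i' = i then \<one> else \<zero>)" for i
  have e: "e \<in> {..<m a} \<rightarrow> carrier Q" by (auto simp: e_def Q_def carrier_power)
  have "c j = cobdry E m D a (\<lambda>i. h (e i)) j" if j: "j < m (Suc a)" for j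
  proof -
    have DR: "(\<lambda>i. D a i j) \<in> {..<m a} \<rightarrow> carrier R" using j by (auto intro: entry_closed)
    define p where "p = (\<lambda>j'. if j' = j then \<one> else \<zero>)"
    have p: "p \<in> ?F \<rightarrow> carrier R" by (auto simp: p_def)
    have "c j = lincomb E ?F p c" unfolding p_def using c j by (intro E.lincomb_unit_left[symmetric]) auto
    also have "\<dots> = h (T p)" using hT[OF p] by simp
    also have "T p = lincomb Q {..<m a} (\<lambda>i. D a i j) e"
    proof (rule PiE_ext)
      show "T p \<in> {..<m a} \<rightarrow>\<^sub>E carrier ?reg" using TQ[OF p] by (simp add: Q_def carrier_power)
      show "lincomb Q {..<m a} (\<lambda>i. D a i j) e \<in> {..<m a} \<rightarrow>\<^sub>E carrier ?reg"
        using Q.lincomb_closed[OF DR e] by (simp add: Q_def carrier_power)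
      fix i assume i: "i \<in> {..<m a}"
      have "T p i = D a i j"
        unfolding T_def p_def using reg.lincomb_unit_left[OF finite_lessThan _ Drow, of j i] i j by simp
      moreover have "lincomb Q {..<m a} (\<lambda>i. D a i j) e i = lincomb ?reg {..<m a} (\<lambda>i. D a i j) (\<lambda>i'. e i' i)"
        unfolding Q_def using i DR e by (intro lincomb_power[OF reg.left_module_axioms]) (auto simp: Q_def)
      moreover have "\<dots> = lincomb ?reg {..<m a} (\<lambda>i. D a i j) (\<lambda>i'. if i' = i then \<one> else \<zero>\<^bsub>?reg\<^esub>)"
        using i DR by (intro reg.lincomb_cong) (auto simp: e_def)
      moreover have "\<dots> = D a i j \<odot>\<^bsub>?reg\<^esub> \<one>"
        using i DR by (intro reg.lincomb_unit) auto
      ultimately show "T p i = lincomb Q {..<m a} (\<lambda>i. D a i j) e i" using DR i by (simp add: Pi_iff)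
    qed
    also have "h \<dots> = cobdry E m D a (\<lambda>i. h (e i)) j"
      unfolding cobdry_def using DR e by (intro mhom_lincomb[OF Q.left_module_axioms E h]) auto
    finally show ?thesis .
  qed
  moreover have "(\<lambda>i. h (e i)) \<in> {..<m a} \<rightarrow> carrier E" using e by (auto intro: mhom_closed[OF h])
  ultimately show "\<exists>c'. c' \<in> {..<m a} \<rightarrow> carrier E \<and> (\<forall>j<m (Suc a). c j = cobdry E m D a c' j)"
    by (intro exI[of _ "\<lambda>i. h (e i)"]) simp
qed

end

section \<open>Dimension shifting along an injective resolution\<close>

lemma a_kernel_eq: "a_kernel G H h = {x \<in> carrier G. h x = \<zero>\<^bsub>H\<^esub>}"
  by (simp add: a_kernel_def kernel_def)

lemma injective_resolutionD:
  assumes "injective_resolution R M I d e"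
  shows "left_module R M" "injective R (I n)" "left_module R (I n)" "e \<in> mhom R M (I 0)"
    "d n \<in> mhom R (I n) (I (Suc n))" "inj_on e (carrier M)"
    "e ` carrier M = {x \<in> carrier (I 0). d 0 x = \<zero>\<^bsub>I (Suc 0)\<^esub>}"
    "d n ` carrier (I n) = {x \<in> carrier (I (Suc n)). d (Suc n) x = \<zero>\<^bsub>I (Suc (Suc n))\<^esub>}"
  using assms unfolding injective_resolution_def a_kernel_eq by (auto simp: injective_left_module)

context weak_resolution
begin

text \<open>With \<open>?K b\<close> the \<open>b\<close>-th cosyzygy of \<open>M\<close>, vanishing
  in degree \<open>a + 1\<close> at \<open>b\<close> follows from degree \<open>a\<close> at
  \<open>b + 1\<close>. In degree 0 the claim holds in \<open>I b\<close> by
  \<open>exact_at_injective\<close> and passes to the subset \<open>?K b\<close>.\<close>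

lemma exact_at_of_cogenerated:
  assumes res: "injective_resolution R M I d e" and cog: "\<And>b. b < n \<Longrightarrow> cogenerated R M (I b)" and a: "a < n"
  shows "exact_at M m D (carrier M) a"
proof -
  note I = injective_resolutionD[OF res]
  let ?K = "\<lambda>b. {x \<in> carrier (I b). d b x = \<zero>\<^bsub>I (Suc b)\<^esub>}"
  have "a + b < n \<Longrightarrow> exact_at (I b) m D (?K b) a" for b
  proof (induction a arbitrary: b)
    case 0
    have "exact_at (I b) m D (carrier (I b)) 0"
      using 0 by (intro exact_at_injective I(2) cog) simp
    moreover have "(?K b) \<subseteq> carrier (I b)" by (rule Collect_restrict)
    ultimately show ?case by (rule exact_at_0_mono[where m = m, OF rank_0])
  next
    case (Suc a)
    have "exact_at (I (Suc b)) m D (d b ` carrier (I b)) a"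
      unfolding I(8) using Suc.prems by (intro Suc.IH) simp
    then show ?case
      using Suc.prems by (intro exact_at_kernel[OF I(3) I(3) I(5)] exact_at_injective I(2) cog) auto
  qed
  from this[of 0] show ?thesis
    using a exact_at_embedding[OF I(1) I(3) I(4) I(6)] unfolding I(7) by simp
qed

text \<open>The same shift run outwards from \<open>M\<close>, lowering the degree while
  \<open>b\<close> grows. It reaches a cosyzygy inside \<open>I n\<close> from cogeneration of the
  earlier terms, as the induction in \<open>cogenerated_transfer\<close> requires.\<close>

lemma exact_at_cosyzygy:
  assumes res: "injective_resolution R M I d e" and cog: "\<And>b. b < n \<Longrightarrow> cogenerated R M (I b)"
    and ex: "\<And>a. a \<le> n \<Longrightarrow> exact_at M m D (carrier M) a"
  shows "exact_at (I n) m D {x \<in> carrier (I n). d n x = \<zero>\<^bsub>I (Suc n)\<^esub>} 0"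
proof -
  note I = injective_resolutionD[OF res]
  let ?K = "\<lambda>b. {x \<in> carrier (I b). d b x = \<zero>\<^bsub>I (Suc b)\<^esub>}"
  have "a + b \<le> n \<Longrightarrow> exact_at (I b) m D (?K b) a" for a b
  proof (induction b arbitrary: a)
    case 0
    then show ?case using ex exact_at_embedding[OF I(1) I(3) I(4) I(6)] unfolding I(7) by simp
  next
    case (Suc b)
    then show ?case unfolding I(8)[symmetric]
      by (intro exact_at_image[OF I(3) I(3) I(5)] exact_at_injective I(2) cog) auto
  qed
  from this[of 0 n] show ?thesis by simp
qed

end

section \<open>Balanced pairs of module structures\<close>

text \<open>The two sides of a faithfully balanced bimodule, both written as left modules, so
  that interchanging them is a symmetry of the locale.\<close>

locale balanced_modules = M: left_module R M + N: left_module S N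
  for R :: "'r ring" and M :: "('r, 'u) module" and S :: "'s ring" and N :: "('s, 'u) module" +
  assumes carrier_N: "carrier N = carrier M"
    and zero_N: "\<zero>\<^bsub>N\<^esub> = \<zero>\<^bsub>M\<^esub>"
    and add_N: "ring.add N = ring.add M"
    and commute: "\<lbrakk>r \<in> carrier R; s \<in> carrier S; u \<in> carrier M\<rbrakk> \<Longrightarrow>
      r \<odot>\<^bsub>M\<^esub> (s \<odot>\<^bsub>N\<^esub> u) = s \<odot>\<^bsub>N\<^esub> (r \<odot>\<^bsub>M\<^esub> u)"
    and faithful_M: "\<lbrakk>r \<in> carrier R; \<And>u. u \<in> carrier M \<Longrightarrow> r \<odot>\<^bsub>M\<^esub> u = \<zero>\<^bsub>M\<^esub>\<rbrakk> \<Longrightarrow> r = \<zero>\<^bsub>R\<^esub>"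
    and faithful_N: "\<lbrakk>s \<in> carrier S; \<And>u. u \<in> carrier N \<Longrightarrow> s \<odot>\<^bsub>N\<^esub> u = \<zero>\<^bsub>N\<^esub>\<rbrakk> \<Longrightarrow> s = \<zero>\<^bsub>S\<^esub>"
    and end_M: "f \<in> mhom R M M \<Longrightarrow> \<exists>s\<in>carrier S. \<forall>u\<in>carrier M. f u = s \<odot>\<^bsub>N\<^esub> u"
    and end_N: "f \<in> mhom S N N \<Longrightarrow> \<exists>r\<in>carrier R. \<forall>u\<in>carrier N. f u = r \<odot>\<^bsub>M\<^esub> u"
    and art_M: "artinian_module R M"
    and art_N: "artinian_module S N"
begin

lemma swap: "balanced_modules S N R M"
proof (intro balanced_modules.intro balanced_modules_axioms.intro N.left_module_axioms M.left_module_axioms)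
  show "s \<odot>\<^bsub>N\<^esub> (r \<odot>\<^bsub>M\<^esub> u) = r \<odot>\<^bsub>M\<^esub> (s \<odot>\<^bsub>N\<^esub> u)"
    if "s \<in> carrier S" "r \<in> carrier R" "u \<in> carrier N" for s r u
    using that by (simp add: commute carrier_N)
qed (fact carrier_N[symmetric] zero_N[symmetric] add_N[symmetric] faithful_M faithful_N end_M end_N art_M art_N)+

lemma finsum_N: "finsum N = finsum M"
  by (intro ext) (simp add: finsum_def finprod_def carrier_N zero_N add_N)

lemma act_lincomb_commute:
  assumes "finite F" "r \<in> carrier R" "p \<in> F \<rightarrow> carrier S" "c \<in> F \<rightarrow> carrier M"
  shows "r \<odot>\<^bsub>M\<^esub> lincomb N F p c = lincomb N F p (\<lambda>i. r \<odot>\<^bsub>M\<^esub> c i)"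
proof -
  define f where "f = (\<lambda>u\<in>carrier N. r \<odot>\<^bsub>M\<^esub> u)"
  have f: "f \<in> mhom S N N" unfolding f_def
    using assms(2) by (intro restrict_mhom N.left_module_axioms)
      (simp_all add: carrier_N add_N M.act_closed M.act_r_distr commute)
  have "r \<odot>\<^bsub>M\<^esub> lincomb N F p c = f (lincomb N F p c)"
    using N.lincomb_closed[OF assms(3), of c] assms(4) by (simp add: f_def carrier_N)
  also have "\<dots> = lincomb N F p (\<lambda>i. f (c i))"
    using assms by (intro mhom_lincomb[OF N.left_module_axioms N.left_module_axioms f]) (simp_all add: carrier_N)
  also have "\<dots> = lincomb N F p (\<lambda>i. r \<odot>\<^bsub>M\<^esub> c i)"
    using assms by (intro N.lincomb_cong) (auto simp: f_def carrier_N Pi_iff M.act_closed)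
  finally show ?thesis .
qed

text \<open>Elements of \<open>S\<close> act by \<open>R\<close>-endomorphisms, so coboundaries over
  \<open>S\<close> are maps of \<open>R\<close>-modules. \<open>G\<close> may exceed the finite set
  \<open>F\<close>: in \<open>separate_from_envelope\<close> it is all of
  \<open>carrier J\<close>.\<close>

lemma lincomb_mhom:
  assumes "finite F" "F \<subseteq> G" "p \<in> F \<rightarrow> carrier S"
  shows "(\<lambda>c\<in>carrier (power_module G M). lincomb N F p c) \<in> mhom R (power_module G M) M"
proof (intro restrict_mhom left_module_power M.left_module_axioms)
  have at: "j \<in> G" if "j \<in> F" for j using that assms(2) by auto
  have C: "c \<in> F \<rightarrow> carrier N" if "c \<in> carrier (power_module G M)" for c
    using that at by (auto simp: carrier_power carrier_N)
  show "lincomb N F p c \<in> carrier M" if "c \<in> carrier (power_module G M)" for c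
    using N.lincomb_closed[OF assms(3) C[OF that]] by (simp add: carrier_N)
  show "lincomb N F p (c \<oplus>\<^bsub>power_module G M\<^esub> c') = lincomb N F p c \<oplus>\<^bsub>M\<^esub> lincomb N F p c'"
    if "c \<in> carrier (power_module G M)" "c' \<in> carrier (power_module G M)" for c c'
  proof -
    have "lincomb N F p (c \<oplus>\<^bsub>power_module G M\<^esub> c') = lincomb N F p (\<lambda>i. c i \<oplus>\<^bsub>N\<^esub> c' i)"
      using assms(3) C[OF that(1)] C[OF that(2)] at
      by (intro N.lincomb_cong) (auto simp: add_power add_N[symmetric] Pi_iff)
    then show ?thesis using N.lincomb_add[OF assms(3) C[OF that(1)] C[OF that(2)]] by (simp add: add_N)
  qed
  show "lincomb N F p (r \<odot>\<^bsub>power_module G M\<^esub> c) = r \<odot>\<^bsub>M\<^esub> lincomb N F p c"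
    if "r \<in> carrier R" "c \<in> carrier (power_module G M)" for r c
  proof -
    have "lincomb N F p (r \<odot>\<^bsub>power_module G M\<^esub> c) = lincomb N F p (\<lambda>i. r \<odot>\<^bsub>M\<^esub> c i)"
      using assms(3) C[OF that(2)] at that(1)
      by (intro N.lincomb_cong) (auto simp: act_power carrier_N Pi_iff M.act_closed)
    then show ?thesis using act_lincomb_commute[OF assms(1) that(1) assms(3)] C[OF that(2)] by (simp add: carrier_N)
  qed
qed

text \<open>Converse of \<open>lincomb_mhom\<close> on finite powers: restricted to one coordinate,
  an \<open>R\<close>-homomorphism is an endomorphism of \<open>M\<close>, hence given by an element
  of \<open>S\<close> through \<open>end_M\<close>.\<close>

lemma power_functional:
  assumes fin: "finite F" and f: "f \<in> mhom R (power_module F M) M"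
  shows "\<exists>s\<in>F \<rightarrow> carrier S. \<forall>c\<in>carrier (power_module F M). f c = lincomb N F s c"
proof -
  let ?P = "power_module F M"
  interpret P: left_module R ?P by (rule left_module_power) (rule M.left_module_axioms)
  define unit where "unit j u = (\<lambda>i\<in>F. if i = j then u else \<zero>\<^bsub>M\<^esub>)" for j u
  have unit: "(\<lambda>u\<in>carrier M. unit j u) \<in> mhom R M ?P" for j
    by (intro restrict_mhom M.left_module_axioms)
      (auto simp: unit_def power_simps M.act_zero_right intro!: restrict_ext)
  have unit_P: "unit j u \<in> carrier ?P" if "u \<in> carrier M" for j u using mhom_closed[OF unit that] that by simp
  have "\<exists>s. s \<in> carrier S \<and> (\<forall>u\<in>carrier M. f (unit j u) = s \<odot>\<^bsub>N\<^esub> u)" for j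
    using end_M[OF compose_mhom[OF M.left_module_axioms unit f, of j]] by (simp add: compose_def Bex_def)
  then obtain s where s: "\<And>j. s j \<in> carrier S" "\<And>j u. u \<in> carrier M \<Longrightarrow> f (unit j u) = s j \<odot>\<^bsub>N\<^esub> u" by metis
  show ?thesis
  proof (intro bexI ballI)
    show sF: "s \<in> F \<rightarrow> carrier S" using s(1) by auto
    fix c assume c: "c \<in> carrier ?P"
    have cF: "c \<in> F \<rightarrow> carrier M" using c by (auto simp: carrier_power)
    have one: "(\<lambda>_. \<one>\<^bsub>R\<^esub>) \<in> F \<rightarrow> carrier R" by auto
    have uF: "(\<lambda>j. unit j (c j)) \<in> F \<rightarrow> carrier ?P" using cF unit_P by auto
    have "c = lincomb ?P F (\<lambda>_. \<one>\<^bsub>R\<^esub>) (\<lambda>j. unit j (c j))"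
    proof (rule PiE_ext)
      show "c \<in> F \<rightarrow>\<^sub>E carrier M" using c by (simp add: carrier_power)
      show "lincomb ?P F (\<lambda>_. \<one>\<^bsub>R\<^esub>) (\<lambda>j. unit j (c j)) \<in> F \<rightarrow>\<^sub>E carrier M"
        using P.lincomb_closed[OF one uF] by (simp add: carrier_power)
      fix i assume i: "i \<in> F"
      have "lincomb ?P F (\<lambda>_. \<one>\<^bsub>R\<^esub>) (\<lambda>j. unit j (c j)) i = lincomb M F (\<lambda>_. \<one>\<^bsub>R\<^esub>) (\<lambda>j. unit j (c j) i)"
        by (rule lincomb_power[OF M.left_module_axioms fin one uF i])
      also have "\<dots> = lincomb M F (\<lambda>_. \<one>\<^bsub>R\<^esub>) (\<lambda>j. if j = i then c i else \<zero>\<^bsub>M\<^esub>)"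
        using i cF by (intro M.lincomb_cong) (auto simp: unit_def)
      also have "\<dots> = \<one>\<^bsub>R\<^esub> \<odot>\<^bsub>M\<^esub> c i" using cF i by (intro M.lincomb_unit[OF fin i one]) auto
      also have "\<dots> = c i" using cF i by (intro M.act_one) auto
      finally show "c i = lincomb ?P F (\<lambda>_. \<one>\<^bsub>R\<^esub>) (\<lambda>j. unit j (c j)) i" ..
    qed
    then have "f c = lincomb M F (\<lambda>_. \<one>\<^bsub>R\<^esub>) (\<lambda>j. f (unit j (c j)))"
      using mhom_lincomb[OF P.left_module_axioms M.left_module_axioms f fin one uF] by simp
    also have "\<dots> = lincomb N F s c" unfolding lincomb_def finsum_N
      using cF s N.act_closed
      by (intro M.M.finsum_cong') (auto simp: M.act_one carrier_N Pi_iff)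
    finally show "f c = lincomb N F s c" .
  qed
qed

text \<open>Common zeros of equations over \<open>S\<close> form an \<open>R\<close>-submodule of a
  finite power of the artinian module \<open>M\<close>, so finitely many equations of
  \<open>K\<close> cut out the zeros of all of them. The columns of \<open>C\<close> are the chosen
  ones.\<close>

lemma finite_annihilator:
  fixes k :: nat
  assumes K: "K \<subseteq> {..<k} \<rightarrow> carrier S"
  shows "\<exists>(q :: nat) C. (\<forall>l<q. (\<lambda>j. C j l) \<in> K) \<and> (\<forall>c\<in>{..<k} \<rightarrow> carrier M.
    (\<forall>l<q. lincomb N {..<k} (\<lambda>j. C j l) c = \<zero>\<^bsub>N\<^esub>) \<longrightarrow> (\<forall>p\<in>K. lincomb N {..<k} p c = \<zero>\<^bsub>N\<^esub>))"
proof -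
  let ?F = "{..<k}"
  let ?P = "power_module ?F M"
  interpret P: left_module R ?P by (rule left_module_power) (rule M.left_module_axioms)
  define ann where "ann A = {c \<in> carrier ?P. \<forall>p\<in>A. lincomb N ?F p c = \<zero>\<^bsub>N\<^esub>}" for A
  have "submodule (ann A) R ?P" if "A \<in> {A. finite A \<and> A \<subseteq> K}" for A
  proof -
    define f where "f p = (\<lambda>c\<in>carrier ?P. lincomb N ?F p c)" for p
    have f: "f p \<in> mhom R ?P M" if "p \<in> A" for p
      unfolding f_def using K that \<open>A \<in> _\<close> by (intro lincomb_mhom) auto
    have ann: "ann A = {c \<in> carrier ?P. \<forall>p\<in>A. f p c = \<zero>\<^bsub>M\<^esub>}" by (auto simp: ann_def f_def zero_N)
    show ?thesis unfolding ann P.is_submodule_iff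
      by (simp add: mhom_add[OF f] mhom_act[OF f] mhom_zero[OF P.left_module_axioms M.left_module_axioms f]
          P.act_closed M.act_zero_right subset_iff)
  qed
  then have "\<exists>A\<in>{A. finite A \<and> A \<subseteq> K}. \<forall>A'\<in>{A. finite A \<and> A \<subseteq> K}. ann A' \<subseteq> ann A \<longrightarrow> ann A' = ann A"
    by (intro artinian_module_minimal[OF artinian_power[OF M.left_module_axioms art_M], of ?F "{}"]) auto
  then obtain A where "A \<in> {A. finite A \<and> A \<subseteq> K}"
    and min: "\<forall>A'\<in>{A. finite A \<and> A \<subseteq> K}. ann A' \<subseteq> ann A \<longrightarrow> ann A' = ann A" by (rule bexE)
  then have A: "finite A" "A \<subseteq> K" by simp_all
  obtain ps where ps: "set ps = A" using finite_list[OF A(1)] by (rule exE)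
  show ?thesis
  proof (intro exI conjI allI ballI impI)
    fix l assume "l < length ps"
    then show "(\<lambda>j. (ps ! l) j) \<in> K" using ps A(2) by (auto dest: nth_mem)
  next
    fix c p assume c: "c \<in> ?F \<rightarrow> carrier M"
      and c0: "\<forall>l<length ps. lincomb N ?F (\<lambda>j. (ps ! l) j) c = \<zero>\<^bsub>N\<^esub>" and p: "p \<in> K"
    define c' where "c' = restrict c ?F"
    have c': "c' \<in> carrier ?P" using c by (auto simp: c'_def carrier_power)
    have eq: "lincomb N ?F q c' = lincomb N ?F q c" if "q \<in> K" for q
      using that K c by (intro N.lincomb_cong) (auto simp: c'_def carrier_N)
    have "lincomb N ?F q c' = \<zero>\<^bsub>N\<^esub>" if q: "q \<in> A" for q
    proof -
      have "\<exists>l<length ps. ps ! l = q" using q unfolding ps[symmetric] in_set_conv_nth .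
      then obtain l where l: "l < length ps" "ps ! l = q" by (elim exE conjE)
      have "lincomb N ?F q c = \<zero>\<^bsub>N\<^esub>" using c0[rule_format, OF l(1)] unfolding l(2) .
      then show ?thesis using eq[of q] q A(2) by auto
    qed
    then have "c' \<in> ann A" using c' by (simp add: ann_def)
    moreover have "ann (insert p A) \<subseteq> ann A" by (auto simp: ann_def)
    then have "ann (insert p A) = ann A" using min A p by simp
    ultimately have "c' \<in> ann (insert p A)" by simp
    then show "lincomb N ?F p c = \<zero>\<^bsub>N\<^esub>" using eq[OF p] by (simp add: ann_def)
  qed
qed

text \<open>Resolves \<open>S\<close> modulo the left ideal generated by \<open>L\<close>; the
  hypothesis on annihilators says that this cyclic module is torsion. The first matrix is a row of
  elements of \<open>L\<close>, and each later one consists of finitely many syzygies of its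
  predecessor with the same zeros in \<open>N\<close> as all syzygies, by
  \<open>finite_annihilator\<close>.\<close>

lemma ex_weak_resolution:
  assumes L: "L \<subseteq> carrier S"
    and ann: "\<And>y. y \<in> carrier N \<Longrightarrow> (\<And>r. r \<in> L \<Longrightarrow> r \<odot>\<^bsub>N\<^esub> y = \<zero>\<^bsub>N\<^esub>) \<Longrightarrow> y = \<zero>\<^bsub>N\<^esub>"
  shows "\<exists>m D. weak_resolution S N m D \<and> m (Suc 0) = Suc 0 \<and> (\<forall>j<m (Suc (Suc 0)). D (Suc 0) 0 j \<in> L)"
proof -
  define zeros where "zeros k q C c \<longleftrightarrow> c \<in> {..<k} \<rightarrow> carrier M \<and>
      (\<forall>l<q. lincomb N {..<k} (\<lambda>j. C j l) c = \<zero>\<^bsub>N\<^esub>)" for k q :: nat and C :: "nat \<Rightarrow> nat \<Rightarrow> 's" and c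
  define ker where "ker k q C = {p \<in> {..<q} \<rightarrow> carrier S. \<forall>i<k. (\<Oplus>\<^bsub>S\<^esub>j\<in>{..<q}. p j \<otimes>\<^bsub>S\<^esub> C i j) = \<zero>\<^bsub>S\<^esub>}"
    for k q :: nat and C :: "nat \<Rightarrow> nat \<Rightarrow> 's"
  have ex: "\<exists>q C. (\<forall>l<q. (\<lambda>j. C j l) \<in> K) \<and> (\<forall>c p. zeros k q C c \<longrightarrow> p \<in> K \<longrightarrow> lincomb N {..<k} p c = \<zero>\<^bsub>N\<^esub>)"
    if K: "K \<subseteq> {..<k} \<rightarrow> carrier S" for k K
    using finite_annihilator[OF K] unfolding zeros_def by metis
  \<comment> \<open>\<open>L\<close> as a set of tuples of length one: only the entry at 0
    matters.\<close>
  define L' where "L' = {p :: nat \<Rightarrow> 's. p 0 \<in> L}"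
  define ok where "ok n = (\<lambda>(k, C, q). (\<forall>l<q. (\<lambda>j. C j l) \<in> {..<k} \<rightarrow> carrier S) \<and>
      (n = 0 \<longrightarrow> k = Suc 0 \<and> (\<forall>l<q. C 0 l \<in> L) \<and>
        (\<forall>c p. zeros k q C c \<longrightarrow> p \<in> L' \<longrightarrow> lincomb N {..<k} p c = \<zero>\<^bsub>N\<^esub>)))" for n :: nat
  define next_step where "next_step = (\<lambda>(k, C, q) (k', C', q'). k' = q \<and> (\<forall>l<q'. (\<lambda>j. C' j l) \<in> ker k q C) \<and>
        (\<forall>c p. zeros q q' C' c \<longrightarrow> p \<in> ker k q C \<longrightarrow> lincomb N {..<q} p c = \<zero>\<^bsub>N\<^esub>))"
  have "\<exists>f. \<forall>n. ok n (f n) \<and> next_step (f n) (f (Suc n))"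
  proof (rule dependent_nat_choice)
    have "L' \<subseteq> {..<Suc 0} \<rightarrow> carrier S" using L by (auto simp: L'_def)
    then obtain q C where qC: "\<forall>l<q. (\<lambda>j. C j l) \<in> L'"
      "\<forall>c p. zeros (Suc 0) q C c \<longrightarrow> p \<in> L' \<longrightarrow> lincomb N {..<Suc 0} p c = \<zero>\<^bsub>N\<^esub>" using ex by blast
    have "\<forall>l<q. C 0 l \<in> L" using qC(1) by (simp add: L'_def)
    moreover have "\<forall>l<q. (\<lambda>j. C j l) \<in> {..<Suc 0} \<rightarrow> carrier S"
      using calculation L by auto
    ultimately show "\<exists>x. ok 0 x"
      using qC(2) by (intro exI[of _ "(Suc 0, C, q)"]) (simp add: ok_def)
  next
    fix x :: "nat \<times> (nat \<Rightarrow> nat \<Rightarrow> 's) \<times> nat" and n :: nat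
    obtain k C q where x: "x = (k, C, q)" by (cases x)
    have ker: "ker k q C \<subseteq> {..<q} \<rightarrow> carrier S" by (auto simp: ker_def)
    then obtain q' C' where qC: "\<forall>l<q'. (\<lambda>j. C' j l) \<in> ker k q C"
      "\<forall>c p. zeros q q' C' c \<longrightarrow> p \<in> ker k q C \<longrightarrow> lincomb N {..<q} p c = \<zero>\<^bsub>N\<^esub>" using ex by blast
    have "\<forall>l<q'. (\<lambda>j. C' j l) \<in> {..<q} \<rightarrow> carrier S" using qC(1) ker by blast
    then show "\<exists>y. ok (Suc n) y \<and> next_step x y"
      using qC by (intro exI[of _ "(q, C', q')"]) (simp add: x ok_def next_step_def)
  qed
  then obtain f where "\<forall>n. ok n (f n) \<and> next_step (f n) (f (Suc n))" by (rule exE)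
  note f = this[unfolded ok_def next_step_def]
  \<comment> \<open>Stage \<open>f n\<close> becomes the matrix \<open>D (Suc n)\<close>. The shift
    makes room for rank zero at index 0, where \<open>D 0\<close> has no entries and its zeros are
    dummies.\<close>
  define m where "m a = (case a of 0 \<Rightarrow> 0 | Suc n \<Rightarrow> fst (f n))" for a
  define D where "D a = (case a of 0 \<Rightarrow> (\<lambda>_ _. \<zero>\<^bsub>S\<^esub>) | Suc n \<Rightarrow> fst (snd (f n)))" for a
  have f_eq: "f n = (m (Suc n), D (Suc n), m (Suc (Suc n)))" for n
    using f[rule_format, of n] by (simp add: m_def D_def split: prod.splits)
  have closed: "(\<lambda>j. D (Suc n) j l) \<in> {..<m (Suc n)} \<rightarrow> carrier S" if "l < m (Suc (Suc n))" for n l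
    using f[rule_format, of n] that by (simp add: f_eq)
  have start: "m (Suc 0) = Suc 0" "\<And>l. l < m (Suc (Suc 0)) \<Longrightarrow> D (Suc 0) 0 l \<in> L"
    using f[rule_format, of 0] by (simp_all add: f_eq)
  have start_exact: "\<forall>c p. zeros (m (Suc 0)) (m (Suc (Suc 0))) (D (Suc 0)) c \<longrightarrow> p \<in> L' \<longrightarrow>
      lincomb N {..<m (Suc 0)} p c = \<zero>\<^bsub>N\<^esub>"
    using f[rule_format, of 0] by (simp only: f_eq prod.case simp_thms start(1)) (elim conjE)
  have step: "\<And>l. l < m (Suc (Suc (Suc n))) \<Longrightarrow> (\<lambda>j. D (Suc (Suc n)) j l) \<in> ker (m (Suc n)) (m (Suc (Suc n))) (D (Suc n))"
    "\<And>c p. zeros (m (Suc (Suc n))) (m (Suc (Suc (Suc n)))) (D (Suc (Suc n))) c \<Longrightarrow>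
      p \<in> ker (m (Suc n)) (m (Suc (Suc n))) (D (Suc n)) \<Longrightarrow> lincomb N {..<m (Suc (Suc n))} p c = \<zero>\<^bsub>N\<^esub>" for n
    using f[rule_format, of n] by (simp_all add: f_eq)
  have m0: "m 0 = 0" by (simp add: m_def)
  have "weak_resolution S N m D"
  proof (intro weak_resolution.intro matrix_complex.intro matrix_complex_axioms.intro
      weak_resolution_axioms.intro N.left_module_axioms N.R.ring_axioms m0)
    show "D a i j \<in> carrier S" if "i < m a" "j < m (Suc a)" for a i j
      using that closed by (cases a) (auto simp: m0)
    show "(\<Oplus>\<^bsub>S\<^esub>j\<in>{..<m (Suc a)}. D (Suc a) j l \<otimes>\<^bsub>S\<^esub> D a i j) = \<zero>\<^bsub>S\<^esub>"
      if "i < m a" "l < m (Suc (Suc a))" for a i l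
    proof (cases a)
      case (Suc n)
      then show ?thesis using step(1)[of l n] that by (simp add: ker_def)
    qed (use that m0 in simp)
  next
    fix p a c
    assume p: "p \<in> {..<m (Suc a)} \<rightarrow> carrier S"
      and pker: "\<And>i. i < m a \<Longrightarrow> (\<Oplus>\<^bsub>S\<^esub>j\<in>{..<m (Suc a)}. p j \<otimes>\<^bsub>S\<^esub> D a i j) = \<zero>\<^bsub>S\<^esub>"
      and c: "c \<in> {..<m (Suc a)} \<rightarrow> carrier N"
      and c0: "\<And>l. l < m (Suc (Suc a)) \<Longrightarrow> cobdry N m D (Suc a) c l = \<zero>\<^bsub>N\<^esub>"
    have z: "zeros (m (Suc a)) (m (Suc (Suc a))) (D (Suc a)) c"
      using c c0 by (simp add: zeros_def cobdry_def carrier_N)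
    show "lincomb N {..<m (Suc a)} p c = \<zero>\<^bsub>N\<^esub>"
    proof (cases a)
      case 0
      \<comment> \<open>In degree 0 the row \<open>p\<close> is arbitrary, its syzygy condition
        being vacuous for \<open>m 0 = 0\<close>. So the cocycle itself has to vanish, which is
        where \<open>ann\<close> enters.\<close>
      have c_0: "c 0 \<in> carrier N" using c by (auto simp: 0 start(1))
      have sing: "lincomb N {..<m (Suc 0)} q c = q 0 \<odot>\<^bsub>N\<^esub> c 0" if "q 0 \<in> carrier S" for q
        using that c_0 by (simp add: start(1) lessThan_Suc lincomb_def N.M.finsum_insert N.M.finsum_empty N.act_closed)
      have "c 0 = \<zero>\<^bsub>N\<^esub>"
      proof (rule ann[OF c_0])
        fix r assume r: "r \<in> L"
        then have "lincomb N {..<m (Suc 0)} (\<lambda>_. r) c = \<zero>\<^bsub>N\<^esub>"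
          using z by (intro start_exact[rule_format]) (simp_all add: 0 L'_def)
        then show "r \<odot>\<^bsub>N\<^esub> c 0 = \<zero>\<^bsub>N\<^esub>" using sing[of "\<lambda>_. r"] r L by auto
      qed
      moreover have "p 0 \<in> carrier S" using p by (auto simp: 0 start(1))
      ultimately show ?thesis using sing[of p] by (simp add: 0 N.act_zero_right)
    next
      case (Suc n)
      then show ?thesis using step(2)[of n c p] z p pker by (simp add: ker_def)
    qed
  qed
  then show ?thesis using start(1,2) by (intro exI[of _ m] exI[of _ D]) simp
qed

end

section \<open>Transfer between the two sides\<close>

context balanced_modules
begin

text \<open>If \<open>y\<close> were nonzero, then \<open>r h + b \<mapsto> r y\<close> would extend, via the injective module \<open>E\<close>, to a linear
  form \<open>s\<close> over \<open>S\<close> killing the coboundaries but not \<open>h\<close>, against weak exactness.\<close>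

lemma cohomology_torsion:
  assumes inj: "injective R E" and e: "e \<in> mhom R M E" "inj_on e (carrier M)" and cog: "cogenerated R M E"
    and res: "weak_resolution S N m D"
    and h: "h \<in> carrier (power_module {..<m (Suc a)} M)"
      "\<And>l. l < m (Suc (Suc a)) \<Longrightarrow> cobdry N m D (Suc a) h l = \<zero>\<^bsub>N\<^esub>"
    and B: "submodule B R (power_module {..<m (Suc a)} M)"
      "\<And>c. c \<in> {..<m a} \<rightarrow> carrier M \<Longrightarrow> (\<lambda>l\<in>{..<m (Suc a)}. cobdry N m D a c l) \<in> B"
    and y: "y \<in> carrier M"
      "\<And>r. r \<in> carrier R \<Longrightarrow> r \<odot>\<^bsub>power_module {..<m (Suc a)} M\<^esub> h \<in> B \<Longrightarrow> r \<odot>\<^bsub>M\<^esub> y = \<zero>\<^bsub>M\<^esub>"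
  shows "y = \<zero>\<^bsub>M\<^esub>"
proof (rule ccontr)
  assume y0: "y \<noteq> \<zero>\<^bsub>M\<^esub>"
  let ?F = "{..<m (Suc a)}"
  define Q where "Q = power_module ?F M"
  have E: "left_module R E" using inj by (rule injective_left_module)
  interpret E: left_module R E by (rule E)
  interpret Q: left_module R Q unfolding Q_def by (rule left_module_power) (rule M.left_module_axioms)
  interpret W: weak_resolution S N m D by (rule res)
  note M = M.left_module_axioms
  have hQ: "h \<in> carrier Q" using h(1) by (simp add: Q_def)
  have BQ: "b \<in> carrier Q" and Badd: "b' \<in> B \<Longrightarrow> b \<oplus>\<^bsub>Q\<^esub> b' \<in> B"
    and Bact: "r \<in> carrier R \<Longrightarrow> r \<odot>\<^bsub>Q\<^esub> b \<in> B" if "b \<in> B" for b b' r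
    using B(1) that unfolding Q_def[symmetric] Q.is_submodule_iff by auto
  have B0: "\<zero>\<^bsub>Q\<^esub> \<in> B" using B(1) by (simp add: Q_def[symmetric] Q.is_submodule_iff)
  have e0: "e \<zero>\<^bsub>M\<^esub> = \<zero>\<^bsub>E\<^esub>" by (rule mhom_zero[OF M E e(1)])
  define G where "G = {((r \<odot>\<^bsub>Q\<^esub> h) \<oplus>\<^bsub>Q\<^esub> b, e (r \<odot>\<^bsub>M\<^esub> y)) |r b. r \<in> carrier R \<and> b \<in> B}"
  have GI: "((r \<odot>\<^bsub>Q\<^esub> h) \<oplus>\<^bsub>Q\<^esub> b, e (r \<odot>\<^bsub>M\<^esub> y)) \<in> G" if "r \<in> carrier R" "b \<in> B" for r b
    using that by (auto simp: G_def)
  have "\<exists>g\<in>mhom R Q E. \<forall>(x, z)\<in>G. g x = z"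
  proof (rule extend_relation[OF inj Q.left_module_axioms])
    show "G \<subseteq> carrier Q \<times> carrier E"
      using hQ BQ y(1) by (auto simp: G_def Q.act_closed M.act_closed intro!: mhom_closed[OF e(1)])
    show "G \<noteq> {}" using GI[OF M.R.zero_closed B0] by auto
  next
    fix x z x' z' assume "(x, z) \<in> G" "(x', z') \<in> G"
    then obtain r b r' b' where 1: "r \<in> carrier R" "b \<in> B" "x = (r \<odot>\<^bsub>Q\<^esub> h) \<oplus>\<^bsub>Q\<^esub> b" "z = e (r \<odot>\<^bsub>M\<^esub> y)"
      and 2: "r' \<in> carrier R" "b' \<in> B" "x' = (r' \<odot>\<^bsub>Q\<^esub> h) \<oplus>\<^bsub>Q\<^esub> b'" "z' = e (r' \<odot>\<^bsub>M\<^esub> y)" by (auto simp: G_def)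
    have "x \<oplus>\<^bsub>Q\<^esub> x' = ((r \<oplus>\<^bsub>R\<^esub> r') \<odot>\<^bsub>Q\<^esub> h) \<oplus>\<^bsub>Q\<^esub> (b \<oplus>\<^bsub>Q\<^esub> b')"
      using 1 2 hQ BQ by (simp add: Q.act_l_distr Q.act_closed Q.M.a_ac)
    moreover have "z \<oplus>\<^bsub>E\<^esub> z' = e ((r \<oplus>\<^bsub>R\<^esub> r') \<odot>\<^bsub>M\<^esub> y)"
      using 1 2 y(1) by (simp add: M.act_l_distr M.act_closed mhom_add[OF e(1)])
    ultimately show "(x \<oplus>\<^bsub>Q\<^esub> x', z \<oplus>\<^bsub>E\<^esub> z') \<in> G"
      using GI[of "r \<oplus>\<^bsub>R\<^esub> r'" "b \<oplus>\<^bsub>Q\<^esub> b'"] 1 2 by (simp add: Badd)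
  next
    fix t x z assume t: "t \<in> carrier R" and "(x, z) \<in> G"
    then obtain r b where 1: "r \<in> carrier R" "b \<in> B" "x = (r \<odot>\<^bsub>Q\<^esub> h) \<oplus>\<^bsub>Q\<^esub> b" "z = e (r \<odot>\<^bsub>M\<^esub> y)"
      by (auto simp: G_def)
    have "t \<odot>\<^bsub>Q\<^esub> x = ((t \<otimes>\<^bsub>R\<^esub> r) \<odot>\<^bsub>Q\<^esub> h) \<oplus>\<^bsub>Q\<^esub> (t \<odot>\<^bsub>Q\<^esub> b)"
      using 1 t hQ BQ by (simp add: Q.act_r_distr Q.act_closed Q.act_assoc)
    moreover have "t \<odot>\<^bsub>E\<^esub> z = e ((t \<otimes>\<^bsub>R\<^esub> r) \<odot>\<^bsub>M\<^esub> y)"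
      using 1 t y(1) by (simp add: M.act_assoc M.act_closed mhom_act[OF e(1)])
    ultimately show "(t \<odot>\<^bsub>Q\<^esub> x, t \<odot>\<^bsub>E\<^esub> z) \<in> G"
      using GI[of "t \<otimes>\<^bsub>R\<^esub> r" "t \<odot>\<^bsub>Q\<^esub> b"] 1 t by (simp add: Bact)
  next
    fix z assume "(\<zero>\<^bsub>Q\<^esub>, z) \<in> G"
    then obtain r b where 1: "r \<in> carrier R" "b \<in> B" "\<zero>\<^bsub>Q\<^esub> = (r \<odot>\<^bsub>Q\<^esub> h) \<oplus>\<^bsub>Q\<^esub> b" "z = e (r \<odot>\<^bsub>M\<^esub> y)"
      by (auto simp: G_def)
    have "r \<odot>\<^bsub>Q\<^esub> h = \<ominus>\<^bsub>Q\<^esub> b"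
      using Q.M.minus_equality[of "r \<odot>\<^bsub>Q\<^esub> h" b] 1 hQ BQ by (simp add: Q.act_closed)
    moreover have "\<ominus>\<^bsub>Q\<^esub> b \<in> B" using B(1) 1(2) unfolding Q_def[symmetric] by (rule Q.minus_mem_submodule)
    ultimately have "r \<odot>\<^bsub>M\<^esub> y = \<zero>\<^bsub>M\<^esub>" using y(2)[OF 1(1)] by (simp add: Q_def)
    then show "z = \<zero>\<^bsub>E\<^esub>" using 1(4) e0 by simp
  qed
  then obtain g where g: "g \<in> mhom R Q E" and gG: "\<forall>(x, z)\<in>G. g x = z" by (rule bexE)
  have gh: "g h = e y"
    using bspec[OF gG GI[OF M.R.one_closed B0]] hQ y(1) by (simp add: Q.act_one M.act_one)
  have gB: "g b = \<zero>\<^bsub>E\<^esub>" if "b \<in> B" for b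
    using bspec[OF gG GI[OF M.R.zero_closed that]] hQ BQ[OF that] y(1)
    by (simp add: Q.act_zero_left M.act_zero_left e0)
  have "e y \<noteq> \<zero>\<^bsub>E\<^esub>" using inj_onD[OF e(2), of y "\<zero>\<^bsub>M\<^esub>"] y(1) y0 e0 by auto
  then obtain p where p: "p \<in> mhom R E M" "p (e y) \<noteq> \<zero>\<^bsub>M\<^esub>"
    using cog mhom_closed[OF e(1) y(1)] unfolding cogenerated_iff[OF M E] by auto
  have pg: "compose (carrier Q) p g \<in> mhom R Q M" by (rule compose_mhom[OF Q.left_module_axioms g p(1)])
  obtain s where s: "s \<in> ?F \<rightarrow> carrier S"
    and pgs: "\<forall>c\<in>carrier Q. compose (carrier Q) p g c = lincomb N ?F s c"
    using power_functional[OF finite_lessThan pg[unfolded Q_def]] unfolding Q_def by (rule bexE)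
  have pgs': "p (g c) = lincomb N ?F s c" if "c \<in> carrier Q" for c
    using bspec[OF pgs that] that by (simp add: compose_def)
  have "lincomb N ?F s h = \<zero>\<^bsub>N\<^esub>"
  proof (rule W.weakly_exact[OF s])
    show "h \<in> ?F \<rightarrow> carrier N" using h(1) by (auto simp: carrier_power carrier_N)
    show "cobdry N m D (Suc a) h l = \<zero>\<^bsub>N\<^esub>" if "l < m (Suc (Suc a))" for l using h(2)[OF that] .
    fix i assume i: "i < m a"
    \<comment> \<open>The row of \<open>s\<close> composed with the coboundary. It acts as zero on
      \<open>N\<close> because \<open>p\<close> composed with \<open>g\<close> kills
      \<open>B\<close>, as tuples with one nonzero entry show; faithfulness then gives the
      coefficient identity that \<open>weakly_exact\<close> asks for.\<close>
    define k where "k i' = (\<Oplus>\<^bsub>S\<^esub>j\<in>?F. s j \<otimes>\<^bsub>S\<^esub> D a i' j)" for i'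
    have k: "k \<in> {..<m a} \<rightarrow> carrier S"
      unfolding k_def using s by (auto intro!: N.R.finsum_closed N.R.m_closed W.entry_closed)
    have "k i = \<zero>\<^bsub>S\<^esub>"
    proof (rule faithful_N)
      show "k i \<in> carrier S" using k i by auto
      fix u assume u: "u \<in> carrier N"
      define c where "c = (\<lambda>i'. if i' = i then u else \<zero>\<^bsub>N\<^esub>)"
      have c: "c \<in> {..<m a} \<rightarrow> carrier N" using u by (auto simp: c_def)
      have cM: "c \<in> {..<m a} \<rightarrow> carrier M" using c by (simp add: carrier_N)
      let ?b = "\<lambda>l\<in>?F. cobdry N m D a c l"
      have "k i \<odot>\<^bsub>N\<^esub> u = lincomb N {..<m a} k c"
        unfolding c_def using k u i by (intro N.lincomb_unit[symmetric]) auto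
      also have "\<dots> = lincomb N ?F s (\<lambda>l. cobdry N m D a c l)"
        unfolding cobdry_def k_def using s c by (intro N.lincomb_lincomb[symmetric]) (auto intro: W.entry_closed)
      also have "\<dots> = lincomb N ?F s ?b"
        using s W.cobdry_closed[OF N.left_module_axioms c] by (intro N.lincomb_cong) auto
      also have "\<dots> = p (g ?b)" using pgs'[OF BQ[OF B(2)[OF cM]]] by simp
      also have "\<dots> = \<zero>\<^bsub>N\<^esub>"
        using gB[OF B(2)[OF cM]] mhom_zero[OF E M p(1)] by (simp add: zero_N)
      finally show "k i \<odot>\<^bsub>N\<^esub> u = \<zero>\<^bsub>N\<^esub>" .
    qed
    then show "(\<Oplus>\<^bsub>S\<^esub>j\<in>?F. s j \<otimes>\<^bsub>S\<^esub> D a i j) = \<zero>\<^bsub>S\<^esub>" by (simp add: k_def)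
  qed
  then show False using pgs'[OF hQ] gh p(2) by (simp add: zero_N)
qed

text \<open>By induction the dual complex is exact below \<open>a\<close>, so its terms resolve the
  image \<open>B\<close> of \<open>\<delta> a\<close>. The class of a cocycle \<open>h\<close>
  modulo \<open>B\<close> generates a torsion module T by \<open>cohomology_torsion\<close>.
  Shifting along the resolution gives Ext^1(T, B) = 0, so the embedding of T into the quotient by
  \<open>B\<close> lifts to the power \<open>Q (Suc a)\<close>; but Hom from T to that power is
  zero, whence \<open>h\<close> lies in \<open>B\<close>.\<close>

lemma exact_at_transfer:
  assumes res: "injective_resolution R M I d e" and cog: "\<And>b. b < n \<Longrightarrow> cogenerated R M (I b)"
    and wres: "weak_resolution S N m D" and "a < n"
  shows "exact_at N m D (carrier N) a"
  using \<open>a < n\<close>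
proof (induction a rule: less_induct)
  case (less a)
  note M = M.left_module_axioms and N = N.left_module_axioms
  interpret W: weak_resolution S N m D by (rule wres)
  note inj = injective_resolutionD[OF res]
  define Q where "Q j = power_module {..<m j} M" for j
  define \<delta> where "\<delta> j = (\<lambda>c\<in>carrier (Q j). \<lambda>l\<in>{..<m (Suc j)}. cobdry N m D j c l)" for j
  have Q: "left_module R (Q j)" for j unfolding Q_def by (rule left_module_power) (rule M)
  have QN: "c \<in> {..<m j} \<rightarrow> carrier N" if "c \<in> carrier (Q j)" for c j
    using that by (auto simp: Q_def carrier_power carrier_N)
  have \<delta>: "\<delta> j \<in> mhom R (Q j) (Q (Suc j))" for j
  proof -
    have form: "(\<lambda>c\<in>carrier (Q j). cobdry N m D j c l) \<in> mhom R (Q j) M" if "l < m (Suc j)" for l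
      unfolding cobdry_def Q_def using that by (intro lincomb_mhom) (auto intro: W.entry_closed)
    interpret Qj: left_module R "Q j" by (rule Q)
    show ?thesis unfolding \<delta>_def
    proof (intro restrict_mhom Q)
      show "(\<lambda>l\<in>{..<m (Suc j)}. cobdry N m D j c l) \<in> carrier (Q (Suc j))" if "c \<in> carrier (Q j)" for c
        using mhom_closed[OF form that] that by (auto simp: Q_def carrier_power)
      show "(\<lambda>l\<in>{..<m (Suc j)}. cobdry N m D j (c \<oplus>\<^bsub>Q j\<^esub> c') l) =
          (\<lambda>l\<in>{..<m (Suc j)}. cobdry N m D j c l) \<oplus>\<^bsub>Q (Suc j)\<^esub> (\<lambda>l\<in>{..<m (Suc j)}. cobdry N m D j c' l)"
        if "c \<in> carrier (Q j)" "c' \<in> carrier (Q j)" for c c'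
        unfolding Q_def[of "Suc j"] add_power using mhom_add[OF form that] that
        by (intro restrict_ext) simp
      show "(\<lambda>l\<in>{..<m (Suc j)}. cobdry N m D j (r \<odot>\<^bsub>Q j\<^esub> c) l) =
          r \<odot>\<^bsub>Q (Suc j)\<^esub> (\<lambda>l\<in>{..<m (Suc j)}. cobdry N m D j c l)"
        if "r \<in> carrier R" "c \<in> carrier (Q j)" for r c
        unfolding Q_def[of "Suc j"] act_power using mhom_act[OF form that] that Qj.act_closed[OF that]
        by (intro restrict_ext) simp
    qed
  qed
  have ker_\<delta>: "{x \<in> carrier (Q (Suc j)). \<delta> (Suc j) x = \<zero>\<^bsub>Q (Suc (Suc j))\<^esub>} = \<delta> j ` carrier (Q j)" if "j < a" for j
  proof (intro equalityI subsetI)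
    fix x assume "x \<in> {x \<in> carrier (Q (Suc j)). \<delta> (Suc j) x = \<zero>\<^bsub>Q (Suc (Suc j))\<^esub>}"
    then have x: "x \<in> carrier (Q (Suc j))" "\<delta> (Suc j) x = \<zero>\<^bsub>Q (Suc (Suc j))\<^esub>" by simp_all
    have "cobdry N m D (Suc j) x l = \<zero>\<^bsub>N\<^esub>" if "l < m (Suc (Suc j))" for l
      using fun_cong[OF x(2), of l] x(1) that by (simp add: \<delta>_def Q_def[of "Suc (Suc j)"] zero_power zero_N)
    moreover have "exact_at N m D (carrier N) j" using less.IH[OF that] that less.prems by simp
    ultimately obtain c where c: "c \<in> {..<m j} \<rightarrow> carrier N" "\<And>l. l < m (Suc j) \<Longrightarrow> x l = cobdry N m D j c l"
      using QN[OF x(1)] by (elim exact_atD) blast+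
    define c' where "c' = restrict c {..<m j}"
    have c': "c' \<in> carrier (Q j)" using c(1) by (auto simp: c'_def Q_def carrier_power carrier_N)
    have "x = \<delta> j c'"
    proof (rule PiE_ext)
      show "x \<in> {..<m (Suc j)} \<rightarrow>\<^sub>E carrier M" using x(1) by (simp add: Q_def carrier_power)
      show "\<delta> j c' \<in> {..<m (Suc j)} \<rightarrow>\<^sub>E carrier M"
        using mhom_closed[OF \<delta> c'] by (simp add: Q_def carrier_power)
      fix l assume l: "l \<in> {..<m (Suc j)}"
      have "cobdry N m D j c' l = cobdry N m D j c l"
        using c(1) l by (intro W.cobdry_cong N) (auto simp: c'_def)
      then show "x l = \<delta> j c' l" using c(2)[of l] l c' by (simp add: \<delta>_def)
    qed
    then show "x \<in> \<delta> j ` carrier (Q j)" using c' by (rule image_eqI)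
  next
    fix x assume "x \<in> \<delta> j ` carrier (Q j)"
    then obtain c where c: "c \<in> carrier (Q j)" "x = \<delta> j c" by auto
    have xQ: "x \<in> carrier (Q (Suc j))" unfolding c(2) by (rule mhom_closed[OF \<delta> c(1)])
    have "cobdry N m D (Suc j) x l = \<zero>\<^bsub>N\<^esub>" if "l < m (Suc (Suc j))" for l
    proof -
      have "cobdry N m D (Suc j) x l = cobdry N m D (Suc j) (cobdry N m D j c) l"
        using W.cobdry_closed[OF N QN[OF c(1)]] that
        by (intro W.cobdry_cong N) (auto simp: c \<delta>_def)
      then show ?thesis using W.cobdry_cobdry[OF N QN[OF c(1)] that] by simp
    qed
    then have "\<delta> (Suc j) x = \<zero>\<^bsub>Q (Suc (Suc j))\<^esub>"
      using xQ by (simp add: \<delta>_def Q_def[of "Suc (Suc j)"] zero_power zero_N cong: restrict_cong)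
    then show "x \<in> {x \<in> carrier (Q (Suc j)). \<delta> (Suc j) x = \<zero>\<^bsub>Q (Suc (Suc j))\<^esub>}" using xQ by simp
  qed
  define B where "B = \<delta> a ` carrier (Q a)"
  have subQ: "submodule (carrier (Q j)) R (Q j)" for j
  proof -
    interpret Qj: left_module R "Q j" by (rule Q)
    show ?thesis by (simp add: Qj.is_submodule_iff Qj.act_closed)
  qed
  have B: "submodule B R (Q (Suc a))" unfolding B_def by (rule image_submodule[OF Q Q \<delta> subQ])
  interpret Qa: left_module R "Q (Suc a)" by (rule Q)
  show ?case
  proof (rule exact_atI)
    fix h' assume h': "h' \<in> {..<m (Suc a)} \<rightarrow> carrier N"
      "\<And>l. l < m (Suc (Suc a)) \<Longrightarrow> cobdry N m D (Suc a) h' l = \<zero>\<^bsub>N\<^esub>"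
    define h where "h = restrict h' {..<m (Suc a)}"
    have h: "h \<in> carrier (Q (Suc a))" using h'(1) by (auto simp: h_def Q_def carrier_power carrier_N)
    have h0: "cobdry N m D (Suc a) h l = \<zero>\<^bsub>N\<^esub>" if "l < m (Suc (Suc a))" for l
      using h'(2)[OF that] W.cobdry_cong[OF N h'(1) that, of h] by (simp add: h_def)
    \<comment> \<open>The annihilator of the class of \<open>h\<close> modulo \<open>B\<close>: the
      complex built from it represents the cyclic module generated by that class.\<close>
    define L where "L = {r \<in> carrier R. r \<odot>\<^bsub>Q (Suc a)\<^esub> h \<in> B}"
    have "\<exists>m' D'. weak_resolution R M m' D' \<and> m' (Suc 0) = Suc 0 \<and> (\<forall>j<m' (Suc (Suc 0)). D' (Suc 0) 0 j \<in> L)"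
    proof (rule balanced_modules.ex_weak_resolution[OF swap])
      show "L \<subseteq> carrier R" by (auto simp: L_def)
      fix y assume y: "y \<in> carrier M" "\<And>r. r \<in> L \<Longrightarrow> r \<odot>\<^bsub>M\<^esub> y = \<zero>\<^bsub>M\<^esub>"
      show "y = \<zero>\<^bsub>M\<^esub>"
      proof (rule cohomology_torsion[OF inj(2) inj(4) inj(6) cog wres])
        show "0 < n" using less.prems by simp
        show "(\<lambda>l\<in>{..<m (Suc a)}. cobdry N m D a c l) \<in> B" if c: "c \<in> {..<m a} \<rightarrow> carrier M" for c
        proof (unfold B_def, rule image_eqI)
          show "restrict c {..<m a} \<in> carrier (Q a)" using c by (auto simp: Q_def carrier_power)
          then show "(\<lambda>l\<in>{..<m (Suc a)}. cobdry N m D a c l) = \<delta> a (restrict c {..<m a})"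
            unfolding \<delta>_def using c
            by (simp, intro restrict_ext) (auto simp: carrier_N intro!: W.cobdry_cong N)
        qed
        show "r \<odot>\<^bsub>M\<^esub> y = \<zero>\<^bsub>M\<^esub>" if "r \<in> carrier R" "r \<odot>\<^bsub>power_module {..<m (Suc a)} M\<^esub> h \<in> B" for r
          using that by (intro y(2)) (simp add: L_def Q_def)
      qed (use h h0 B y in \<open>simp_all add: Q_def\<close>)
    qed
    then obtain m' D' where wres': "weak_resolution R M m' D'" and m'1: "m' (Suc 0) = Suc 0"
      and D'L: "\<And>j. j < m' (Suc (Suc 0)) \<Longrightarrow> D' (Suc 0) 0 j \<in> L" by auto
    interpret V: weak_resolution R M m' D' by (rule wres')
    have exQ: "exact_at (Q j) m' D' (carrier (Q j)) i" if "i < n" for i j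
      unfolding Q_def using V.exact_at_of_cogenerated[OF res cog that] by (intro V.exact_at_power M) auto
    \<comment> \<open>Each passage from one image to the next costs one degree, so the bound
      \<open>Suc a\<close> leaves degree 1 at \<open>j = a\<close>. The start is the zero module
      because \<open>m 0 = 0\<close>.\<close>
    have chain: "j \<le> a \<Longrightarrow> i + j \<le> Suc a \<Longrightarrow> exact_at (Q (Suc j)) m' D' (\<delta> j ` carrier (Q j)) i" for i j
    proof (induction j arbitrary: i)
      case 0
      have "\<delta> 0 c = \<zero>\<^bsub>Q (Suc 0)\<^esub>" if "c \<in> carrier (Q 0)" for c
        using that by (simp add: \<delta>_def Q_def[of "Suc 0"] zero_power cobdry_def W.rank_0 N.lincomb_empty zero_N)
      moreover have "carrier (Q 0) \<noteq> {}" by (simp add: Q_def carrier_power W.rank_0)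
      ultimately have "\<delta> 0 ` carrier (Q 0) = {\<zero>\<^bsub>Q (Suc 0)\<^esub>}" by auto
      then show ?case using V.exact_at_zero[OF Q] by simp
    next
      case (Suc j)
      have "exact_at (Q (Suc j)) m' D' {x \<in> carrier (Q (Suc j)). \<delta> (Suc j) x = \<zero>\<^bsub>Q (Suc (Suc j))\<^esub>} (Suc i)"
        using Suc by (subst ker_\<delta>) auto
      moreover have "exact_at (Q (Suc j)) m' D' (carrier (Q (Suc j))) i"
        using Suc.prems less.prems by (intro exQ) simp
      ultimately show ?case by (intro V.exact_at_image[OF Q Q \<delta>])
    qed
    have exB: "exact_at (Q (Suc a)) m' D' B (Suc 0)" unfolding B_def by (rule chain) auto
    have hc: "(\<lambda>_. h) \<in> {..<m' (Suc 0)} \<rightarrow> carrier (Q (Suc a))" using h by auto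
    have row: "cobdry (Q (Suc a)) m' D' (Suc 0) (\<lambda>_. h) j = D' (Suc 0) 0 j \<odot>\<^bsub>Q (Suc a)\<^esub> h"
      if j: "j < m' (Suc (Suc 0))" for j
    proof -
      have "D' (Suc 0) 0 j \<in> carrier R" using D'L[OF j] by (simp add: L_def)
      then show ?thesis using h
        by (simp add: cobdry_def m'1 lessThan_Suc lincomb_def Qa.M.finsum_insert Qa.M.finsum_empty Qa.act_closed)
    qed
    have "cobdry (Q (Suc a)) m' D' (Suc 0) (\<lambda>_. h) \<in> {..<m' (Suc (Suc 0))} \<rightarrow> B"
      using row D'L by (auto simp: L_def)
    then obtain b where b: "b \<in> {..<m' (Suc 0)} \<rightarrow> B" "\<And>j. j < m' (Suc (Suc 0)) \<Longrightarrow>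
        cobdry (Q (Suc a)) m' D' (Suc 0) (\<lambda>_. h) j = cobdry (Q (Suc a)) m' D' (Suc 0) b j"
      using V.cobdry_cobdry[OF Q hc] by (rule exact_atD[OF exB]; blast intro: that)
    have BQ: "x \<in> carrier (Q (Suc a))" if "x \<in> B" for x using B that by (auto simp: Qa.is_submodule_iff)
    have bQ: "b \<in> {..<m' (Suc 0)} \<rightarrow> carrier (Q (Suc a))" using b(1) BQ by blast
    \<comment> \<open>The lift of the class of \<open>h\<close>: \<open>b\<close> is chosen so that
      its coboundary vanishes, and degree 0 exactness in the power forces it to be zero. Since
      \<open>m' (Suc 0) = Suc 0\<close>, only index 0 occurs.\<close>
    define w where "w i = h \<oplus>\<^bsub>Q (Suc a)\<^esub> \<ominus>\<^bsub>Q (Suc a)\<^esub> b i" for i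
    have "w \<in> {..<m' (Suc 0)} \<rightarrow> carrier (Q (Suc a))" using h bQ by (auto simp: w_def Pi_iff)
    moreover have "cobdry (Q (Suc a)) m' D' (Suc 0) w l = \<zero>\<^bsub>Q (Suc a)\<^esub>" if l: "l < m' (Suc (Suc 0))" for l
      unfolding w_def V.cobdry_diff[OF Q hc bQ l] b(2)[OF l]
      using V.cobdry_closed[OF Q bQ l] by (rule Qa.M.r_neg)
    moreover have "exact_at (Q (Suc a)) m' D' (carrier (Q (Suc a))) 0" using less.prems by (intro exQ) simp
    ultimately obtain v where v: "v \<in> {..<m' 0} \<rightarrow> carrier (Q (Suc a))"
      "\<And>j. j < m' (Suc 0) \<Longrightarrow> w j = cobdry (Q (Suc a)) m' D' 0 v j"
      by (elim exact_atD) blast+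
    have "w 0 = \<zero>\<^bsub>Q (Suc a)\<^esub>" using v(2)[of 0] by (simp add: m'1 cobdry_def V.rank_0 Qa.lincomb_empty)
    then have "h = b 0"
    proof -
      assume w0: "w 0 = \<zero>\<^bsub>Q (Suc a)\<^esub>"
      have b0: "b 0 \<in> carrier (Q (Suc a))" using bQ by (auto simp: m'1)
      show "h = b 0" using w0 h b0 unfolding w_def
        by (metis Qa.M.minus_equality Qa.M.minus_minus Qa.M.a_inv_closed)
    qed
    moreover have "b 0 \<in> B" using b(1) by (auto simp: m'1)
    ultimately obtain c where c: "c \<in> carrier (Q a)" "h = \<delta> a c" by (auto simp: B_def)
    have "h' j = cobdry N m D a c j" if j: "j < m (Suc a)" for j
      using fun_cong[OF c(2), of j] c(1) j by (simp add: h_def \<delta>_def)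
    then show "\<exists>c'. c' \<in> {..<m a} \<rightarrow> carrier N \<and> (\<forall>j<m (Suc a). h' j = cobdry N m D a c' j)"
      using QN[OF c(1)] by (intro exI[of _ c]) simp
  qed
qed

end

section \<open>Separating points of an injective envelope\<close>

context balanced_modules
begin

text \<open>Put \<open>x = e' u\<close>. If \<open>w x = 0\<close> for all solutions \<open>w\<close> in \<open>M\<close> of a finite system of relations that
  hold in \<open>J\<close>, then \<open>w \<mapsto> e (w x)\<close> factors through the residuals of the system. Following this with
  \<open>p : E \<rightarrow> M\<close>, where \<open>p \<circ> e\<close> is multiplication by \<open>s\<close>, exhibits \<open>s x\<close> as a combination of the
  relations. So \<open>p (e u) = s u = 0\<close> for every \<open>p\<close>.\<close>

lemma finite_system_solvable:
  fixes J :: "('s, 'j) module"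
  assumes inj: "injective R E" and e: "e \<in> mhom R M E" "inj_on e (carrier M)" and cog: "cogenerated R M E"
    and J: "left_module S J" and e': "e' \<in> mhom S N J" "inj_on e' (carrier N)"
    and u: "u \<in> carrier N" "u \<noteq> \<zero>\<^bsub>N\<^esub>"
    and \<Psi>: "finite \<Psi>" "\<And>\<rho>. \<rho> \<in> \<Psi> \<Longrightarrow> finite (fst \<rho>) \<and> fst \<rho> \<subseteq> carrier J \<and> snd \<rho> \<in> fst \<rho> \<rightarrow> carrier S \<and>
      lincomb J (fst \<rho>) (snd \<rho>) (\<lambda>y. y) = \<zero>\<^bsub>J\<^esub>"
  shows "\<exists>w\<in>carrier (power_module (carrier J) M).
    (\<forall>\<rho>\<in>\<Psi>. lincomb N (fst \<rho>) (snd \<rho>) w = \<zero>\<^bsub>N\<^esub>) \<and> w (e' u) \<noteq> \<zero>\<^bsub>M\<^esub>"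
proof (rule ccontr)
  assume neg: "\<not> ?thesis"
  note M = M.left_module_axioms and N = N.left_module_axioms
  have E: "left_module R E" using inj by (rule injective_left_module)
  interpret E: left_module R E by (rule E)
  interpret J: left_module S J by (rule J)
  define x where "x = e' u"
  have x: "x \<in> carrier J" unfolding x_def by (rule mhom_closed[OF e'(1) u(1)])
  define F where "F = insert x (\<Union>\<rho>\<in>\<Psi>. fst \<rho>)"
  have F: "finite F" "F \<subseteq> carrier J" "x \<in> F" using \<Psi> x by (auto simp: F_def)
  have \<rho>: "finite (fst \<rho>)" "fst \<rho> \<subseteq> F" "snd \<rho> \<in> fst \<rho> \<rightarrow> carrier S" "lincomb J (fst \<rho>) (snd \<rho>) (\<lambda>y. y) = \<zero>\<^bsub>J\<^esub>"
    if "\<rho> \<in> \<Psi>" for \<rho> using \<Psi>(2)[OF that] that by (auto simp: F_def)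
  \<comment> \<open>Padding with zeros puts all relations over the common finite set
    \<open>F\<close>, so that they form one matrix.\<close>
  define coef where "coef z \<rho> = (if z \<in> fst \<rho> then snd \<rho> z else \<zero>\<^bsub>S\<^esub>)" for z and \<rho> :: "'j set \<times> ('j \<Rightarrow> 's)"
  have coef: "coef z \<rho> \<in> carrier S" if "\<rho> \<in> \<Psi>" for z \<rho> using \<rho>(3)[OF that] by (auto simp: coef_def)
  define P where "P = power_module F M"
  define P' where "P' = power_module \<Psi> M"
  interpret P: left_module R P unfolding P_def by (rule left_module_power) (rule M)
  interpret P': left_module R P' unfolding P'_def by (rule left_module_power) (rule M)
  have form: "(\<lambda>w\<in>carrier P. lincomb N F (\<lambda>z. coef z \<rho>) w) \<in> mhom R P M" if "\<rho> \<in> \<Psi>" for \<rho>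
    unfolding P_def using F(1) that by (intro lincomb_mhom) (auto intro: coef)
  define res where "res w = (\<lambda>\<rho>\<in>\<Psi>. lincomb N F (\<lambda>z. coef z \<rho>) w)" for w
  have res: "res w \<in> carrier P'" if "w \<in> carrier P" for w
    using mhom_closed[OF form that] that by (auto simp: res_def P'_def carrier_power)
  have res_add: "res (v \<oplus>\<^bsub>P\<^esub> w) = res v \<oplus>\<^bsub>P'\<^esub> res w" if "v \<in> carrier P" "w \<in> carrier P" for v w
    unfolding res_def P'_def add_power using mhom_add[OF form that] that by (intro restrict_ext) simp
  have res_act: "res (r \<odot>\<^bsub>P\<^esub> w) = r \<odot>\<^bsub>P'\<^esub> res w" if "r \<in> carrier R" "w \<in> carrier P" for r w
    unfolding res_def P'_def act_power using mhom_act[OF form that] that P.act_closed[OF that]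
    by (intro restrict_ext) simp
  have Px: "w x \<in> carrier M" if "w \<in> carrier P" for w using that F(3) by (auto simp: P_def carrier_power)
  have solution: "w x = \<zero>\<^bsub>M\<^esub>" if w: "w \<in> carrier P" "res w = \<zero>\<^bsub>P'\<^esub>" for w
  proof -
    \<comment> \<open>Unknowns outside \<open>F\<close> occur in no relation of
      \<open>\<Psi>\<close> and are set to zero; the resulting full tuple can be held against
      \<open>neg\<close>.\<close>
    define w' where "w' = (\<lambda>z\<in>carrier J. if z \<in> F then w z else \<zero>\<^bsub>M\<^esub>)"
    have wF: "w \<in> F \<rightarrow> carrier N" using w(1) by (auto simp: P_def carrier_power carrier_N)
    have "w' \<in> carrier (power_module (carrier J) M)" using w(1) by (auto simp: w'_def P_def carrier_power)
    moreover have "lincomb N (fst \<rho>) (snd \<rho>) w' = \<zero>\<^bsub>N\<^esub>" if \<rho>': "\<rho> \<in> \<Psi>" for \<rho>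
    proof -
      have "lincomb N (fst \<rho>) (snd \<rho>) w' = lincomb N (fst \<rho>) (\<lambda>z. coef z \<rho>) w"
        using \<rho>(2)[OF \<rho>'] F(2) wF coef[OF \<rho>'] by (intro N.lincomb_cong) (auto simp: coef_def w'_def)
      also have "\<dots> = lincomb N F (\<lambda>z. coef z \<rho>) w"
        using \<rho>(2)[OF \<rho>'] F(1) wF coef[OF \<rho>'] by (intro N.lincomb_superset[symmetric]) (auto simp: coef_def)
      also have "\<dots> = \<zero>\<^bsub>N\<^esub>"
        using fun_cong[OF w(2), of \<rho>] \<rho>' by (simp add: res_def P'_def zero_power zero_N)
      finally show ?thesis .
    qed
    ultimately have "w' x = \<zero>\<^bsub>M\<^esub>" using neg unfolding x_def[symmetric] by auto
    then show ?thesis using F(3) x by (simp add: w'_def)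
  qed
  define G where "G = {(res w, e (w x)) |w. w \<in> carrier P}"
  have GI: "(res w, e (w x)) \<in> G" if "w \<in> carrier P" for w using that by (auto simp: G_def)
  have "\<exists>g\<in>mhom R P' E. \<forall>(y, z)\<in>G. g y = z"
  proof (rule extend_relation[OF inj P'.left_module_axioms])
    show "G \<subseteq> carrier P' \<times> carrier E" using res Px mhom_closed[OF e(1)] by (auto simp: G_def)
    show "G \<noteq> {}" using GI[OF P.M.zero_closed] by auto
  next
    fix y z y' z' assume "(y, z) \<in> G" "(y', z') \<in> G"
    then obtain v w where v: "v \<in> carrier P" "y = res v" "z = e (v x)" and w: "w \<in> carrier P" "y' = res w" "z' = e (w x)"
      by (auto simp: G_def)
    have "e ((v \<oplus>\<^bsub>P\<^esub> w) x) = z \<oplus>\<^bsub>E\<^esub> z'"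
      using Px[OF v(1)] Px[OF w(1)] F(3) by (simp add: v(3) w(3) P_def add_power mhom_add[OF e(1)])
    then show "(y \<oplus>\<^bsub>P'\<^esub> y', z \<oplus>\<^bsub>E\<^esub> z') \<in> G"
      using GI[OF P.M.a_closed[OF v(1) w(1)]] by (simp add: v(2) w(2) res_add[OF v(1) w(1)])
  next
    fix r y z assume r: "r \<in> carrier R" and "(y, z) \<in> G"
    then obtain w where w: "w \<in> carrier P" "y = res w" "z = e (w x)" by (auto simp: G_def)
    have "e ((r \<odot>\<^bsub>P\<^esub> w) x) = r \<odot>\<^bsub>E\<^esub> z"
      using Px[OF w(1)] F(3) r by (simp add: w(3) P_def act_power mhom_act[OF e(1)])
    then show "(r \<odot>\<^bsub>P'\<^esub> y, r \<odot>\<^bsub>E\<^esub> z) \<in> G"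
      using GI[OF P.act_closed[OF r w(1)]] by (simp add: w(2) res_act[OF r w(1)])
  next
    fix z assume "(\<zero>\<^bsub>P'\<^esub>, z) \<in> G"
    then obtain w where w: "w \<in> carrier P" "\<zero>\<^bsub>P'\<^esub> = res w" "z = e (w x)" by (auto simp: G_def)
    show "z = \<zero>\<^bsub>E\<^esub>" unfolding w(3) solution[OF w(1) w(2)[symmetric]] by (rule mhom_zero[OF M E e(1)])
  qed
  then obtain g where g: "g \<in> mhom R P' E" and "\<forall>(y, z)\<in>G. g y = z" by (rule bexE)
  then have g_res: "g (res w) = e (w x)" if "w \<in> carrier P" for w using GI[OF that] by auto
  have uM: "u \<in> carrier M" using u(1) by (simp add: carrier_N)
  have "e u \<noteq> \<zero>\<^bsub>E\<^esub>"
    using inj_onD[OF e(2), of u "\<zero>\<^bsub>M\<^esub>"] uM u(2) mhom_zero[OF M E e(1)] by (auto simp: zero_N)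
  then obtain p where p: "p \<in> mhom R E M" "p (e u) \<noteq> \<zero>\<^bsub>M\<^esub>"
    using cog mhom_closed[OF e(1) uM] unfolding cogenerated_iff[OF M E] by auto
  obtain s where s: "s \<in> carrier S" "\<forall>v\<in>carrier M. compose (carrier M) p e v = s \<odot>\<^bsub>N\<^esub> v"
    using end_M[OF compose_mhom[OF M e(1) p(1)]] by (rule bexE)
  have pe: "p (e v) = s \<odot>\<^bsub>N\<^esub> v" if "v \<in> carrier M" for v using bspec[OF s(2) that] that by (simp add: compose_def)
  obtain t where t: "t \<in> \<Psi> \<rightarrow> carrier S" and pgt: "\<forall>v\<in>carrier P'. compose (carrier P') p g v = lincomb N \<Psi> t v"
    using power_functional[OF \<Psi>(1) compose_mhom[OF P'.left_module_axioms g p(1), unfolded P'_def]]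
    unfolding P'_def by (rule bexE)
  define k where "k z = (\<Oplus>\<^bsub>S\<^esub>\<rho>\<in>\<Psi>. t \<rho> \<otimes>\<^bsub>S\<^esub> coef z \<rho>)" for z
  have k: "k z \<in> carrier S" for z unfolding k_def using t coef by (auto intro!: N.R.finsum_closed)
  have combine: "s \<odot>\<^bsub>N\<^esub> w x = lincomb N F k w" if w: "w \<in> carrier P" for w
  proof -
    have wF: "w \<in> F \<rightarrow> carrier N" using w by (auto simp: P_def carrier_power carrier_N)
    have "s \<odot>\<^bsub>N\<^esub> w x = p (g (res w))" using pe[OF Px[OF w]] g_res[OF w] by simp
    also have "\<dots> = lincomb N \<Psi> t (res w)"
      using bspec[OF pgt res[OF w]] res[OF w] by (simp add: compose_def)
    also have "\<dots> = lincomb N \<Psi> t (\<lambda>\<rho>. lincomb N F (\<lambda>z. coef z \<rho>) w)"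
      using t wF coef by (intro N.lincomb_cong) (auto simp: res_def intro!: N.lincomb_closed)
    also have "\<dots> = lincomb N F k w"
      unfolding k_def using t wF coef F(1) \<Psi>(1) by (intro N.lincomb_lincomb) auto
    finally show ?thesis .
  qed
  \<comment> \<open>\<open>combine\<close> equates two linear forms on tuples in \<open>N\<close>.
    Testing on tuples with one nonzero entry, faithfulness turns this into an identity in
    \<open>S\<close>, which can be carried over to \<open>J\<close>.\<close>
  have k_eq: "k z = (if z = x then s else \<zero>\<^bsub>S\<^esub>)" if z: "z \<in> F" for z
  proof -
    define s' where "s' = (if z = x then s else \<zero>\<^bsub>S\<^esub>)"
    have s': "s' \<in> carrier S" using s(1) by (simp add: s'_def)
    have "k z \<oplus>\<^bsub>S\<^esub> \<ominus>\<^bsub>S\<^esub> s' = \<zero>\<^bsub>S\<^esub>"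
    proof (rule faithful_N)
      show "k z \<oplus>\<^bsub>S\<^esub> \<ominus>\<^bsub>S\<^esub> s' \<in> carrier S" using k s' by simp
      fix v assume v: "v \<in> carrier N"
      define w where "w = (\<lambda>i\<in>F. if i = z then v else \<zero>\<^bsub>N\<^esub>)"
      have w: "w \<in> carrier P" using v by (auto simp: w_def P_def carrier_power carrier_N zero_N)
      have "lincomb N F k w = lincomb N F k (\<lambda>i. if i = z then v else \<zero>\<^bsub>N\<^esub>)"
        using k v by (intro N.lincomb_cong) (auto simp: w_def)
      also have "\<dots> = k z \<odot>\<^bsub>N\<^esub> v" using k v z F(1) by (intro N.lincomb_unit) auto
      finally have "k z \<odot>\<^bsub>N\<^esub> v = s \<odot>\<^bsub>N\<^esub> w x" using combine[OF w] by simp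
      also have "\<dots> = s' \<odot>\<^bsub>N\<^esub> v"
        using F(3) s(1) v by (auto simp: w_def s'_def N.act_zero_left N.act_zero_right)
      finally show "(k z \<oplus>\<^bsub>S\<^esub> \<ominus>\<^bsub>S\<^esub> s') \<odot>\<^bsub>N\<^esub> v = \<zero>\<^bsub>N\<^esub>"
        using k s' v by (simp add: N.act_l_distr N.act_minus_left N.act_closed N.M.r_neg)
    qed
    then show ?thesis using k[of z] s' unfolding s'_def[symmetric]
      by (metis N.R.minus_equality N.R.minus_minus N.R.a_inv_closed)
  qed
  \<comment> \<open>The identity is evaluated in \<open>J\<close> at the tautological tuple, where
    every relation of \<open>\<Psi>\<close> holds. So \<open>s x = 0\<close>, hence
    \<open>s u = 0\<close>.\<close>
  have idF: "(\<lambda>z. z) \<in> F \<rightarrow> carrier J" using F(2) by auto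
  have "s \<odot>\<^bsub>J\<^esub> x = lincomb J F (\<lambda>z. if z = x then s else \<zero>\<^bsub>S\<^esub>) (\<lambda>z. z)"
    using J.lincomb_delta[OF F(1,3) idF s(1)] by simp
  also have "\<dots> = lincomb J F k (\<lambda>z. z)"
    using k_eq k idF by (intro J.lincomb_cong) auto
  also have "\<dots> = lincomb J \<Psi> t (\<lambda>\<rho>. lincomb J F (\<lambda>z. coef z \<rho>) (\<lambda>z. z))"
    unfolding k_def using t idF coef F(1) \<Psi>(1) by (intro J.lincomb_lincomb[symmetric]) auto
  also have "\<dots> = \<zero>\<^bsub>J\<^esub>"
  proof (rule J.lincomb_zero[OF t])
    fix \<rho> assume \<rho>': "\<rho> \<in> \<Psi>"
    have "lincomb J F (\<lambda>z. coef z \<rho>) (\<lambda>z. z) = lincomb J (fst \<rho>) (\<lambda>z. coef z \<rho>) (\<lambda>z. z)"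
      using \<rho>(2)[OF \<rho>'] F(1) idF coef[OF \<rho>'] by (intro J.lincomb_superset) (auto simp: coef_def)
    also have "\<dots> = lincomb J (fst \<rho>) (snd \<rho>) (\<lambda>z. z)"
      using \<rho>(2,3)[OF \<rho>'] F(2) by (intro J.lincomb_cong) (auto simp: coef_def)
    finally show "lincomb J F (\<lambda>z. coef z \<rho>) (\<lambda>z. z) = \<zero>\<^bsub>J\<^esub>" using \<rho>(4)[OF \<rho>'] by simp
  qed
  finally have "e' (s \<odot>\<^bsub>N\<^esub> u) = e' \<zero>\<^bsub>N\<^esub>"
    using s(1) u(1) by (simp add: mhom_act[OF e'(1)] mhom_zero[OF N J e'(1)] x_def)
  then have "s \<odot>\<^bsub>N\<^esub> u = \<zero>\<^bsub>N\<^esub>"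
    using s(1) u(1) by (intro inj_onD[OF e'(2)]) (auto simp: N.act_closed)
  then show False using p(2) pe[OF uM] by (simp add: zero_N)
qed

text \<open>A homomorphism from \<open>J\<close> to \<open>N\<close> is a tuple indexed by
  \<open>carrier J\<close> satisfying every linear relation that holds in \<open>J\<close>. Finite
  sets of relations are handled by \<open>finite_system_solvable\<close>, and
  \<open>artinian_compact\<close> passes to all of them.\<close>

lemma separate_from_envelope:
  fixes J :: "('s, 'j) module"
  assumes inj: "injective R E" and e: "e \<in> mhom R M E" "inj_on e (carrier M)" and cog: "cogenerated R M E"
    and J: "left_module S J" and e': "e' \<in> mhom S N J" "inj_on e' (carrier N)"
    and u: "u \<in> carrier N" "u \<noteq> \<zero>\<^bsub>N\<^esub>"
  shows "\<exists>\<beta>\<in>mhom S J N. \<beta> (e' u) \<noteq> \<zero>\<^bsub>N\<^esub>"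
proof -
  note M = M.left_module_axioms and N = N.left_module_axioms
  interpret J: left_module S J by (rule J)
  define P where "P = power_module (carrier J) M"
  interpret P: left_module R P unfolding P_def by (rule left_module_power) (rule M)
  define x where "x = e' u"
  have x: "x \<in> carrier J" unfolding x_def by (rule mhom_closed[OF e'(1) u(1)])
  define rels where "rels = {\<rho>. finite (fst \<rho>) \<and> fst \<rho> \<subseteq> carrier J \<and> snd \<rho> \<in> fst \<rho> \<rightarrow> carrier S \<and>
      lincomb J (fst \<rho>) (snd \<rho>) (\<lambda>y. y) = \<zero>\<^bsub>J\<^esub>}"
  define W where "W \<rho> = {w \<in> carrier P. lincomb N (fst \<rho>) (snd \<rho>) w = \<zero>\<^bsub>N\<^esub>}" for \<rho> :: "'j set \<times> ('j \<Rightarrow> 's)"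
  have sub: "submodule (W \<rho>) R P" if "\<rho> \<in> rels" for \<rho>
  proof -
    define f where "f = (\<lambda>w\<in>carrier P. lincomb N (fst \<rho>) (snd \<rho>) w)"
    have f: "f \<in> mhom R P M" unfolding f_def P_def using that by (intro lincomb_mhom) (auto simp: rels_def)
    have "W \<rho> = {w \<in> carrier P. f w \<in> {\<zero>\<^bsub>M\<^esub>}}" by (auto simp: W_def f_def zero_N)
    then show ?thesis using vimage_submodule[OF P.left_module_axioms M f zero_submodule[OF M]] by simp
  qed
  \<comment> \<open>Compactness needs a single value at \<open>x\<close> attained by every finite
    system, while the nonzero values found so far may vary. \<open>V \<Phi>\<close> is the submodule
    of attainable values; once it is least, at \<open>\<Phi>0\<close>, each of its elements stays
    attainable when relations are added.\<close>
  define V where "V \<Phi> = (\<lambda>w\<in>carrier P. w x) ` {w \<in> carrier P. \<forall>\<rho>\<in>\<Phi>. w \<in> W \<rho>}" for \<Phi>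
  have subV: "submodule (V \<Phi>) R M" if "\<Phi> \<subseteq> rels" for \<Phi>
  proof -
    have sub': "submodule (W \<rho>) R P" if "\<rho> \<in> \<Phi>" for \<rho> using that by (intro sub subsetD[OF \<open>\<Phi> \<subseteq> rels\<close>])
    have "submodule {w \<in> carrier P. \<forall>\<rho>\<in>\<Phi>. w \<in> W \<rho>} R P"
      using sub' unfolding P.is_submodule_iff by (auto simp: P.act_closed)
    then show ?thesis unfolding V_def
      using x M by (intro image_submodule[OF P.left_module_axioms M]) (auto simp: P_def intro!: proj_mhom)
  qed
  have "\<exists>\<Phi>\<in>{\<Phi>. finite \<Phi> \<and> \<Phi> \<subseteq> rels}. \<forall>\<Phi>'\<in>{\<Phi>. finite \<Phi> \<and> \<Phi> \<subseteq> rels}. V \<Phi>' \<subseteq> V \<Phi> \<longrightarrow> V \<Phi>' = V \<Phi>"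
    by (rule artinian_module_minimal[OF art_M, of "{}"]) (auto intro: subV)
  then obtain \<Phi>0 where "\<Phi>0 \<in> {\<Phi>. finite \<Phi> \<and> \<Phi> \<subseteq> rels}"
    and min: "\<forall>\<Phi>'\<in>{\<Phi>. finite \<Phi> \<and> \<Phi> \<subseteq> rels}. V \<Phi>' \<subseteq> V \<Phi>0 \<longrightarrow> V \<Phi>' = V \<Phi>0" by (rule bexE)
  then have \<Phi>0: "finite \<Phi>0" "\<Phi>0 \<subseteq> rels" by simp_all
  have "\<exists>w\<in>carrier (power_module (carrier J) M).
      (\<forall>\<rho>\<in>\<Phi>0. lincomb N (fst \<rho>) (snd \<rho>) w = \<zero>\<^bsub>N\<^esub>) \<and> w (e' u) \<noteq> \<zero>\<^bsub>M\<^esub>"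
    using \<Phi>0 by (intro finite_system_solvable[OF inj e cog J e' u]) (auto simp: rels_def)
  then obtain w0 where w0: "w0 \<in> carrier P" "\<And>\<rho>. \<rho> \<in> \<Phi>0 \<Longrightarrow> w0 \<in> W \<rho>" "w0 x \<noteq> \<zero>\<^bsub>M\<^esub>"
    unfolding P_def[symmetric] x_def[symmetric] by (auto simp: W_def)
  define v where "v = w0 x"
  have vV: "v \<in> V \<Phi>0" unfolding v_def V_def using w0(1,2) by (intro image_eqI[of _ _ w0]) auto
  have "\<exists>w\<in>carrier (power_module (carrier J) M). (\<forall>Z\<in>W ` rels. w \<in> Z) \<and> w x = v"
  proof (rule artinian_compact[OF M art_M])
    show "submodule Z R (power_module (carrier J) M)" if "Z \<in> W ` rels" for Z
      using that sub unfolding P_def by auto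
    show "\<exists>F. finite F \<and> F \<subseteq> carrier J \<and>
        (\<forall>w\<in>Z. \<forall>w'\<in>carrier (power_module (carrier J) M). (\<forall>y\<in>F. w y = w' y) \<longrightarrow> w' \<in> Z)" if Z: "Z \<in> W ` rels" for Z
    proof -
      obtain \<rho> where \<rho>: "\<rho> \<in> rels" "Z = W \<rho>" using Z by (rule imageE)
      show ?thesis
      proof (intro exI[of _ "fst \<rho>"] conjI ballI impI)
        show "finite (fst \<rho>)" "fst \<rho> \<subseteq> carrier J" using \<rho>(1) by (auto simp: rels_def)
        fix w w' assume w: "w \<in> Z" "w' \<in> carrier (power_module (carrier J) M)" "\<forall>y\<in>fst \<rho>. w y = w' y"
        have "w \<in> fst \<rho> \<rightarrow> carrier N"
          using w(1) \<rho> by (auto simp: W_def P_def carrier_power carrier_N rels_def)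
        then have "lincomb N (fst \<rho>) (snd \<rho>) w' = lincomb N (fst \<rho>) (snd \<rho>) w"
          using w(3) \<rho>(1) by (intro N.lincomb_cong) (auto simp: rels_def)
        then show "w' \<in> Z" using w(1,2) by (simp add: \<rho>(2) W_def P_def)
      qed
    qed
    show "x \<in> carrier J" by (rule x)
    fix \<Phi> assume "finite \<Phi>" "\<Phi> \<subseteq> W ` rels"
    then obtain \<Psi> where \<Psi>: "\<Psi> \<subseteq> rels" "finite \<Psi>" "\<Phi> = W ` \<Psi>" using finite_subset_image by metis
    have "V (\<Psi> \<union> \<Phi>0) \<subseteq> V \<Phi>0" by (auto simp: V_def)
    then have "V (\<Psi> \<union> \<Phi>0) = V \<Phi>0" using min \<Psi>(1,2) \<Phi>0 by simp
    then have "v \<in> V (\<Psi> \<union> \<Phi>0)" using vV by simp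
    then obtain w where "w \<in> carrier P" "\<forall>\<rho>\<in>\<Psi> \<union> \<Phi>0. w \<in> W \<rho>" "v = w x" by (auto simp: V_def)
    then show "\<exists>w\<in>carrier (power_module (carrier J) M). (\<forall>Z\<in>\<Phi>. w \<in> Z) \<and> w x = v"
      unfolding \<Psi>(3) P_def by auto
  qed
  then obtain w where w: "w \<in> carrier P" "\<And>\<rho>. \<rho> \<in> rels \<Longrightarrow> w \<in> W \<rho>" "w x = v" unfolding P_def by auto
  have wN: "w y \<in> carrier N" if "y \<in> carrier J" for y using w(1) that by (auto simp: P_def carrier_power carrier_N)
  have rel: "lincomb N F c w = \<zero>\<^bsub>N\<^esub>"
    if "finite F" "F \<subseteq> carrier J" "c \<in> F \<rightarrow> carrier S" "lincomb J F c (\<lambda>y. y) = \<zero>\<^bsub>J\<^esub>" for F c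
    using w(2)[of "(F, c)"] that by (auto simp: rels_def W_def)
  text \<open>Linearity of \<open>w\<close> is read off from relations with three and two terms, written as sums of delta
    functions because the points involved may coincide.\<close>
  let ?\<delta> = "\<lambda>k r i. if i = k then r else \<zero>\<^bsub>S\<^esub>"
  have cancel: "a = b" if "a \<in> carrier N" "b \<in> carrier N" "a \<oplus>\<^bsub>N\<^esub> (\<ominus>\<^bsub>S\<^esub> \<one>\<^bsub>S\<^esub>) \<odot>\<^bsub>N\<^esub> b = \<zero>\<^bsub>N\<^esub>" for a b
    using that by (metis N.act_minus_one N.M.minus_equality N.M.minus_minus N.M.a_inv_closed)
  have add: "w (a \<oplus>\<^bsub>J\<^esub> b) = w a \<oplus>\<^bsub>N\<^esub> w b" if ab: "a \<in> carrier J" "b \<in> carrier J" for a b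
  proof -
    let ?F = "{a, b, a \<oplus>\<^bsub>J\<^esub> b}"
    define c where "c = (\<lambda>i. (?\<delta> a \<one>\<^bsub>S\<^esub> i \<oplus>\<^bsub>S\<^esub> ?\<delta> b \<one>\<^bsub>S\<^esub> i) \<oplus>\<^bsub>S\<^esub> ?\<delta> (a \<oplus>\<^bsub>J\<^esub> b) (\<ominus>\<^bsub>S\<^esub> \<one>\<^bsub>S\<^esub>) i)"
    have split: "lincomb C ?F c f = (f a \<oplus>\<^bsub>C\<^esub> f b) \<oplus>\<^bsub>C\<^esub> (\<ominus>\<^bsub>S\<^esub> \<one>\<^bsub>S\<^esub>) \<odot>\<^bsub>C\<^esub> f (a \<oplus>\<^bsub>J\<^esub> b)"
      if C: "left_module S C" and f: "f \<in> ?F \<rightarrow> carrier C" for C :: "('s, 'x) module" and f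
    proof -
      interpret C: left_module S C by (rule C)
      have \<delta>: "?\<delta> k r \<in> ?F \<rightarrow> carrier S" if "r \<in> carrier S" for k r using that by auto
      have "lincomb C ?F c f = lincomb C ?F (\<lambda>i. ?\<delta> a \<one>\<^bsub>S\<^esub> i \<oplus>\<^bsub>S\<^esub> ?\<delta> b \<one>\<^bsub>S\<^esub> i) f \<oplus>\<^bsub>C\<^esub>
          lincomb C ?F (?\<delta> (a \<oplus>\<^bsub>J\<^esub> b) (\<ominus>\<^bsub>S\<^esub> \<one>\<^bsub>S\<^esub>)) f"
        unfolding c_def using f by (intro C.lincomb_add_left \<delta>) auto
      also have "lincomb C ?F (\<lambda>i. ?\<delta> a \<one>\<^bsub>S\<^esub> i \<oplus>\<^bsub>S\<^esub> ?\<delta> b \<one>\<^bsub>S\<^esub> i) f =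
          lincomb C ?F (?\<delta> a \<one>\<^bsub>S\<^esub>) f \<oplus>\<^bsub>C\<^esub> lincomb C ?F (?\<delta> b \<one>\<^bsub>S\<^esub>) f"
        using f by (intro C.lincomb_add_left \<delta>) auto
      finally show ?thesis
        using f by (simp add: C.lincomb_delta C.act_one)
    qed
    have "lincomb N ?F c w = \<zero>\<^bsub>N\<^esub>"
    proof (rule rel)
      show "lincomb J ?F c (\<lambda>y. y) = \<zero>\<^bsub>J\<^esub>"
        using ab by (subst split[OF J]) (auto simp: J.act_minus_one J.M.r_neg)
    qed (use ab in \<open>auto simp: c_def\<close>)
    then have eq: "(w a \<oplus>\<^bsub>N\<^esub> w b) \<oplus>\<^bsub>N\<^esub> (\<ominus>\<^bsub>S\<^esub> \<one>\<^bsub>S\<^esub>) \<odot>\<^bsub>N\<^esub> w (a \<oplus>\<^bsub>J\<^esub> b) = \<zero>\<^bsub>N\<^esub>"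
      using ab wN by (subst (asm) split[OF N]) auto
    show ?thesis by (rule cancel[OF _ _ eq, symmetric]) (use ab wN in simp_all)
  qed
  have act: "w (s \<odot>\<^bsub>J\<^esub> a) = s \<odot>\<^bsub>N\<^esub> w a" if sa: "s \<in> carrier S" "a \<in> carrier J" for s a
  proof -
    let ?F = "{a, s \<odot>\<^bsub>J\<^esub> a}"
    define c where "c = (\<lambda>i. ?\<delta> a s i \<oplus>\<^bsub>S\<^esub> ?\<delta> (s \<odot>\<^bsub>J\<^esub> a) (\<ominus>\<^bsub>S\<^esub> \<one>\<^bsub>S\<^esub>) i)"
    have split: "lincomb C ?F c f = s \<odot>\<^bsub>C\<^esub> f a \<oplus>\<^bsub>C\<^esub> (\<ominus>\<^bsub>S\<^esub> \<one>\<^bsub>S\<^esub>) \<odot>\<^bsub>C\<^esub> f (s \<odot>\<^bsub>J\<^esub> a)"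
      if C: "left_module S C" and f: "f \<in> ?F \<rightarrow> carrier C" for C :: "('s, 'x) module" and f
    proof -
      interpret C: left_module S C by (rule C)
      have "lincomb C ?F c f = lincomb C ?F (?\<delta> a s) f \<oplus>\<^bsub>C\<^esub> lincomb C ?F (?\<delta> (s \<odot>\<^bsub>J\<^esub> a) (\<ominus>\<^bsub>S\<^esub> \<one>\<^bsub>S\<^esub>)) f"
        unfolding c_def using f sa by (intro C.lincomb_add_left) auto
      then show ?thesis using f sa by (simp add: C.lincomb_delta)
    qed
    have "lincomb N ?F c w = \<zero>\<^bsub>N\<^esub>"
    proof (rule rel)
      show "lincomb J ?F c (\<lambda>y. y) = \<zero>\<^bsub>J\<^esub>"
        using sa by (subst split[OF J]) (auto simp: J.act_minus_one J.M.r_neg J.act_closed)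
    qed (use sa in \<open>auto simp: c_def J.act_closed\<close>)
    then have eq: "s \<odot>\<^bsub>N\<^esub> w a \<oplus>\<^bsub>N\<^esub> (\<ominus>\<^bsub>S\<^esub> \<one>\<^bsub>S\<^esub>) \<odot>\<^bsub>N\<^esub> w (s \<odot>\<^bsub>J\<^esub> a) = \<zero>\<^bsub>N\<^esub>"
      using sa wN by (subst (asm) split[OF N]) (auto simp: J.act_closed)
    show ?thesis by (rule cancel[OF _ _ eq, symmetric]) (use sa wN in \<open>simp_all add: J.act_closed N.act_closed\<close>)
  qed
  have "restrict w (carrier J) \<in> mhom S J N" using wN add act by (intro restrict_mhom J) auto
  moreover have "restrict w (carrier J) (e' u) \<noteq> \<zero>\<^bsub>N\<^esub>"
    using x w(3) w0(3) unfolding x_def[symmetric] by (simp add: v_def zero_N)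
  ultimately show ?thesis by (intro bexI[of _ "restrict w (carrier J)"])
qed

end

text \<open>A homomorphism that does not kill a multiple of \<open>y\<close> does not kill
  \<open>y\<close>, so this reduces separating points of an envelope to separating points of the
  essential submodule.\<close>

lemma essential_multiple:
  assumes J: "left_module S J" and ess: "essential S J K" and y: "y \<in> carrier J" "y \<noteq> \<zero>\<^bsub>J\<^esub>"
  shows "\<exists>s\<in>carrier S. s \<odot>\<^bsub>J\<^esub> y \<in> K \<and> s \<odot>\<^bsub>J\<^esub> y \<noteq> \<zero>\<^bsub>J\<^esub>"
proof -
  interpret J: left_module S J by (rule J)
  define Y where "Y = (\<lambda>s. s \<odot>\<^bsub>J\<^esub> y) ` carrier S"
  have sub: "submodule Y S J" unfolding J.is_submodule_iff
  proof (intro conjI ballI)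
    show "Y \<subseteq> carrier J" using y(1) by (auto simp: Y_def J.act_closed)
    show "\<zero>\<^bsub>J\<^esub> \<in> Y" using y(1) unfolding Y_def by (intro image_eqI[of _ _ "\<zero>\<^bsub>S\<^esub>"]) (auto simp: J.act_zero_left)
    show "z \<oplus>\<^bsub>J\<^esub> z' \<in> Y" if "z \<in> Y" "z' \<in> Y" for z z'
      using that y(1) by (auto simp: Y_def J.act_l_distr[symmetric])
    show "s \<odot>\<^bsub>J\<^esub> z \<in> Y" if "s \<in> carrier S" "z \<in> Y" for s z
      using that y(1) by (auto simp: Y_def J.act_assoc[symmetric])
  qed
  have "y \<in> Y" using y(1) unfolding Y_def by (intro image_eqI[of _ _ "\<one>\<^bsub>S\<^esub>"]) (auto simp: J.act_one)
  then have "Y \<noteq> {\<zero>\<^bsub>J\<^esub>}" using y(2) by auto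
  then have "K \<inter> Y \<noteq> {\<zero>\<^bsub>J\<^esub>}" using ess sub by (simp add: essential_def)
  moreover have "\<zero>\<^bsub>J\<^esub> \<in> K \<inter> Y"
    using ess sub by (simp add: essential_def J.is_submodule_iff)
  ultimately have "\<exists>z\<in>K \<inter> Y. z \<noteq> \<zero>\<^bsub>J\<^esub>" by blast
  then show ?thesis by (auto simp: Y_def)
qed

section \<open>Induction along the minimal injective resolution\<close>

context balanced_modules
begin

text \<open>Past \<open>J 0\<close>, an element killed by all homomorphisms to \<open>N\<close> has
  a nonzero multiple \<open>x\<close> in the kernel of \<open>d' k\<close>, and \<open>x\<close>
  generates a torsion module. Its Ext into \<open>N\<close> vanishes through degree \<open>k\<close>
  by \<open>exact_at_transfer\<close>, so shifting along the earlier terms, cogenerated by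
  induction, leaves no nonzero homomorphism to that kernel.\<close>

lemma cogenerated_transfer:
  assumes res: "injective_resolution R M I d e" and cog: "\<And>b. b < n \<Longrightarrow> cogenerated R M (I b)"
    and min: "minimal_injective_resolution S N J d' e'" and "k < n"
  shows "cogenerated S N (J k)"
  using \<open>k < n\<close>
proof (induction k rule: less_induct)
  case (less k)
  note N = N.left_module_axioms
  have res': "injective_resolution S N J d' e'" using min by (simp add: minimal_injective_resolution_def)
  note I = injective_resolutionD[OF res] and J = injective_resolutionD[OF res']
  interpret Jk: left_module S "J k" by (rule J(3))
  show ?case
  proof (cases k)
    case 0
    have ess: "essential S (J 0) (e' ` carrier N)" using min by (simp add: minimal_injective_resolution_def)
    show ?thesis unfolding 0 cogenerated_iff[OF N J(3)]
    proof (intro ballI impI)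
      fix y assume y: "y \<in> carrier (J 0)" "y \<noteq> \<zero>\<^bsub>J 0\<^esub>"
      obtain s u where s: "s \<in> carrier S" "u \<in> carrier N" "s \<odot>\<^bsub>J 0\<^esub> y = e' u" "s \<odot>\<^bsub>J 0\<^esub> y \<noteq> \<zero>\<^bsub>J 0\<^esub>"
        using essential_multiple[OF J(3) ess y] by auto
      have "u \<noteq> \<zero>\<^bsub>N\<^esub>" using s(3,4) mhom_zero[OF N J(3) J(4)] by auto
      moreover have "cogenerated R M (I 0)" using less.prems 0 by (intro cog) simp
      ultimately obtain \<beta> where \<beta>: "\<beta> \<in> mhom S (J 0) N" "\<beta> (e' u) \<noteq> \<zero>\<^bsub>N\<^esub>"
        using separate_from_envelope[OF I(2) I(4) I(6) _ J(3) J(4) J(6) s(2)] by auto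
      have "\<beta> y \<noteq> \<zero>\<^bsub>N\<^esub>"
      proof
        assume "\<beta> y = \<zero>\<^bsub>N\<^esub>"
        then have "\<beta> (s \<odot>\<^bsub>J 0\<^esub> y) = \<zero>\<^bsub>N\<^esub>" using s(1) y(1) by (simp add: mhom_act[OF \<beta>(1)] N.act_zero_right)
        then show False using \<beta>(2) s(3) by simp
      qed
      then show "\<exists>\<beta>\<in>mhom S (J 0) N. \<beta> y \<noteq> \<zero>\<^bsub>N\<^esub>" using \<beta>(1) by (intro bexI[of _ \<beta>])
    qed
  next
    case (Suc i)
    have ess: "essential S (J k) (d' i ` carrier (J i))" using min by (simp add: minimal_injective_resolution_def Suc)
    have cog0: "cogenerated S N (J 0)" using less.prems Suc by (intro less.IH) auto
    show ?thesis unfolding cogenerated_iff[OF N J(3)]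
    proof (intro ballI impI, rule ccontr)
      fix y assume y: "y \<in> carrier (J k)" "y \<noteq> \<zero>\<^bsub>J k\<^esub>" and "\<not> (\<exists>\<beta>\<in>mhom S (J k) N. \<beta> y \<noteq> \<zero>\<^bsub>N\<^esub>)"
      then have kill: "\<beta> y = \<zero>\<^bsub>N\<^esub>" if "\<beta> \<in> mhom S (J k) N" for \<beta> using that by auto
      obtain s where s: "s \<in> carrier S" "s \<odot>\<^bsub>J k\<^esub> y \<in> d' i ` carrier (J i)" "s \<odot>\<^bsub>J k\<^esub> y \<noteq> \<zero>\<^bsub>J k\<^esub>"
        using essential_multiple[OF J(3) ess y] by auto
      define x where "x = s \<odot>\<^bsub>J k\<^esub> y"
      have x: "x \<in> carrier (J k)" "x \<noteq> \<zero>\<^bsub>J k\<^esub>" "d' k x = \<zero>\<^bsub>J (Suc k)\<^esub>"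
        using s J(8)[of i] unfolding x_def[symmetric] Suc[symmetric] by auto
      have kill_x: "\<beta> x = \<zero>\<^bsub>N\<^esub>" if "\<beta> \<in> mhom S (J k) N" for \<beta>
        unfolding x_def using kill[OF that] s(1) y(1) by (simp add: mhom_act[OF that] N.act_zero_right)
      \<comment> \<open>The annihilator of \<open>x\<close>; the weak resolution obtained from it
        stands for the submodule generated by \<open>x\<close>.\<close>
      define A where "A = {r \<in> carrier S. r \<odot>\<^bsub>J k\<^esub> x = \<zero>\<^bsub>J k\<^esub>}"
      have "\<exists>m D. weak_resolution S N m D \<and> m (Suc 0) = Suc 0 \<and> (\<forall>j<m (Suc (Suc 0)). D (Suc 0) 0 j \<in> A)"
      proof (rule ex_weak_resolution)
        show "A \<subseteq> carrier S" by (auto simp: A_def)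
        fix u assume u: "u \<in> carrier N" and Au: "\<And>r. r \<in> A \<Longrightarrow> r \<odot>\<^bsub>N\<^esub> u = \<zero>\<^bsub>N\<^esub>"
        interpret J0: left_module S "J 0" by (rule J(3))
        \<comment> \<open>If \<open>A\<close> kills \<open>u\<close>, then
          \<open>x \<mapsto> e' u\<close> is well defined on multiples of \<open>x\<close> and
          extends to \<open>J k\<close>. Followed by maps from the cogenerated module
          \<open>J 0\<close> to \<open>N\<close> it must kill \<open>x\<close>, so
          \<open>e' u = 0\<close>.\<close>
        define G where "G = {(r \<odot>\<^bsub>J k\<^esub> x, r \<odot>\<^bsub>J 0\<^esub> e' u) |r. r \<in> carrier S}"
        have eu: "e' u \<in> carrier (J 0)" by (rule mhom_closed[OF J(4) u])
        have "\<exists>h\<in>mhom S (J k) (J 0). \<forall>(z, z')\<in>G. h z = z'"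
        proof (rule extend_relation[OF J(2) J(3)])
          show "G \<subseteq> carrier (J k) \<times> carrier (J 0)" using x(1) eu by (auto simp: G_def Jk.act_closed J0.act_closed)
          show "G \<noteq> {}" by (auto simp: G_def)
          show "(z \<oplus>\<^bsub>J k\<^esub> z1, z' \<oplus>\<^bsub>J 0\<^esub> z1') \<in> G" if "(z, z') \<in> G" "(z1, z1') \<in> G" for z z' z1 z1'
            using that x(1) eu by (auto simp: G_def Jk.act_l_distr[symmetric] J0.act_l_distr[symmetric])
          show "(r \<odot>\<^bsub>J k\<^esub> z, r \<odot>\<^bsub>J 0\<^esub> z') \<in> G" if "r \<in> carrier S" "(z, z') \<in> G" for r z z'
            using that x(1) eu by (auto simp: G_def Jk.act_assoc[symmetric] J0.act_assoc[symmetric])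
          fix z assume "(\<zero>\<^bsub>J k\<^esub>, z) \<in> G"
          then obtain r where r: "r \<in> carrier S" "r \<odot>\<^bsub>J k\<^esub> x = \<zero>\<^bsub>J k\<^esub>" "z = r \<odot>\<^bsub>J 0\<^esub> e' u" by (auto simp: G_def)
          have "r \<odot>\<^bsub>N\<^esub> u = \<zero>\<^bsub>N\<^esub>" using r by (intro Au) (simp add: A_def)
          then show "z = \<zero>\<^bsub>J 0\<^esub>"
            using r(1,3) mhom_act[OF J(4) r(1) u] mhom_zero[OF N J(3) J(4)] by simp
        qed
        then obtain h where h: "h \<in> mhom S (J k) (J 0)" and hG: "\<forall>(z, z')\<in>G. h z = z'" by (rule bexE)
        have "(x, e' u) \<in> G" unfolding G_def using x(1) eu
          by (intro CollectI exI[of _ "\<one>\<^bsub>S\<^esub>"]) (simp add: Jk.act_one J0.act_one)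
        then have hx: "h x = e' u" using hG by auto
        have "e' u = \<zero>\<^bsub>J 0\<^esub>"
        proof (rule ccontr)
          assume "e' u \<noteq> \<zero>\<^bsub>J 0\<^esub>"
          then obtain p where p: "p \<in> mhom S (J 0) N" "p (e' u) \<noteq> \<zero>\<^bsub>N\<^esub>"
            using cog0 eu unfolding cogenerated_iff[OF N J(3)] by auto
          show False using kill_x[OF compose_mhom[OF J(3) h p(1)]] p(2) x(1) hx by (simp add: compose_def)
        qed
        then show "u = \<zero>\<^bsub>N\<^esub>"
          using u mhom_zero[OF N J(3) J(4)] by (intro inj_onD[OF J(6)]) auto
      qed
      then obtain m D where wres: "weak_resolution S N m D" and m1: "m (Suc 0) = Suc 0"
        and DA: "\<And>j. j < m (Suc (Suc 0)) \<Longrightarrow> D (Suc 0) 0 j \<in> A" by auto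
      interpret W: weak_resolution S N m D by (rule wres)
      \<comment> \<open>The constant tuple \<open>x\<close> is the homomorphism sending the
        generator to \<open>x\<close>. Since \<open>m 0 = 0\<close>, exactness in degree 0 says that
        it is zero.\<close>
      have "exact_at (J k) m D {x \<in> carrier (J k). d' k x = \<zero>\<^bsub>J (Suc k)\<^esub>} 0"
      proof (rule W.exact_at_cosyzygy[OF res'])
        show "cogenerated S N (J b)" if "b < k" for b using that less.prems by (intro less.IH) auto
        show "exact_at N m D (carrier N) a" if "a \<le> k" for a
          using that less.prems by (intro exact_at_transfer[OF res cog wres]) auto
      qed
      moreover have "(\<lambda>_. x) \<in> {..<m (Suc 0)} \<rightarrow> {x \<in> carrier (J k). d' k x = \<zero>\<^bsub>J (Suc k)\<^esub>}" using x by auto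
      moreover have "cobdry (J k) m D (Suc 0) (\<lambda>_. x) l = \<zero>\<^bsub>J k\<^esub>" if "l < m (Suc (Suc 0))" for l
        using DA[OF that] x(1)
        by (simp add: A_def cobdry_def m1 lessThan_Suc lincomb_def Jk.M.finsum_insert Jk.M.finsum_empty)
      ultimately obtain c where "\<And>j. j < m (Suc 0) \<Longrightarrow> x = cobdry (J k) m D 0 c j" by (elim exact_atD) blast+
      then have "x = \<zero>\<^bsub>J k\<^esub>" using m1 by (simp add: cobdry_def W.rank_0 Jk.lincomb_empty)
      then show False using x(2) by contradiction
    qed
  qed
qed

end

text \<open>Injectivity of the two natural maps gives faithfulness, surjectivity gives
  \<open>end_M\<close> and \<open>end_N\<close>, and finite generation over artin algebras gives the
  artinian conditions.\<close>

lemma bimodule_balanced_modules: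
  assumes "artin_algebra k \<phi> \<Lambda>" "artin_algebra h \<psi> \<Gamma>" "faithfully_balanced_selforthogonal \<Lambda> \<Gamma> U"
  shows "balanced_modules \<Lambda> (left_mod U) (opp_ring \<Gamma>) (right_mod U)"
proof -
  let ?M = "left_mod U" and ?N = "right_mod U"
  have simps: "carrier ?M = carrier U" "carrier ?N = carrier U" "\<zero>\<^bsub>?M\<^esub> = \<zero>\<^bsub>U\<^esub>" "\<zero>\<^bsub>?N\<^esub> = \<zero>\<^bsub>U\<^esub>"
    "ring.add ?M = ring.add U" "ring.add ?N = ring.add U"
    "\<And>a u. a \<odot>\<^bsub>?M\<^esub> u = lact U a u" "\<And>g u. g \<odot>\<^bsub>?N\<^esub> u = ract U u g"
    by (simp_all add: left_mod_def right_mod_def)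
  note fb = assms(3)[unfolded faithfully_balanced_selforthogonal_def bimodule_def]
  have M: "left_module \<Lambda> ?M" and N: "left_module (opp_ring \<Gamma>) ?N" and fgM: "fin_gen \<Lambda> ?M"
    and fgN: "fin_gen (opp_ring \<Gamma>) ?N"
    and isoL: "(\<lambda>a. \<lambda>u\<in>carrier U. lact U a u) \<in> ring_iso \<Lambda> (end_ring (opp_ring \<Gamma>) ?N)"
    and isoG: "(\<lambda>g. \<lambda>u\<in>carrier U. ract U u g) \<in> ring_iso \<Gamma> (opp_ring (end_ring \<Lambda> ?M))"
    and comm: "\<forall>a\<in>carrier \<Lambda>. \<forall>u\<in>carrier U. \<forall>g\<in>carrier \<Gamma>. ract U (lact U a u) g = lact U a (ract U u g)"
    using fb by simp_all
  interpret M: left_module \<Lambda> ?M by (rule M)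
  interpret N: left_module "opp_ring \<Gamma>" ?N by (rule N)
  have bijL: "bij_betw (\<lambda>a. \<lambda>u\<in>carrier U. lact U a u) (carrier \<Lambda>) (mhom (opp_ring \<Gamma>) ?N ?N)"
    using isoL by (simp add: ring_iso_def end_ring_def)
  have bijG: "bij_betw (\<lambda>g. \<lambda>u\<in>carrier U. ract U u g) (carrier \<Gamma>) (mhom \<Lambda> ?M ?M)"
    using isoG by (simp add: ring_iso_def end_ring_def)
  show ?thesis
  proof (intro balanced_modules.intro balanced_modules_axioms.intro M N)
    show "r \<odot>\<^bsub>?M\<^esub> (s \<odot>\<^bsub>?N\<^esub> u) = s \<odot>\<^bsub>?N\<^esub> (r \<odot>\<^bsub>?M\<^esub> u)"
      if "r \<in> carrier \<Lambda>" "s \<in> carrier (opp_ring \<Gamma>)" "u \<in> carrier ?M" for r s u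
      using comm that by (simp add: simps)
    show "r = \<zero>\<^bsub>\<Lambda>\<^esub>" if "r \<in> carrier \<Lambda>" "\<And>u. u \<in> carrier ?M \<Longrightarrow> r \<odot>\<^bsub>?M\<^esub> u = \<zero>\<^bsub>?M\<^esub>" for r
    proof (rule inj_onD[OF bij_betw_imp_inj_on[OF bijL]])
      show "(\<lambda>u\<in>carrier U. lact U r u) = (\<lambda>u\<in>carrier U. lact U \<zero>\<^bsub>\<Lambda>\<^esub> u)"
        using that(2) M.act_zero_left by (intro restrict_ext) (simp add: simps)
    qed (use that in auto)
    show "s = \<zero>\<^bsub>opp_ring \<Gamma>\<^esub>" if "s \<in> carrier (opp_ring \<Gamma>)" "\<And>u. u \<in> carrier ?N \<Longrightarrow> s \<odot>\<^bsub>?N\<^esub> u = \<zero>\<^bsub>?N\<^esub>" for s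
    proof (rule inj_onD[OF bij_betw_imp_inj_on[OF bijG]])
      show "(\<lambda>u\<in>carrier U. ract U u s) = (\<lambda>u\<in>carrier U. ract U u \<zero>\<^bsub>opp_ring \<Gamma>\<^esub>)"
        using that(2) N.act_zero_left by (intro restrict_ext) (simp add: simps)
    qed (use that N.R.zero_closed in auto)
    show "\<exists>s\<in>carrier (opp_ring \<Gamma>). \<forall>u\<in>carrier ?M. f u = s \<odot>\<^bsub>?N\<^esub> u" if f: "f \<in> mhom \<Lambda> ?M ?M" for f
    proof -
      obtain s where "s \<in> carrier \<Gamma>" "f = (\<lambda>u\<in>carrier U. ract U u s)"
        using bij_betw_imp_surj_on[OF bijG] f by auto
      then show ?thesis by (intro bexI[of _ s]) (simp_all add: simps)
    qed
    show "\<exists>r\<in>carrier \<Lambda>. \<forall>u\<in>carrier ?N. f u = r \<odot>\<^bsub>?M\<^esub> u" if f: "f \<in> mhom (opp_ring \<Gamma>) ?N ?N" for f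
    proof -
      obtain r where "r \<in> carrier \<Lambda>" "f = (\<lambda>u\<in>carrier U. lact U r u)"
        using bij_betw_imp_surj_on[OF bijL] f by auto
      then show ?thesis by (intro bexI[of _ r]) (simp_all add: simps)
    qed
    show "artinian_module \<Lambda> ?M" by (rule fin_gen_artinian[OF fgM artin_algebra_artinian(1)[OF assms(1)]])
    show "artinian_module (opp_ring \<Gamma>) ?N"
      by (rule fin_gen_artinian[OF fgN artin_algebra_artinian(2)[OF assms(2)]])
  qed (simp_all add: simps)
qed

theorem theorem1p3:
  fixes k :: "'k ring" and \<phi> :: "'k \<Rightarrow> 'l" and \<Lambda> :: "'l ring"
    and h :: "'h ring" and \<psi> :: "'h \<Rightarrow> 'g" and \<Gamma> :: "'g ring"
    and U :: "('l, 'g, 'u) bimod"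
    and I :: "nat \<Rightarrow> ('l, 'i) module" and J :: "nat \<Rightarrow> ('g, 'j) module"
  assumes "artin_algebra k \<phi> \<Lambda>" and "artin_algebra h \<psi> \<Gamma>"
    and "faithfully_balanced_selforthogonal \<Lambda> \<Gamma> U"
    and "minimal_injective_resolution \<Lambda> (left_mod U) I d e"
    and "minimal_injective_resolution (opp_ring \<Gamma>) (right_mod U) J d' e'"
  shows "dom_dim \<Lambda> (left_mod U) I = dom_dim (opp_ring \<Gamma>) (right_mod U) J"
proof -
  interpret balanced_modules \<Lambda> "left_mod U" "opp_ring \<Gamma>" "right_mod U"
    using assms(1-3) by (rule bimodule_balanced_modules)
  interpret op: balanced_modules "opp_ring \<Gamma>" "right_mod U" \<Lambda> "left_mod U" by (rule swap)
  have resI: "injective_resolution \<Lambda> (left_mod U) I d e"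
    and resJ: "injective_resolution (opp_ring \<Gamma>) (right_mod U) J d' e'"
    using assms(4,5) by (simp_all add: minimal_injective_resolution_def)
  have "dom_dim_ge \<Lambda> (left_mod U) I n \<longleftrightarrow> dom_dim_ge (opp_ring \<Gamma>) (right_mod U) J n" for n
    unfolding dom_dim_ge_def
  proof (intro iffI allI impI)
    show "cogenerated (opp_ring \<Gamma>) (right_mod U) (J b)"
      if "\<forall>b<n. cogenerated \<Lambda> (left_mod U) (I b)" "b < n" for b
      by (rule cogenerated_transfer[OF resI _ assms(5) that(2)]) (rule that(1)[rule_format])
    show "cogenerated \<Lambda> (left_mod U) (I b)"
      if "\<forall>b<n. cogenerated (opp_ring \<Gamma>) (right_mod U) (J b)" "b < n" for b
      by (rule op.cogenerated_transfer[OF resJ _ assms(4) that(2)]) (rule that(1)[rule_format])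
  qed
  then show ?thesis by (simp add: dom_dim_def)
qed

end
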